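(* Let $\Gamma$ be a countable group and $\Sigma_1,\Sigma_2<\Gamma$ subgroups such that $L(\Sigma_1)\prec_{L(\Gamma)}L(\Sigma_2)'\cap L(\Gamma)$. Then there exist $k\in\Gamma$ and finite index subgroups $\Omega_1<k\Sigma_1k^{-1}$ and $\Omega_2<\Sigma_2$ such that the group $[\Omega_1,\Omega_2]$ generated by all commutators $g^{-1}h^{-1}gh$ with $g\in\Omega_1,h\in\Omega_2$ is finite and satisfies $[\Omega_1,\Omega_2]\subset C_\Gamma(\Omega_1)\cap C_\Gamma(\Omega_2)$.
   Context: $C_\Gamma(T)=\{g\in\Gamma: gh=hg \text{ for all } h\in T\}$. For a tracial von Neumann algebra $M$ and von Neumann subalgebras $P\subset pMp$, $Q\subset qMq$, $P\prec_MQ$ means there exist projections $p_0\in P,q_0\in Q$, a $*$-homomorphism $\theta:p_0Pp_0\to q_0Qq_0$ and a non-zero partial isometry $v\in q_0Mp_0$ with $\theta(x)v=vx$ for all $x\in p_0Pp_0$. *)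

theory Defs
  imports "HOL-Analysis.Infinite_Sum" "HOL-Algebra.Generated_Groups" "HOL-Algebra.Coset"
begin

definition centralizer_set :: "('a, 'b) monoid_scheme \<Rightarrow> 'a set \<Rightarrow> 'a set" where
  "centralizer_set G T = {g \<in> carrier G. \<forall>h\<in>T. g \<otimes>\<^bsub>G\<^esub> h = h \<otimes>\<^bsub>G\<^esub> g}"

definition conj_set :: "('a, 'b) monoid_scheme \<Rightarrow> 'a \<Rightarrow> 'a set \<Rightarrow> 'a set" where
  "conj_set G k S = {k \<otimes>\<^bsub>G\<^esub> s \<otimes>\<^bsub>G\<^esub> inv\<^bsub>G\<^esub> k | s. s \<in> S}"

definition finite_index_subgroup :: "('a, 'b) monoid_scheme \<Rightarrow> 'a set \<Rightarrow> 'a set \<Rightarrow> bool" where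
  "finite_index_subgroup G H K \<longleftrightarrow>
     subgroup H G \<and> H \<subseteq> K \<and> finite {H #>\<^bsub>G\<^esub> x | x. x \<in> K}"

definition commutator_group :: "('a, 'b) monoid_scheme \<Rightarrow> 'a set \<Rightarrow> 'a set \<Rightarrow> 'a set" where
  "commutator_group G A B = generate G
     {inv\<^bsub>G\<^esub> g \<otimes>\<^bsub>G\<^esub> inv\<^bsub>G\<^esub> h \<otimes>\<^bsub>G\<^esub> g \<otimes>\<^bsub>G\<^esub> h | g h. g \<in> A \<and> h \<in> B}"

type_synonym 'a vec = "'a \<Rightarrow> complex"
type_synonym 'a op = "'a vec \<Rightarrow> 'a vec"

definition l2 :: "('a, 'b) monoid_scheme \<Rightarrow> 'a vec set" where
  "l2 G = {f. (\<forall>x. x \<notin> carrier G \<longrightarrow> f x = 0) \<and>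
                (\<lambda>x. (cmod (f x))\<^sup>2) summable_on carrier G}"

definition l2_inner :: "('a, 'b) monoid_scheme \<Rightarrow> 'a vec \<Rightarrow> 'a vec \<Rightarrow> complex" where
  "l2_inner G f g = infsum (\<lambda>x. cnj (f x) * g x) (carrier G)"

definition l2_norm :: "('a, 'b) monoid_scheme \<Rightarrow> 'a vec \<Rightarrow> real" where
  "l2_norm G f = sqrt (infsum (\<lambda>x. (cmod (f x))\<^sup>2) (carrier G))"

text \<open>Bounded linear operators on l2(G); canonically represented by
  functions that vanish outside l2(G).\<close>
definition bounded_op :: "('a, 'b) monoid_scheme \<Rightarrow> 'a op \<Rightarrow> bool" where
  "bounded_op G T \<longleftrightarrow>
     (\<forall>f\<in>l2 G. T f \<in> l2 G) \<and>
     (\<forall>f\<in>l2 G. \<forall>g\<in>l2 G. \<forall>c. T (\<lambda>x. c * f x + g x) = (\<lambda>x. c * T f x + T g x)) \<and>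
     (\<exists>C. \<forall>f\<in>l2 G. l2_norm G (T f) \<le> C * l2_norm G f) \<and>
     (\<forall>f. f \<notin> l2 G \<longrightarrow> T f = (\<lambda>_. 0))"

definition zero_op :: "'a op" where
  "zero_op = (\<lambda>f x. 0)"

definition add_op :: "'a op \<Rightarrow> 'a op \<Rightarrow> 'a op" where
  "add_op S T = (\<lambda>f x. S f x + T f x)"

definition smult_op :: "complex \<Rightarrow> 'a op \<Rightarrow> 'a op" where
  "smult_op c T = (\<lambda>f x. c * T f x)"

definition adj :: "('a, 'b) monoid_scheme \<Rightarrow> 'a op \<Rightarrow> 'a op" where
  "adj G T = (THE S. bounded_op G S \<and>
      (\<forall>f\<in>l2 G. \<forall>g\<in>l2 G. l2_inner G (T f) g = l2_inner G f (S g)))"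

definition is_projection :: "('a, 'b) monoid_scheme \<Rightarrow> 'a op \<Rightarrow> bool" where
  "is_projection G p \<longleftrightarrow> bounded_op G p \<and> p \<circ> p = p \<and> adj G p = p"

definition partial_isometry :: "('a, 'b) monoid_scheme \<Rightarrow> 'a op \<Rightarrow> bool" where
  "partial_isometry G v \<longleftrightarrow> bounded_op G v \<and> is_projection G (adj G v \<circ> v)"

definition commutant :: "('a, 'b) monoid_scheme \<Rightarrow> 'a op set \<Rightarrow> 'a op set" where
  "commutant G S = {T. bounded_op G T \<and> (\<forall>s\<in>S. T \<circ> s = s \<circ> T)}"

definition lambda_op :: "('a, 'b) monoid_scheme \<Rightarrow> 'a \<Rightarrow> 'a op" where
  "lambda_op G g = (\<lambda>f. if f \<in> l2 G then
       (\<lambda>x. if x \<in> carrier G then f (inv\<^bsub>G\<^esub> g \<otimes>\<^bsub>G\<^esub> x) else 0) else (\<lambda>_. 0))"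

text \<open>For a subgroup Sigma of G, L(Sigma) is the von Neumann algebra on l2(G)
  generated by the unitaries lambda_g, g in Sigma, i.e. its double commutant.
  L(G) = group_vNa G (carrier G).\<close>
definition group_vNa :: "('a, 'b) monoid_scheme \<Rightarrow> 'a set \<Rightarrow> 'a op set" where
  "group_vNa G S = commutant G (commutant G (lambda_op G ` S))"

text \<open>Popa's intertwining relation P \<prec>_M Q (for P, Q unital subalgebras of M).\<close>
definition corner :: "'a op \<Rightarrow> 'a op set \<Rightarrow> 'a op set" where
  "corner p A = {p \<circ> x \<circ> p | x. x \<in> A}"

definition star_hom_on :: "('a, 'b) monoid_scheme \<Rightarrow> 'a op set \<Rightarrow> 'a op set \<Rightarrow> ('a op \<Rightarrow> 'a op) \<Rightarrow> bool" where
  "star_hom_on G A B \<theta> \<longleftrightarrow>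
     (\<forall>x\<in>A. \<theta> x \<in> B) \<and>
     (\<forall>x\<in>A. \<forall>y\<in>A. \<theta> (add_op x y) = add_op (\<theta> x) (\<theta> y)) \<and>
     (\<forall>x\<in>A. \<forall>c. \<theta> (smult_op c x) = smult_op c (\<theta> x)) \<and>
     (\<forall>x\<in>A. \<forall>y\<in>A. \<theta> (x \<circ> y) = \<theta> x \<circ> \<theta> y) \<and>
     (\<forall>x\<in>A. \<theta> (adj G x) = adj G (\<theta> x))"

definition intertwines :: "('a, 'b) monoid_scheme \<Rightarrow> 'a op set \<Rightarrow> 'a op set \<Rightarrow> 'a op set \<Rightarrow> bool" where
  "intertwines G M P Q \<longleftrightarrow>
     (\<exists>p0 q0 \<theta> v. p0 \<in> P \<and> is_projection G p0 \<and> q0 \<in> Q \<and> is_projection G q0 \<and>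
        star_hom_on G (corner p0 P) (corner q0 Q) \<theta> \<and>
        v \<in> M \<and> v = q0 \<circ> v \<circ> p0 \<and> partial_isometry G v \<and> v \<noteq> zero_op \<and>
        (\<forall>x\<in>corner p0 P. \<theta> x \<circ> v = v \<circ> x))"

end

theory Submission
  imports Defs "HOL-Analysis.L2_Norm"
begin

text \<open>
  Let p, q, \<open>\<theta>\<close>, v witness the intertwining, and put \<open>w\<^sub>h = v\<^sup>* \<lambda>\<^sub>h v\<close> for h in the second
  subgroup. Since the values of \<open>\<theta>\<close> commute with \<open>\<lambda>\<^sub>h\<close>, every \<open>w\<^sub>h\<close> commutes with the corner
  \<open>p L(\<Sigma>1) p\<close>, so neither continuity nor contractivity of \<open>\<theta>\<close> is ever needed. As the trace is finite,
  among sufficiently many translates of v two overlap: \<open>w\<^sub>h\<close> has 2-norm bounded below for all h in a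
  generic set (finitely many translates cover \<open>\<Sigma>2\<close>), and for each such h the same argument applied to
  \<open>w\<^sub>h\<^sup>*\<close> shows that \<open>\<lambda>\<^sub>k w\<^sub>h\<close> and \<open>w\<^sub>h \<lambda>\<^sub>k\<close> are far from orthogonal for generic k in \<open>\<Sigma>1\<close>.
  Since \<open>w\<^sub>h\<close> is supported near \<open>F1 h F0\<close> for finite sets F1, F0 independent of h, such a k conjugates
  one element of \<open>F1 h F0\<close> into another one.

  A covering lemma in the style of B. H. Neumann turns this into uniformly finite conjugacy classes: after
  conjugating \<open>\<Sigma>1\<close> and passing to finite index subgroups, the elements of each subgroup have boundedly
  many conjugates under the other. The argument for BFC groups (multiply an element with a maximal
  class by elements centralizing class representatives) then bounds the number of commutators.
\<close>

subsection \<open>Square-summable functions and adjoints\<close>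

text \<open>The obstacle is uniformity: finite conjugacy classes do not suffice, since both the
  exchange of the two subgroups and the choice of an element with a maximal class need one bound for
  all elements. Hence the operator estimates are quantitative. The number of translates and the size
  of the overlap depend only on a norm bound and a lower bound for a 2-norm, which serve all h of
  the generic set at once; \<open>cover_bound\<close> depends only on the number of sets and of
  translates. All that passes from operators to groups is the relation k (a h b) = (c h d) k with
  (a, b) and (c, d) in one finite set. Generic sets need not be subgroups, so the covering lemma
  speaks of quotients s t^-1. The conjugating element of the theorem originates there: (a s b)(a t
  b)^-1 = a (s t^-1) a^-1 forgets b, and conjugation by a is moved to
  \<open>\<Sigma>1\<close>.\<close>

definition dirac :: "'a \<Rightarrow> 'a vec" where
  "dirac x = (\<lambda>y. if y = x then 1 else 0)"

lemma l2_outside: "f \<in> l2 G \<Longrightarrow> x \<notin> carrier G \<Longrightarrow> f x = 0"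
  by (simp add: l2_def)

lemma l2_summable: "f \<in> l2 G \<Longrightarrow> (\<lambda>x. (cmod (f x))\<^sup>2) summable_on carrier G"
  by (simp add: l2_def)

lemma l2_dominated:
  assumes "g summable_on carrier G" "\<And>x. x \<in> carrier G \<Longrightarrow> (cmod (f x))\<^sup>2 \<le> g x"
    and "\<And>x. x \<notin> carrier G \<Longrightarrow> f x = 0"
  shows "f \<in> l2 G"
  using assms by (auto simp: l2_def intro: summable_on_comparison_test)

lemma l2_zero: "(\<lambda>x. 0) \<in> l2 G"
  by (simp add: l2_def)

lemma l2_scale: "f \<in> l2 G \<Longrightarrow> (\<lambda>x. c * f x) \<in> l2 G"
  by (auto simp: l2_def norm_mult power_mult_distrib intro: summable_on_cmult_right)

lemma l2_add:
  assumes "f \<in> l2 G" "g \<in> l2 G"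
  shows "(\<lambda>x. f x + g x) \<in> l2 G"
proof (rule l2_dominated)
  show "(\<lambda>x. 2 * (cmod (f x))\<^sup>2 + 2 * (cmod (g x))\<^sup>2) summable_on carrier G"
    using assms by (intro summable_on_add summable_on_cmult_right l2_summable)
  fix x
  have "(cmod (f x + g x))\<^sup>2 \<le> (cmod (f x) + cmod (g x))\<^sup>2"
    by (intro power_mono norm_triangle_ineq) simp
  also have "\<dots> \<le> 2 * (cmod (f x))\<^sup>2 + 2 * (cmod (g x))\<^sup>2"
    using sum_squares_bound[of "cmod (f x)" "cmod (g x)"] by (simp add: power2_sum)
  finally show "(cmod (f x + g x))\<^sup>2 \<le> 2 * (cmod (f x))\<^sup>2 + 2 * (cmod (g x))\<^sup>2" .
qed (use assms in \<open>simp add: l2_outside\<close>)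

lemma l2_diff: "f \<in> l2 G \<Longrightarrow> g \<in> l2 G \<Longrightarrow> (\<lambda>x. f x - g x) \<in> l2 G"
  using l2_add[of f G "\<lambda>x. (-1) * g x"] l2_scale[of g G "-1"] by simp

lemma l2_sum: "(\<And>i. i \<in> I \<Longrightarrow> f i \<in> l2 G) \<Longrightarrow> (\<lambda>x. \<Sum>i\<in>I. f i x) \<in> l2 G"
  by (induction I rule: infinite_finite_induct) (simp_all add: l2_zero l2_add)

lemma l2_inner_summable:
  assumes "f \<in> l2 G" "g \<in> l2 G"
  shows "(\<lambda>x. cnj (f x) * g x) summable_on carrier G"
proof (rule abs_summable_summable, rule abs_summable_on_comparison_test')
  show "(\<lambda>x. (cmod (f x))\<^sup>2 + (cmod (g x))\<^sup>2) summable_on carrier G"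
    using assms by (intro summable_on_add l2_summable)
  fix x
  have "cmod (f x) * cmod (g x) \<le> 2 * cmod (f x) * cmod (g x)"
    by simp
  also have "\<dots> \<le> (cmod (f x))\<^sup>2 + (cmod (g x))\<^sup>2"
    by (rule sum_squares_bound)
  finally show "norm (cnj (f x) * g x) \<le> (cmod (f x))\<^sup>2 + (cmod (g x))\<^sup>2"
    by (simp add: norm_mult)
qed

lemma l2_inner_cnj: "l2_inner G g f = cnj (l2_inner G f g)"
  unfolding l2_inner_def by (subst infsum_cnj[symmetric]) (simp add: mult.commute)

lemma l2_inner_add_right:
  assumes "f \<in> l2 G" "g \<in> l2 G" "h \<in> l2 G"
  shows "l2_inner G f (\<lambda>x. g x + h x) = l2_inner G f g + l2_inner G f h"
  unfolding l2_inner_def distrib_left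
  by (intro infsum_add l2_inner_summable assms)

lemma l2_inner_scale_right: "l2_inner G f (\<lambda>x. c * g x) = c * l2_inner G f g"
  unfolding l2_inner_def by (subst infsum_cmult_right'[symmetric]) (simp add: ac_simps)

lemma l2_inner_zero_right: "l2_inner G f (\<lambda>x. 0) = 0"
  by (simp add: l2_inner_def)

lemma l2_inner_sum_right:
  assumes "f \<in> l2 G" "\<And>i. i \<in> I \<Longrightarrow> g i \<in> l2 G"
  shows "l2_inner G f (\<lambda>x. \<Sum>i\<in>I. g i x) = (\<Sum>i\<in>I. l2_inner G f (g i))"
  using assms(2)
  by (induction I rule: infinite_finite_induct)
    (simp_all add: l2_inner_zero_right l2_inner_add_right assms(1) l2_sum)

lemma l2_inner_add_left:
  assumes "f \<in> l2 G" "g \<in> l2 G" "h \<in> l2 G"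
  shows "l2_inner G (\<lambda>x. g x + h x) f = l2_inner G g f + l2_inner G h f"
  using l2_inner_add_right[OF assms] l2_inner_cnj[of G _ f] by simp

lemma l2_inner_scale_left: "l2_inner G (\<lambda>x. c * g x) f = cnj c * l2_inner G g f"
  using l2_inner_scale_right[of G f c g] l2_inner_cnj[of G _ f] by simp

lemma l2_inner_sum_left:
  assumes "f \<in> l2 G" "\<And>i. i \<in> I \<Longrightarrow> g i \<in> l2 G"
  shows "l2_inner G (\<lambda>x. \<Sum>i\<in>I. g i x) f = (\<Sum>i\<in>I. l2_inner G (g i) f)"
proof -
  have "l2_inner G f (\<lambda>x. \<Sum>i\<in>I. g i x) = (\<Sum>i\<in>I. l2_inner G f (g i))"
    using assms by (rule l2_inner_sum_right)
  then show ?thesis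
    using l2_inner_cnj[of G _ f] by (simp add: cnj_sum)
qed

lemma l2_norm_nonneg: "0 \<le> l2_norm G f"
  by (simp add: l2_norm_def infsum_nonneg)

lemma l2_norm_sq: "(l2_norm G f)\<^sup>2 = infsum (\<lambda>x. (cmod (f x))\<^sup>2) (carrier G)"
  by (simp add: l2_norm_def infsum_nonneg)

lemma l2_inner_self:
  assumes "f \<in> l2 G"
  shows "l2_inner G f f = of_real ((l2_norm G f)\<^sup>2)"
proof -
  have "((\<lambda>x. (cmod (f x))\<^sup>2) has_sum (l2_norm G f)\<^sup>2) (carrier G)"
    using l2_summable[OF assms] by (simp add: l2_norm_sq)
  then have "((\<lambda>x. complex_of_real ((cmod (f x))\<^sup>2)) has_sum of_real ((l2_norm G f)\<^sup>2)) (carrier G)"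
    by (rule has_sum_of_real)
  then show ?thesis
    unfolding l2_inner_def complex_norm_square by (simp add: infsumI mult.commute)
qed

lemma sum_le_l2_norm_sq:
  assumes "f \<in> l2 G" "finite F" "F \<subseteq> carrier G"
  shows "(\<Sum>x\<in>F. (cmod (f x))\<^sup>2) \<le> (l2_norm G f)\<^sup>2"
  unfolding l2_norm_sq using assms by (intro finite_sum_le_infsum l2_summable) auto

lemma l2_Cauchy_Schwarz:
  assumes "f \<in> l2 G" "g \<in> l2 G"
  shows "cmod (l2_inner G f g) \<le> l2_norm G f * l2_norm G g"
proof -
  let ?p = "\<lambda>x. cnj (f x) * g x"
  have s: "?p abs_summable_on carrier G"
    using l2_inner_summable[OF assms] by (simp add: summable_on_iff_abs_summable_on_complex)
  have "cmod (l2_inner G f g) \<le> infsum (\<lambda>x. cmod (?p x)) (carrier G)"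
    unfolding l2_inner_def using s by (rule norm_infsum_bound)
  also have "\<dots> \<le> l2_norm G f * l2_norm G g"
  proof (rule infsum_le_finite_sums[OF s])
    fix F assume F: "finite F" "F \<subseteq> carrier G"
    have "(\<Sum>x\<in>F. cmod (?p x)) \<le> L2_set (\<lambda>x. cmod (f x)) F * L2_set (\<lambda>x. cmod (g x)) F"
      using L2_set_mult_ineq[of "\<lambda>x. cmod (f x)" "\<lambda>x. cmod (g x)" F] by (simp add: norm_mult)
    also have "\<dots> \<le> l2_norm G f * l2_norm G g"
      using sum_le_l2_norm_sq[OF assms(1) F] sum_le_l2_norm_sq[OF assms(2) F]
      by (intro mult_mono L2_set_nonneg)
        (auto simp: L2_set_def l2_norm_nonneg intro: real_le_lsqrt sum_nonneg)
    finally show "(\<Sum>x\<in>F. cmod (?p x)) \<le> l2_norm G f * l2_norm G g" .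
  qed
  finally show ?thesis .
qed

lemma l2_norm_scale: "l2_norm G (\<lambda>x. c * f x) = cmod c * l2_norm G f"
  by (simp add: l2_norm_def norm_mult power_mult_distrib infsum_cmult_right' real_sqrt_mult)

lemma l2_norm_triangle:
  assumes "f \<in> l2 G" "g \<in> l2 G"
  shows "l2_norm G (\<lambda>x. f x + g x) \<le> l2_norm G f + l2_norm G g"
proof (rule power2_le_imp_le)
  have Re_self: "Re (l2_inner G h h) = (l2_norm G h)\<^sup>2" if "h \<in> l2 G" for h
    by (simp only: l2_inner_self[OF that] Re_complex_of_real)
  have "l2_inner G (\<lambda>x. f x + g x) (\<lambda>x. f x + g x)
      = (l2_inner G f f + l2_inner G g f) + (l2_inner G f g + l2_inner G g g)"
    by (simp only: l2_inner_add_right l2_inner_add_left l2_add assms)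
  then have "Re (l2_inner G (\<lambda>x. f x + g x) (\<lambda>x. f x + g x))
      = Re (l2_inner G f f) + Re (l2_inner G g f) + (Re (l2_inner G f g) + Re (l2_inner G g g))"
    by (simp only: plus_complex.sel)
  moreover have "Re (l2_inner G g f) = Re (l2_inner G f g)"
    by (subst l2_inner_cnj) simp
  ultimately have "(l2_norm G (\<lambda>x. f x + g x))\<^sup>2
      = (l2_norm G f)\<^sup>2 + (l2_norm G g)\<^sup>2 + 2 * Re (l2_inner G f g)"
    by (simp only: Re_self l2_add assms)
  also have "\<dots> \<le> (l2_norm G f + l2_norm G g)\<^sup>2"
    using l2_Cauchy_Schwarz[OF assms] complex_Re_le_cmod[of "l2_inner G f g"]
    by (simp add: power2_sum)
  finally show "(l2_norm G (\<lambda>x. f x + g x))\<^sup>2 \<le> (l2_norm G f + l2_norm G g)\<^sup>2" .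
qed (simp add: l2_norm_nonneg)

lemma l2_norm_diff_triangle:
  assumes "f \<in> l2 G" "g \<in> l2 G" "h \<in> l2 G"
  shows "l2_norm G (\<lambda>x. f x - h x) \<le> l2_norm G (\<lambda>x. f x - g x) + l2_norm G (\<lambda>x. g x - h x)"
  using l2_norm_triangle[OF l2_diff[OF assms(1,2)] l2_diff[OF assms(2,3)]] by simp

lemma dirac_l2: "x \<in> carrier G \<Longrightarrow> dirac x \<in> l2 G"
  by (auto simp: l2_def dirac_def if_distrib cong: if_cong
      intro!: finite_nonzero_values_imp_summable_on)

lemma l2_inner_dirac:
  assumes "x \<in> carrier G"
  shows "l2_inner G (dirac x) f = f x"
proof -
  have "l2_inner G (dirac x) f = infsum (\<lambda>y. f x) {x}"
    unfolding l2_inner_def dirac_def using assms by (intro infsum_cong_neutral) auto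
  then show ?thesis by simp
qed

lemma l2_inner_dirac_right: "x \<in> carrier G \<Longrightarrow> l2_inner G f (dirac x) = cnj (f x)"
  using l2_inner_cnj[of G f "dirac x"] by (simp add: l2_inner_dirac)

lemma l2_norm_dirac: "x \<in> carrier G \<Longrightarrow> l2_norm G (dirac x) = 1"
proof -
  assume x: "x \<in> carrier G"
  have "of_real ((l2_norm G (dirac x))\<^sup>2) = (1::complex)"
    using x by (subst l2_inner_self[symmetric]) (auto simp: dirac_l2 l2_inner_dirac, simp add: dirac_def)
  then have "(l2_norm G (dirac x))\<^sup>2 = 1"
    by (metis of_real_eq_1_iff)
  then show ?thesis
    using l2_norm_nonneg[of G "dirac x"] by (simp add: power2_eq_1_iff)
qed

lemma l2_eqI:
  assumes "f \<in> l2 G" "g \<in> l2 G" "\<And>h. h \<in> l2 G \<Longrightarrow> l2_inner G h f = l2_inner G h g"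
  shows "f = g"
proof
  fix x show "f x = g x"
    using assms(3)[OF dirac_l2, of x] assms(1,2)
    by (cases "x \<in> carrier G") (simp_all add: l2_inner_dirac l2_outside)
qed

lemma l2_restrict: "f \<in> l2 G \<Longrightarrow> (\<lambda>x. if x \<in> F then f x else 0) \<in> l2 G"
  by (rule l2_dominated[OF l2_summable]) (auto simp: l2_outside)

lemma l2_restrict_sum:
  "finite F \<Longrightarrow> (\<lambda>x. if x \<in> F then f x else 0) = (\<lambda>x. \<Sum>y\<in>F. f y * dirac y x)"
  by (auto simp: dirac_def if_distrib sum.delta cong: if_cong)

lemma l2_approx:
  assumes f: "f \<in> l2 G" and e: "e > 0"
  obtains F where "finite F" "F \<subseteq> carrier G"
    "l2_norm G (\<lambda>x. f x - (if x \<in> F then f x else 0)) \<le> e"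
proof -
  let ?s = "\<lambda>x. (cmod (f x))\<^sup>2"
  obtain F where F: "finite F" "F \<subseteq> carrier G" "dist (sum ?s F) (infsum ?s (carrier G)) \<le> e\<^sup>2"
    using infsum_finite_approximation[OF l2_summable[OF f], of "e\<^sup>2"] e by auto
  have sub: "?s summable_on (carrier G - F)"
    using l2_summable[OF f] by (rule summable_on_subset) auto
  have split: "carrier G = F \<union> (carrier G - F)"
    using F(2) by blast
  have "infsum ?s (carrier G) = sum ?s F + infsum ?s (carrier G - F)"
    by (subst split, subst infsum_Un_disjoint) (use F sub in auto)
  then have "infsum ?s (carrier G - F) \<le> e\<^sup>2"
    using F(3) by (simp add: dist_real_def)
  moreover have "infsum (\<lambda>x. (cmod (f x - (if x \<in> F then f x else 0)))\<^sup>2) (carrier G)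
      = infsum ?s (carrier G - F)"
    by (rule infsum_cong_neutral) auto
  ultimately have "l2_norm G (\<lambda>x. f x - (if x \<in> F then f x else 0)) \<le> e"
    using e by (simp add: l2_norm_def real_le_lsqrt)
  with F show ?thesis using that by blast
qed

section \<open>Bounded operators and their adjoints\<close>

lemma bounded_op_l2: "bounded_op G T \<Longrightarrow> f \<in> l2 G \<Longrightarrow> T f \<in> l2 G"
  by (simp add: bounded_op_def)

lemma bounded_op_outside: "bounded_op G T \<Longrightarrow> f \<notin> l2 G \<Longrightarrow> T f = (\<lambda>_. 0)"
  by (simp add: bounded_op_def)

lemma bounded_op_linear:
  "bounded_op G T \<Longrightarrow> f \<in> l2 G \<Longrightarrow> g \<in> l2 G \<Longrightarrow>
    T (\<lambda>x. c * f x + g x) = (\<lambda>x. c * T f x + T g x)"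
  by (simp add: bounded_op_def)

lemma bounded_op_zero:
  assumes "bounded_op G T" shows "T (\<lambda>x. 0) = (\<lambda>x. 0)"
proof -
  have "T (\<lambda>x. 1 * 0 + 0) = (\<lambda>x. 1 * T (\<lambda>x. 0) x + T (\<lambda>x. 0) x)"
    by (rule bounded_op_linear[OF assms l2_zero l2_zero])
  then have "T (\<lambda>x. 0) = (\<lambda>x. T (\<lambda>x. 0) x + T (\<lambda>x. 0) x)"
    by simp
  then have "T (\<lambda>x. 0) x = T (\<lambda>x. 0) x + T (\<lambda>x. 0) x" for x
    by (rule fun_cong)
  then show ?thesis by auto
qed

lemma bounded_op_add:
  assumes "bounded_op G T" "f \<in> l2 G" "g \<in> l2 G"
  shows "T (\<lambda>x. f x + g x) = (\<lambda>x. T f x + T g x)"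
proof -
  have "T (\<lambda>x. 1 * f x + g x) = (\<lambda>x. 1 * T f x + T g x)"
    by (rule bounded_op_linear[OF assms])
  then show ?thesis by simp
qed

lemma bounded_op_scale:
  assumes "bounded_op G T" "f \<in> l2 G"
  shows "T (\<lambda>x. c * f x) = (\<lambda>x. c * T f x)"
proof -
  have "T (\<lambda>x. c * f x + 0) = (\<lambda>x. c * T f x + T (\<lambda>x. 0) x)"
    by (rule bounded_op_linear[OF assms l2_zero])
  then show ?thesis by (simp add: bounded_op_zero[OF assms(1)])
qed

lemma bounded_op_diff:
  assumes "bounded_op G T" "f \<in> l2 G" "g \<in> l2 G"
  shows "T (\<lambda>x. f x - g x) = (\<lambda>x. T f x - T g x)"
  using bounded_op_add[OF assms(1,2) l2_scale[OF assms(3), of "-1"]]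
    bounded_op_scale[OF assms(1,3), of "-1"] by simp

lemma bounded_op_sum:
  assumes "bounded_op G T" "\<And>i. i \<in> I \<Longrightarrow> f i \<in> l2 G"
  shows "T (\<lambda>x. \<Sum>i\<in>I. f i x) = (\<lambda>x. \<Sum>i\<in>I. T (f i) x)"
  using assms(2)
  by (induction I rule: infinite_finite_induct)
    (simp_all add: bounded_op_zero[OF assms(1)] bounded_op_add[OF assms(1)] l2_sum)

text \<open>The constant is made positive because later estimates divide by it, as in
  \<open>uniform_support\<close>.\<close>

lemma bounded_opE:
  assumes "bounded_op G T"
  obtains C where "C > 0" "\<And>f. f \<in> l2 G \<Longrightarrow> l2_norm G (T f) \<le> C * l2_norm G f"
proof -
  obtain C where C: "\<forall>f\<in>l2 G. l2_norm G (T f) \<le> C * l2_norm G f"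
    using assms by (auto simp: bounded_op_def)
  show ?thesis
  proof (rule that[of "max C 1"])
    show "l2_norm G (T f) \<le> max C 1 * l2_norm G f" if "f \<in> l2 G" for f
      using C that mult_right_mono[OF max.cobounded1 l2_norm_nonneg[of G f], of C 1] by force
  qed simp
qed

lemma bounded_opI:
  assumes "\<And>f. f \<in> l2 G \<Longrightarrow> T f \<in> l2 G"
    and "\<And>f g c. f \<in> l2 G \<Longrightarrow> g \<in> l2 G \<Longrightarrow> T (\<lambda>x. c * f x + g x) = (\<lambda>x. c * T f x + T g x)"
    and "\<And>f. f \<in> l2 G \<Longrightarrow> l2_norm G (T f) \<le> C * l2_norm G f"
    and "\<And>f. f \<notin> l2 G \<Longrightarrow> T f = (\<lambda>_. 0)"
  shows "bounded_op G T"
  using assms unfolding bounded_op_def by blast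

lemma bounded_op_comp:
  assumes S: "bounded_op G S" and T: "bounded_op G T"
  shows "bounded_op G (S \<circ> T)"
proof -
  obtain C where C: "C > 0" "\<And>f. f \<in> l2 G \<Longrightarrow> l2_norm G (S f) \<le> C * l2_norm G f"
    using bounded_opE[OF S] by blast
  obtain D where D: "D > 0" "\<And>f. f \<in> l2 G \<Longrightarrow> l2_norm G (T f) \<le> D * l2_norm G f"
    using bounded_opE[OF T] by blast
  show ?thesis
  proof (rule bounded_opI[where C = "C * D"])
    fix f assume f: "f \<in> l2 G"
    have "l2_norm G (S (T f)) \<le> C * l2_norm G (T f)"
      using C(2) bounded_op_l2[OF T f] .
    also have "\<dots> \<le> C * (D * l2_norm G f)"
      using D(2)[OF f] C(1) by simp
    finally show "l2_norm G ((S \<circ> T) f) \<le> C * D * l2_norm G f"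
      by (simp add: mult.assoc)
  next
    fix f g c assume "f \<in> l2 G" "g \<in> l2 G"
    then show "(S \<circ> T) (\<lambda>x. c * f x + g x) = (\<lambda>x. c * (S \<circ> T) f x + (S \<circ> T) g x)"
      by (simp add: bounded_op_linear[OF S] bounded_op_linear[OF T] bounded_op_l2[OF T])
  qed (simp_all add: bounded_op_l2[OF S] bounded_op_l2[OF T] bounded_op_outside[OF T] bounded_op_zero[OF S])
qed

text \<open>Finite combinations of the \<open>dirac x\<close> are dense by \<open>l2_approx\<close>,
  and both sides are continuous in f, so an adjoint relation can be tested on the
  \<open>dirac x\<close>.\<close>

lemma l2_inner_adjoint_of_dirac:
  assumes "bounded_op G T" "bounded_op G S" "g \<in> l2 G" "f \<in> l2 G"
    and eq: "\<And>x. x \<in> carrier G \<Longrightarrow> l2_inner G (T (dirac x)) g = l2_inner G (dirac x) (S g)"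
  shows "l2_inner G (T f) g = l2_inner G f (S g)"
proof -
  obtain C where C: "C > 0" "\<And>f. f \<in> l2 G \<Longrightarrow> l2_norm G (T f) \<le> C * l2_norm G f"
    using bounded_opE[OF assms(1)] by blast
  have Sg: "S g \<in> l2 G" using assms bounded_op_l2 by blast
  let ?K = "C * l2_norm G g + l2_norm G (S g)"
  have K: "?K \<ge> 0" using C by (simp add: l2_norm_nonneg)
  have small: "cmod (l2_inner G (T f) g - l2_inner G f (S g)) \<le> e * ?K" if "e > 0" for e
  proof -
    obtain F where F: "finite F" "F \<subseteq> carrier G"
      "l2_norm G (\<lambda>x. f x - (if x \<in> F then f x else 0)) \<le> e"
      using l2_approx[OF assms(4) \<open>e > 0\<close>] by blast
    define f0 where "f0 = (\<lambda>x. if x \<in> F then f x else 0)"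
    have f0: "f0 \<in> l2 G" unfolding f0_def using assms(4) by (rule l2_restrict)
    define d where "d = (\<lambda>x. f x - f0 x)"
    have d: "d \<in> l2 G" unfolding d_def using assms(4) f0 by (rule l2_diff)
    have f0s: "f0 = (\<lambda>x. \<Sum>y\<in>F. f y * dirac y x)"
      unfolding f0_def using F(1) by (rule l2_restrict_sum)
    have memb: "(\<lambda>x. f y * dirac y x) \<in> l2 G" "dirac y \<in> l2 G" if "y \<in> F" for y
      using that F(2) by (auto intro!: l2_scale dirac_l2)
    have "T f0 = (\<lambda>x. \<Sum>y\<in>F. f y * T (dirac y) x)"
      unfolding f0s using memb by (simp add: bounded_op_sum[OF assms(1)] bounded_op_scale[OF assms(1)])
    then have "l2_inner G (T f0) g = (\<Sum>y\<in>F. cnj (f y) * l2_inner G (T (dirac y)) g)"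
      using memb bounded_op_l2[OF assms(1)] assms(3)
      by (simp add: l2_inner_sum_left l2_scale l2_inner_scale_left)
    also have "\<dots> = (\<Sum>y\<in>F. cnj (f y) * l2_inner G (dirac y) (S g))"
      using F(2) eq by (intro sum.cong) auto
    also have "\<dots> = l2_inner G f0 (S g)"
      unfolding f0s using memb Sg by (simp add: l2_inner_sum_left l2_inner_scale_left)
    finally have e0: "l2_inner G (T f0) g = l2_inner G f0 (S g)" .
    have fd: "f = (\<lambda>x. f0 x + d x)" by (simp add: d_def)
    have "l2_inner G (T f) g - l2_inner G f (S g) = l2_inner G (T d) g - l2_inner G d (S g)"
      by (subst (1 2) fd) (simp add: bounded_op_add[OF assms(1) f0 d] l2_inner_add_left assms(3) Sg
          bounded_op_l2[OF assms(1)] f0 d e0)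
    also have "cmod \<dots> \<le> cmod (l2_inner G (T d) g) + cmod (l2_inner G d (S g))"
      by (rule norm_triangle_ineq4)
    also have "\<dots> \<le> l2_norm G (T d) * l2_norm G g + l2_norm G d * l2_norm G (S g)"
      by (intro add_mono l2_Cauchy_Schwarz d Sg assms(3) bounded_op_l2[OF assms(1)])
    also have "\<dots> \<le> (C * e) * l2_norm G g + e * l2_norm G (S g)"
    proof (intro add_mono mult_right_mono l2_norm_nonneg)
      show "l2_norm G d \<le> e" using F(3) by (simp add: d_def f0_def)
      then show "l2_norm G (T d) \<le> C * e"
        using C(2)[OF d] C(1) by (meson mult_left_mono order.trans less_imp_le)
    qed
    finally show ?thesis by (simp add: algebra_simps)
  qed
  have "cmod (l2_inner G (T f) g - l2_inner G f (S g)) \<le> 0"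
  proof (rule field_le_epsilon)
    fix e :: real assume e: "e > 0"
    \<comment> \<open>\<open>?K\<close> may be 0, hence \<open>?K + 1\<close> in the
      denominator.\<close>
    have "e / (?K + 1) * ?K \<le> e"
      using e K by (simp add: field_simps)
    moreover have "e / (?K + 1) > 0" using e K by simp
    ultimately show "cmod (l2_inner G (T f) g - l2_inner G f (S g)) \<le> 0 + e"
      using small[of "e / (?K + 1)"] by linarith
  qed
  then show ?thesis by simp
qed

text \<open>By the Riesz argument, the adjoint sends g to the family of inner products of the vectors
  T (dirac x) with g.\<close>
lemma adjoint_exists:
  assumes T: "bounded_op G T"
  obtains S where "bounded_op G S"
    "\<And>f g. f \<in> l2 G \<Longrightarrow> g \<in> l2 G \<Longrightarrow> l2_inner G (T f) g = l2_inner G f (S g)"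
proof -
  obtain C where C: "C > 0" "\<And>f. f \<in> l2 G \<Longrightarrow> l2_norm G (T f) \<le> C * l2_norm G f"
    using bounded_opE[OF T] by blast
  define S where "S = (\<lambda>g. if g \<in> l2 G then
      (\<lambda>x. if x \<in> carrier G then l2_inner G (T (dirac x)) g else 0) else (\<lambda>_. 0))"
  have Td: "T (dirac x) \<in> l2 G" if "x \<in> carrier G" for x
    using that by (intro bounded_op_l2[OF T] dirac_l2)
  \<comment> \<open>Test T on the combination f of the \<open>dirac y\<close>, y in F, with
    coefficients \<open>S g y\<close>. The sum in question, \<open>q\<close>, is both the squared
    norm of f and the inner product of T f with g, so Cauchy-Schwarz and one division by the norm of
    f bound it.\<close>
  have part: "(\<Sum>x\<in>F. (cmod (S g x))\<^sup>2) \<le> (C * l2_norm G g)\<^sup>2"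
    if g: "g \<in> l2 G" and F: "finite F" "F \<subseteq> carrier G" for g F
  proof -
    define q where "q = (\<Sum>x\<in>F. (cmod (S g x))\<^sup>2)"
    have q0: "q \<ge> 0" by (simp add: q_def sum_nonneg)
    define f where "f = (\<lambda>x. \<Sum>y\<in>F. S g y * dirac y x)"
    have memb: "(\<lambda>x. S g y * dirac y x) \<in> l2 G" "dirac y \<in> l2 G" if "y \<in> F" for y
      using that F(2) by (auto intro!: l2_scale dirac_l2)
    have f: "f \<in> l2 G" unfolding f_def using memb by (intro l2_sum)
    have fF: "f y = S g y" if "y \<in> F" for y
      using that F(1) by (simp add: f_def dirac_def if_distrib sum.delta cong: if_cong)
    have "of_real ((l2_norm G f)\<^sup>2) = (\<Sum>y\<in>F. cnj (S g y) * l2_inner G (dirac y) f)"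
      using memb f
      by (subst l2_inner_self[OF f, symmetric], subst f_def) (simp add: l2_inner_sum_left l2_inner_scale_left)
    also have "\<dots> = (\<Sum>y\<in>F. cnj (S g y) * S g y)"
      using F(2) fF by (intro sum.cong) (auto simp: l2_inner_dirac)
    also have "\<dots> = of_real q"
      unfolding q_def of_real_sum complex_norm_square by (simp only: mult.commute)
    finally have nf: "(l2_norm G f)\<^sup>2 = q" unfolding of_real_eq_iff .
    have "l2_inner G (T f) g = (\<Sum>y\<in>F. cnj (S g y) * l2_inner G (T (dirac y)) g)"
      using memb g bounded_op_l2[OF T] unfolding f_def
      by (simp add: bounded_op_sum[OF T] bounded_op_scale[OF T] l2_inner_sum_left l2_scale l2_inner_scale_left)
    also have "\<dots> = (\<Sum>y\<in>F. cnj (S g y) * S g y)"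
      using F(2) g by (intro sum.cong) (auto simp: S_def)
    also have "\<dots> = of_real q"
      unfolding q_def of_real_sum complex_norm_square by (simp only: mult.commute)
    finally have "q = cmod (l2_inner G (T f) g)" using q0 by simp
    also have "\<dots> \<le> l2_norm G (T f) * l2_norm G g"
      by (intro l2_Cauchy_Schwarz bounded_op_l2[OF T] f g)
    also have "\<dots> \<le> C * l2_norm G f * l2_norm G g"
      by (intro mult_right_mono C f l2_norm_nonneg)
    finally have "l2_norm G f * l2_norm G f \<le> (C * l2_norm G g) * l2_norm G f"
      using nf by (simp add: power2_eq_square algebra_simps)
    then have "l2_norm G f \<le> C * l2_norm G g" if "l2_norm G f > 0"
      using that by (rule mult_right_le_imp_le)
    moreover have "0 \<le> C * l2_norm G g"
      using C(1) l2_norm_nonneg[of G g] by simp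
    ultimately have "l2_norm G f \<le> C * l2_norm G g"
      using l2_norm_nonneg[of G f] by linarith
    then have "(l2_norm G f)\<^sup>2 \<le> (C * l2_norm G g)\<^sup>2"
      by (intro power_mono l2_norm_nonneg)
    then show ?thesis unfolding nf unfolding q_def .
  qed
  have Sl2: "S g \<in> l2 G" if g: "g \<in> l2 G" for g
  proof -
    have "(\<lambda>x. (cmod (S g x))\<^sup>2) summable_on carrier G"
      by (rule nonneg_bdd_above_summable_on) 
        (use part[OF g] in \<open>auto intro!: bdd_aboveI2[where M = "(C * l2_norm G g)\<^sup>2"]\<close>)
    then show ?thesis using g by (simp add: l2_def S_def)
  qed
  have bS: "bounded_op G S"
  proof (rule bounded_opI[where C = C])
    fix g assume g: "g \<in> l2 G"
    have "(l2_norm G (S g))\<^sup>2 \<le> (C * l2_norm G g)\<^sup>2"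
      unfolding l2_norm_sq[of G "S g"] by (rule infsum_le_finite_sums[OF l2_summable[OF Sl2[OF g]] part[OF g]])
    then show "l2_norm G (S g) \<le> C * l2_norm G g"
      by (rule power2_le_imp_le) (use C(1) in \<open>simp add: l2_norm_nonneg\<close>)
  next
    fix f g c assume "f \<in> l2 G" "g \<in> l2 G"
    then show "S (\<lambda>x. c * f x + g x) = (\<lambda>x. c * S f x + S g x)"
      unfolding S_def by (auto simp: l2_add l2_scale l2_inner_add_right l2_inner_scale_right Td)
  next
    show "S f \<in> l2 G" if "f \<in> l2 G" for f
      using that by (rule Sl2)
    show "S f = (\<lambda>_. 0)" if "f \<notin> l2 G" for f
      unfolding S_def using that by (rule if_not_P)
  qed
  show ?thesis
    by (rule that[OF bS], rule l2_inner_adjoint_of_dirac[OF T bS])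
      (auto simp: l2_inner_dirac, simp add: S_def)
qed

text \<open>Evaluates the \<open>THE\<close> in \<open>adj\<close>. Uniqueness holds for functions
  on all vectors: on \<open>l2 G\<close> inner products separate points, and elsewhere every bounded
  operator is 0 by convention.\<close>

lemma adj_eqI:
  assumes T: "bounded_op G T" and S: "bounded_op G S"
    and eq: "\<And>f g. f \<in> l2 G \<Longrightarrow> g \<in> l2 G \<Longrightarrow> l2_inner G (T f) g = l2_inner G f (S g)"
  shows "adj G T = S"
  unfolding adj_def
proof (rule the_equality)
  fix R assume R: "bounded_op G R \<and>
    (\<forall>f\<in>l2 G. \<forall>g\<in>l2 G. l2_inner G (T f) g = l2_inner G f (R g))"
  show "R = S"
  proof
    fix g show "R g = S g"
    proof (cases "g \<in> l2 G")
      case True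
      show ?thesis
      proof (rule l2_eqI)
        show "R g \<in> l2 G" "S g \<in> l2 G"
          using R S True by (auto intro: bounded_op_l2)
        show "l2_inner G h (R g) = l2_inner G h (S g)" if "h \<in> l2 G" for h
          using R eq[OF that True] that True by metis
      qed
    next
      case False
      then show ?thesis
        using bounded_op_outside[of G R g] bounded_op_outside[OF S, of g] R by simp
    qed
  qed
qed (use assms in blast)

lemma
  assumes T: "bounded_op G T"
  shows bounded_op_adj: "bounded_op G (adj G T)"
    and inner_adj: "f \<in> l2 G \<Longrightarrow> g \<in> l2 G \<Longrightarrow> l2_inner G (T f) g = l2_inner G f (adj G T g)"
proof -
  obtain S where S: "bounded_op G S"
    "\<And>f g. f \<in> l2 G \<Longrightarrow> g \<in> l2 G \<Longrightarrow> l2_inner G (T f) g = l2_inner G f (S g)"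
    using adjoint_exists[OF T] by blast
  have "adj G T = S" by (rule adj_eqI[OF T S])
  with S show "bounded_op G (adj G T)"
    "f \<in> l2 G \<Longrightarrow> g \<in> l2 G \<Longrightarrow> l2_inner G (T f) g = l2_inner G f (adj G T g)"
    by auto
qed

lemma l2_norm_sum:
  assumes "finite I" "\<And>i. i \<in> I \<Longrightarrow> f i \<in> l2 G"
  shows "l2_norm G (\<lambda>x. \<Sum>i\<in>I. f i x) \<le> (\<Sum>i\<in>I. l2_norm G (f i))"
  using assms
proof (induction I rule: finite_induct)
  case empty
  show ?case by (simp add: l2_norm_def)
next
  case (insert i I)
  have fi: "f i \<in> l2 G" and s: "(\<lambda>x. \<Sum>j\<in>I. f j x) \<in> l2 G"
    using insert.prems by (auto intro!: l2_sum)
  have "l2_norm G (\<lambda>x. f i x + (\<Sum>j\<in>I. f j x)) \<le> l2_norm G (f i) + (\<Sum>j\<in>I. l2_norm G (f j))"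
    using l2_norm_triangle[OF fi s] insert by fastforce
  then show ?case using insert.hyps by simp
qed

lemma adj_comp:
  assumes S: "bounded_op G S" and T: "bounded_op G T"
  shows "adj G (S \<circ> T) = adj G T \<circ> adj G S"
  by (rule adj_eqI[OF bounded_op_comp[OF S T] bounded_op_comp[OF bounded_op_adj[OF T] bounded_op_adj[OF S]]])
    (simp add: inner_adj[OF S] inner_adj[OF T] bounded_op_l2[OF T] bounded_op_l2[OF bounded_op_adj[OF S]])

lemma inner_adj_left:
  assumes T: "bounded_op G T" and "f \<in> l2 G" "g \<in> l2 G"
  shows "l2_inner G (adj G T f) g = l2_inner G f (T g)"
  using inner_adj[OF T assms(3,2)] l2_inner_cnj[of G f "T g"] l2_inner_cnj[of G "adj G T f" g] by simp

lemma adj_adj: "bounded_op G T \<Longrightarrow> adj G (adj G T) = T"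
  by (rule adj_eqI) (auto simp: bounded_op_adj inner_adj_left)

lemma bounded_op_isometry:
  assumes "\<And>f. f \<in> l2 G \<Longrightarrow> T f \<in> l2 G"
    and "\<And>f g c. f \<in> l2 G \<Longrightarrow> g \<in> l2 G \<Longrightarrow> T (\<lambda>x. c * f x + g x) = (\<lambda>x. c * T f x + T g x)"
    and "\<And>f. f \<in> l2 G \<Longrightarrow> l2_norm G (T f) = l2_norm G f"
    and "\<And>f. f \<notin> l2 G \<Longrightarrow> T f = (\<lambda>_. 0)"
  shows "bounded_op G T"
  by (rule bounded_opI[where C = 1]) (use assms in auto)

lemma bounded_op_commutant: "T \<in> commutant G S \<Longrightarrow> bounded_op G T"
  by (simp add: commutant_def)

subsection \<open>Generic sets and finite conjugacy classes\<close>

text \<open>The size of the finite set of translates in lemma \<open>generic_of_cover\<close>: discarding one of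
  the covering sets turns a bound f into f + f * f.\<close>
fun cover_bound :: "nat \<Rightarrow> nat \<Rightarrow> nat" where
  "cover_bound 0 f = f"
| "cover_bound (Suc n) f = cover_bound n (f + f * f)"

lemma cover_bound_ge: "f \<le> cover_bound n f"
proof (induction n arbitrary: f)
  case (Suc n)
  show ?case using Suc[of "f + f * f"] by simp
qed simp

text \<open>The element x need not lie in S: the proof measures elements of one subgroup by their
  conjugates under another.\<close>

definition conj_class :: "('a, 'b) monoid_scheme \<Rightarrow> 'a set \<Rightarrow> 'a \<Rightarrow> 'a set" where
  "conj_class G S x = (\<lambda>g. g \<otimes>\<^bsub>G\<^esub> x \<otimes>\<^bsub>G\<^esub> inv\<^bsub>G\<^esub> g) ` S"

text \<open>For a subgroup D of H this is finite index, expressed through left cosets. D is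
  arbitrary because the notion is also applied to sets not known to be subgroups, such as a set of
  elements whose classes obey a given bound.\<close>

definition fin_cover :: "('a, 'b) monoid_scheme \<Rightarrow> 'a set \<Rightarrow> 'a set \<Rightarrow> bool" where
  "fin_cover G D H \<longleftrightarrow> (\<exists>F. finite F \<and> F \<subseteq> H \<and> H \<subseteq> (\<Union>f\<in>F. (\<lambda>d. f \<otimes>\<^bsub>G\<^esub> d) ` D))"

context group
begin

lemma m_inv_cancel [simp]:
  "x \<in> carrier G \<Longrightarrow> y \<in> carrier G \<Longrightarrow> inv x \<otimes> (x \<otimes> y) = y"
  "x \<in> carrier G \<Longrightarrow> y \<in> carrier G \<Longrightarrow> x \<otimes> (inv x \<otimes> y) = y"
  by (simp_all add: m_assoc[symmetric])

text \<open>If the translates of \<open>S i S i\<inverse>\<close> by F i miss some x, then x S i is disjoint from F i S i, hence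
  covered by the translates of the other sets, so S i can be dropped from the cover.\<close>
lemma generic_of_cover:
  assumes H: "subgroup H G" and I: "finite I"
    and F: "\<And>i. i \<in> I \<Longrightarrow> finite (F i) \<and> F i \<subseteq> H \<and> card (F i) \<le> N"
    and S: "\<And>i. i \<in> I \<Longrightarrow> S i \<subseteq> H"
    and cov: "H \<subseteq> (\<Union>i\<in>I. \<Union>f\<in>F i. (\<lambda>s. f \<otimes> s) ` S i)"
  obtains i E where "i \<in> I" "finite E" "E \<subseteq> H" "card E \<le> cover_bound (card I) N"
    "H \<subseteq> (\<Union>f\<in>E. (\<lambda>(s, t). f \<otimes> (s \<otimes> inv t)) ` (S i \<times> S i))"
proof -
  have "\<exists>i\<in>I. \<exists>E. finite E \<and> E \<subseteq> H \<and> card E \<le> cover_bound (card I) N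
    \<and> H \<subseteq> (\<Union>f\<in>E. (\<lambda>(s, t). f \<otimes> (s \<otimes> inv t)) ` (S i \<times> S i))"
    using I F S cov
  proof (induction I arbitrary: F N rule: finite_induct)
    case empty
    then show ?case using subgroup.one_closed[OF H] by auto
  next
    case (insert i I)
    have HG: "H \<subseteq> carrier G" using H by (rule subgroup.subset)
    have Fi: "finite (F i)" "F i \<subseteq> H" "card (F i) \<le> N" and Si: "S i \<subseteq> H"
      using insert.prems(1,2)[of i] by auto
    show ?case
    proof (cases "H \<subseteq> (\<Union>f\<in>F i. (\<lambda>(s, t). f \<otimes> (s \<otimes> inv t)) ` (S i \<times> S i))")
      case True
      have "card (F i) \<le> cover_bound (card (insert i I)) N"
        using Fi(3) cover_bound_ge le_trans by blast
      then show ?thesis using True Fi by blast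
    next
      case False
      then obtain x where x: "x \<in> H"
        and nx: "\<And>f s t. f \<in> F i \<Longrightarrow> s \<in> S i \<Longrightarrow> t \<in> S i \<Longrightarrow> x \<noteq> f \<otimes> (s \<otimes> inv t)"
        by force
      \<comment> \<open>The added translates of \<open>S j\<close> reach the part f S i that is
        given up: f S i = f x^-1 (x S i), and x S i lies in translates g S l with l \<noteq> i.
        Counting them yields the recursion of \<open>cover_bound\<close>.\<close>
      define F' where "F' j = F j \<union> (\<lambda>(f, g). f \<otimes> (inv x \<otimes> g)) ` (F i \<times> F j)" for j
      have F': "finite (F' j) \<and> F' j \<subseteq> H \<and> card (F' j) \<le> N + N * N" if "j \<in> I" for j
      proof (intro conjI)
        have Fj: "finite (F j)" "F j \<subseteq> H" "card (F j) \<le> N"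
          using insert.prems(1)[of j] that by auto
        show "finite (F' j)" using Fi Fj by (simp add: F'_def)
        show "F' j \<subseteq> H"
          using Fi Fj x H by (auto simp: F'_def intro!: subgroup.m_closed subgroup.m_inv_closed)
        have "card ((\<lambda>(f, g). f \<otimes> (inv x \<otimes> g)) ` (F i \<times> F j)) \<le> card (F i \<times> F j)"
          by (rule card_image_le) (use Fi Fj in simp)
        also have "\<dots> \<le> N * N"
          using Fi Fj by (simp add: card_cartesian_product mult_le_mono)
        finally show "card (F' j) \<le> N + N * N"
          unfolding F'_def using Fj(3) card_Un_le[of "F j"] by (meson add_mono le_trans)
      qed
      have cov': "H \<subseteq> (\<Union>j\<in>I. \<Union>f\<in>F' j. (\<lambda>s. f \<otimes> s) ` S j)"
      proof
        fix h assume h: "h \<in> H"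
        then obtain j f s where j: "j \<in> insert i I" "f \<in> F j" "s \<in> S j" "h = f \<otimes> s"
          using insert.prems(3) by blast
        show "h \<in> (\<Union>j\<in>I. \<Union>f\<in>F' j. (\<lambda>s. f \<otimes> s) ` S j)"
        proof (cases "j \<in> I")
          case True
          then show ?thesis using j by (auto simp: F'_def)
        next
          case False
          then have [simp]: "j = i" using j by simp
          have mem: "f \<in> carrier G" "s \<in> carrier G" "x \<in> carrier G"
            using j Fi Si x HG by auto
          have "x \<otimes> s \<in> H"
            using H x j Si by (auto intro: subgroup.m_closed)
          then obtain l g t where l: "l \<in> insert i I" "g \<in> F l" "t \<in> S l" "x \<otimes> s = g \<otimes> t"
            using insert.prems(3) by blast
          have mem2: "g \<in> carrier G" "t \<in> carrier G"
            using insert.prems(1,2) l HG by blast+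
          have "l \<noteq> i"
          proof
            assume "l = i"
            moreover have "x = x \<otimes> s \<otimes> inv s"
              using mem by (simp add: m_assoc)
            then have "x = g \<otimes> (t \<otimes> inv s)"
              using mem mem2 l(4) by (simp add: m_assoc)
            ultimately show False using nx l j by auto
          qed
          then have "l \<in> I" using l by simp
          moreover have "h = f \<otimes> (inv x \<otimes> g) \<otimes> t"
          proof -
            have "f \<otimes> (inv x \<otimes> g) \<otimes> t = f \<otimes> (inv x \<otimes> (g \<otimes> t))"
              using mem mem2 by (simp add: m_assoc)
            also have "\<dots> = h" using mem by (simp add: l(4)[symmetric] j(4))
            finally show ?thesis by simp
          qed
          moreover have "f \<otimes> (inv x \<otimes> g) \<in> F' l"
            using j l by (auto simp: F'_def)
          ultimately show ?thesis using l by blast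
        qed
      qed
      have "\<exists>j\<in>I. \<exists>E. finite E \<and> E \<subseteq> H \<and> card E \<le> cover_bound (card I) (N + N * N)
          \<and> H \<subseteq> (\<Union>f\<in>E. (\<lambda>(s, t). f \<otimes> (s \<otimes> inv t)) ` (S j \<times> S j))"
        by (rule insert.IH[OF F' _ cov']) (use insert.prems(2) in auto)
      then show ?thesis using insert.hyps by auto
    qed
  qed
  then show ?thesis using that by blast
qed

text \<open>Greedy choice: if no set of at most N translates covers H, elements of H can be picked
  one after another outside all translates of T by the earlier ones. N such elements have no
  quotient \<open>inv (x r) \<otimes> x s\<close> with r < s in T, against the hypothesis.\<close>

lemma generic_by_pigeonhole:
  assumes H: "subgroup H G"
    and T: "\<And>x. (\<And>i. i < N \<Longrightarrow> x i \<in> H) \<Longrightarrow> \<exists>r s. r < s \<and> s < N \<and> inv (x r) \<otimes> x s \<in> T"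
  shows "\<exists>E. finite E \<and> E \<subseteq> H \<and> card E \<le> N \<and> H \<subseteq> (\<Union>f\<in>E. (\<lambda>d. f \<otimes> d) ` T)"
proof (rule ccontr)
  assume no: "\<not> ?thesis"
  have HG: "H \<subseteq> carrier G" using H by (rule subgroup.subset)
  have "\<exists>x. (\<forall>i<n. x i \<in> H) \<and> (\<forall>r s. r < s \<and> s < n \<longrightarrow> inv (x r) \<otimes> x s \<notin> T)" if "n \<le> N" for n :: nat
    using that
  proof (induction n)
    case (Suc n)
    then obtain x where x: "\<And>i. i < n \<Longrightarrow> x i \<in> H"
      "\<And>r s. r < s \<Longrightarrow> s < n \<Longrightarrow> inv (x r) \<otimes> x s \<notin> T" by auto
    have "card (x ` {..<n}) \<le> N"
      using card_image_le[of "{..<n}" x] Suc.prems by simp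
    moreover have "x ` {..<n} \<subseteq> H" using x(1) by auto
    moreover have "finite (x ` {..<n})" by simp
    ultimately have "\<not> H \<subseteq> (\<Union>f\<in>x ` {..<n}. (\<lambda>d. f \<otimes> d) ` T)"
      using no by blast
    then obtain y where y: "y \<in> H" "\<And>i d. i < n \<Longrightarrow> d \<in> T \<Longrightarrow> y \<noteq> x i \<otimes> d"
      by blast
    have "inv (x r) \<otimes> y \<notin> T" if "r < n" for r
    proof
      assume "inv (x r) \<otimes> y \<in> T"
      moreover have "y = x r \<otimes> (inv (x r) \<otimes> y)"
        using x(1)[OF that] y(1) HG by (auto simp: subset_eq)
      ultimately show False using y(2)[OF that] by blast
    qed
    then show ?case
      using x y(1) by (intro exI[of _ "x(n := y)"]) (auto simp: less_Suc_eq)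
  qed simp
  from this[OF order_refl] obtain x where "\<And>i. i < N \<Longrightarrow> x i \<in> H"
    "\<And>r s. r < s \<Longrightarrow> s < N \<Longrightarrow> inv (x r) \<otimes> x s \<notin> T" by auto
  then show False using T[of x] by auto
qed

section \<open>Conjugacy classes of one subgroup under another\<close>

lemma conj_class_carrier: "S \<subseteq> carrier G \<Longrightarrow> x \<in> carrier G \<Longrightarrow> conj_class G S x \<subseteq> carrier G"
  by (auto simp: conj_class_def)

lemma conj_class_mult_subset:
  assumes "S \<subseteq> carrier G" "x \<in> carrier G" "y \<in> carrier G"
  shows "conj_class G S (x \<otimes> y) \<subseteq> (\<lambda>(a, b). a \<otimes> b) ` (conj_class G S x \<times> conj_class G S y)"
proof
  fix z assume "z \<in> conj_class G S (x \<otimes> y)"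
  then obtain g where g: "g \<in> S" "z = g \<otimes> (x \<otimes> y) \<otimes> inv g"
    by (auto simp: conj_class_def)
  then have "z = (g \<otimes> x \<otimes> inv g) \<otimes> (g \<otimes> y \<otimes> inv g)"
    using assms subsetD[OF assms(1) g(1)] by (simp add: m_assoc)
  then show "z \<in> (\<lambda>(a, b). a \<otimes> b) ` (conj_class G S x \<times> conj_class G S y)"
    using g(1) by (auto simp: conj_class_def)
qed

lemma conj_class_mult:
  assumes "S \<subseteq> carrier G" "x \<in> carrier G" "y \<in> carrier G"
    and "finite (conj_class G S x)" "finite (conj_class G S y)"
  shows "finite (conj_class G S (x \<otimes> y))"
    and "card (conj_class G S (x \<otimes> y)) \<le> card (conj_class G S x) * card (conj_class G S y)"
proof -
  let ?P = "(\<lambda>(a, b). a \<otimes> b) ` (conj_class G S x \<times> conj_class G S y)"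
  have fin: "finite ?P" using assms by simp
  with conj_class_mult_subset[OF assms(1-3)] show "finite (conj_class G S (x \<otimes> y))"
    by (rule finite_subset)
  have "card (conj_class G S (x \<otimes> y)) \<le> card ?P"
    by (rule card_mono[OF fin conj_class_mult_subset[OF assms(1-3)]])
  also have "\<dots> \<le> card (conj_class G S x \<times> conj_class G S y)"
    by (rule card_image_le) (use assms in simp)
  finally show "card (conj_class G S (x \<otimes> y)) \<le> card (conj_class G S x) * card (conj_class G S y)"
    by (simp add: card_cartesian_product)
qed

lemma conj_class_inv:
  assumes "S \<subseteq> carrier G" "x \<in> carrier G"
  shows "conj_class G S (inv x) = m_inv G ` conj_class G S x"
  unfolding conj_class_def image_image using assms
  by (intro image_cong refl) (auto simp: inv_mult_group m_assoc subset_eq)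

lemma finite_conj_class_inv:
  assumes "S \<subseteq> carrier G" "x \<in> carrier G" "finite (conj_class G S x)"
  shows "finite (conj_class G S (inv x))"
    and "card (conj_class G S (inv x)) \<le> card (conj_class G S x)"
  using assms by (auto simp: conj_class_inv intro: card_image_le)

lemma conj_class_one: "S \<subseteq> carrier G \<Longrightarrow> conj_class G S \<one> \<subseteq> {\<one>}"
  by (auto simp: conj_class_def subset_eq)

lemma subgroup_finite_conj_class:
  assumes H: "subgroup H G" and S: "S \<subseteq> carrier G"
  shows "subgroup {h \<in> H. finite (conj_class G S h)} G"
proof
  have HG: "H \<subseteq> carrier G" using H by (rule subgroup.subset)
  then show "{h \<in> H. finite (conj_class G S h)} \<subseteq> carrier G" by blast
  show "\<one> \<in> {h \<in> H. finite (conj_class G S h)}"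
    using H conj_class_one[OF S] by (auto intro: subgroup.one_closed finite_subset)
  fix x assume x: "x \<in> {h \<in> H. finite (conj_class G S h)}"
  then show "inv x \<in> {h \<in> H. finite (conj_class G S h)}"
    using finite_conj_class_inv[OF S, of x] H HG by (auto intro: subgroup.m_inv_closed)
  fix y assume y: "y \<in> {h \<in> H. finite (conj_class G S h)}"
  show "x \<otimes> y \<in> {h \<in> H. finite (conj_class G S h)}"
    using conj_class_mult(1)[OF S, of x y] x y H HG by (auto intro: subgroup.m_closed)
qed

text \<open>Only the finitely many translates f D with f itself of finite class meet the subgroup of
  elements of finite class, which gives the uniform bound.\<close>
lemma bounded_class_subgroup:
  assumes H: "subgroup H G" and S: "S \<subseteq> carrier G"
    and D: "D \<subseteq> H" "\<And>d. d \<in> D \<Longrightarrow> finite (conj_class G S d) \<and> card (conj_class G S d) \<le> K"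
    and cov: "fin_cover G D H"
  defines "\<Delta> \<equiv> {h \<in> H. finite (conj_class G S h)}"
  shows "fin_cover G \<Delta> H"
    and "\<exists>K'. \<forall>h\<in>\<Delta>. card (conj_class G S h) \<le> K'"
proof -
  have HG: "H \<subseteq> carrier G" using H by (rule subgroup.subset)
  have sub: "subgroup \<Delta> G"
    unfolding \<Delta>_def using H S by (rule subgroup_finite_conj_class)
  obtain F where F: "finite F" "F \<subseteq> H" "H \<subseteq> (\<Union>f\<in>F. (\<lambda>d. f \<otimes> d) ` D)"
    using cov by (auto simp: fin_cover_def)
  have D\<Delta>: "D \<subseteq> \<Delta>" using D by (auto simp: \<Delta>_def)
  have "H \<subseteq> (\<Union>f\<in>F. (\<lambda>d. f \<otimes> d) ` \<Delta>)" using F(3) D\<Delta> by blast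
  then show "fin_cover G \<Delta> H" using F by (auto simp: fin_cover_def)
  \<comment> \<open>A crude bound over all of F; an infinite class contributes 0, the
    \<open>card\<close> of an infinite set.\<close>
  define M where "M = (\<Sum>f\<in>F. card (conj_class G S f))"
  show "\<exists>K'. \<forall>h\<in>\<Delta>. card (conj_class G S h) \<le> K'"
  proof (intro exI ballI)
    fix h assume h: "h \<in> \<Delta>"
    then obtain f d where fd: "f \<in> F" "d \<in> D" "h = f \<otimes> d"
      using F(3) by (auto simp: \<Delta>_def)
    have mem: "f \<in> carrier G" "d \<in> carrier G" using fd F D HG by auto
    have "h \<otimes> inv d \<in> \<Delta>"
      using sub h fd(2) D\<Delta> by (auto intro: subgroup.m_closed subgroup.m_inv_closed)
    moreover have "h \<otimes> inv d = f" using mem fd by (simp add: m_assoc)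
    ultimately have "f \<in> \<Delta>" by simp
    then have "card (conj_class G S h) \<le> card (conj_class G S f) * card (conj_class G S d)"
      unfolding fd(3) using S mem D fd by (intro conj_class_mult) (auto simp: \<Delta>_def)
    also have "\<dots> \<le> M * K"
      using D(2)[OF fd(2)] F(1) fd(1) unfolding M_def by (intro mult_le_mono member_le_sum) auto
    finally show "card (conj_class G S h) \<le> M * K" .
  qed
qed

definition centr_in :: "'a set \<Rightarrow> 'a \<Rightarrow> 'a set" where
  "centr_in S x = {g \<in> S. g \<otimes> x = x \<otimes> g}"

text \<open>The class size is the index of the centralizer. If s and t commute with x, then
  conjugating x by f (s t^-1) is the same as conjugating it by f, so E already produces the whole
  class. The hypothesis \<open>cov\<close> has the form in which \<open>generic_of_cover\<close>
  delivers it.\<close>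

lemma conj_class_of_cover:
  assumes S: "subgroup S G" and x: "x \<in> carrier G" and E: "finite E" "E \<subseteq> S"
    and cov: "S \<subseteq> (\<Union>f\<in>E. (\<lambda>(s, t). f \<otimes> (s \<otimes> inv t)) ` (centr_in S x \<times> centr_in S x))"
  shows "finite (conj_class G S x)" "card (conj_class G S x) \<le> card E"
proof -
  have SG: "S \<subseteq> carrier G" using S by (rule subgroup.subset)
  have "conj_class G S x \<subseteq> (\<lambda>f. f \<otimes> x \<otimes> inv f) ` E"
  proof
    fix z assume "z \<in> conj_class G S x"
    then obtain g where g: "g \<in> S" "z = g \<otimes> x \<otimes> inv g" by (auto simp: conj_class_def)
    then obtain f s t where f: "f \<in> E" "s \<in> centr_in S x" "t \<in> centr_in S x" "g = f \<otimes> (s \<otimes> inv t)"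
      using cov by force
    have mem: "f \<in> carrier G" "s \<in> carrier G" "t \<in> carrier G"
      using f E SG by (auto simp: centr_in_def)
    have tx: "t \<otimes> x = x \<otimes> t" using f(3) by (simp add: centr_in_def)
    have "inv t \<otimes> x = inv t \<otimes> (x \<otimes> t) \<otimes> inv t"
      using mem x by (simp add: m_assoc)
    also have "\<dots> = x \<otimes> inv t"
      unfolding tx[symmetric] using mem x by simp
    finally have t: "inv t \<otimes> x = x \<otimes> inv t" .
    have "s \<otimes> inv t \<otimes> x = s \<otimes> (x \<otimes> inv t)"
      using mem x t by (simp add: m_assoc)
    also have "\<dots> = x \<otimes> (s \<otimes> inv t)"
      using f(2) mem x by (simp add: centr_in_def m_assoc[symmetric])
    finally have c: "s \<otimes> inv t \<otimes> x = x \<otimes> (s \<otimes> inv t)" .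
    have "z = f \<otimes> (s \<otimes> inv t \<otimes> x) \<otimes> inv (f \<otimes> (s \<otimes> inv t))"
      using g f mem x by (simp add: m_assoc)
    also have "\<dots> = f \<otimes> x \<otimes> ((s \<otimes> inv t) \<otimes> inv (s \<otimes> inv t)) \<otimes> inv f"
      unfolding c using mem x by (simp add: m_assoc inv_mult_group)
    also have "\<dots> = f \<otimes> x \<otimes> inv f"
      using mem x by (subst r_inv) simp_all
    finally show "z \<in> (\<lambda>f. f \<otimes> x \<otimes> inv f) ` E" using f by blast
  qed
  moreover have "card ((\<lambda>f. f \<otimes> x \<otimes> inv f) ` E) \<le> card E" using E by (simp add: card_image_le)
  ultimately show "finite (conj_class G S x)" "card (conj_class G S x) \<le> card E"
    using E finite_subset card_mono by (fastforce, meson finite_imageI le_trans)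
qed

text \<open>Any K + 1 elements of A contain two whose quotient commutes with a given element of B; by
  the covering lemma some such quotient has a large centralizer in B.\<close>
lemma bounded_class_swap:
  assumes A: "subgroup A G" and B: "subgroup B G"
    and K: "\<And>b. b \<in> B \<Longrightarrow> finite (conj_class G A b) \<and> card (conj_class G A b) \<le> K"
  shows "\<exists>D K'. D \<subseteq> A \<and> fin_cover G D A \<and>
    (\<forall>d\<in>D. finite (conj_class G B d) \<and> card (conj_class G B d) \<le> K')"
proof -
  have AG: "A \<subseteq> carrier G" and BG: "B \<subseteq> carrier G"
    using A B by (auto dest: subgroup.subset)
  define I where "I = {(r, s). r < s \<and> s < Suc K}"
  have I: "finite I" by (rule finite_subset[of _ "{..K} \<times> {..K}"]) (auto simp: I_def)
  \<comment> \<open>Each centralizer enters the cover of B with the single translate \<one>, hence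
    the initial bound 1. As \<open>I\<close> is built from K, the bound depends on K alone.\<close>
  define K' where "K' = cover_bound (card I) 1"
  define D where "D = {a \<in> A. finite (conj_class G B a) \<and> card (conj_class G B a) \<le> K'}"
  have "\<exists>r s. r < s \<and> s < Suc K \<and> inv (x r) \<otimes> x s \<in> D" if x: "\<And>i. i < Suc K \<Longrightarrow> x i \<in> A" for x
  proof -
    let ?S = "\<lambda>(r, s). centr_in B (inv (x r) \<otimes> x s)"
    have cov: "B \<subseteq> (\<Union>i\<in>I. \<Union>f\<in>{\<one>}. (\<lambda>d. f \<otimes> d) ` ?S i)"
    proof
      fix b assume b: "b \<in> B"
      \<comment> \<open>These K + 1 conjugates of b lie in a class with at most K elements.\<close>
      have "\<not> inj_on (\<lambda>i. x i \<otimes> b \<otimes> inv (x i)) {..<Suc K}"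
      proof
        assume "inj_on (\<lambda>i. x i \<otimes> b \<otimes> inv (x i)) {..<Suc K}"
        moreover have "(\<lambda>i. x i \<otimes> b \<otimes> inv (x i)) ` {..<Suc K} \<subseteq> conj_class G A b"
          using x by (auto simp: conj_class_def)
        ultimately have "card {..<Suc K} \<le> card (conj_class G A b)"
          using K[OF b] by (intro card_inj_on_le) auto
        then show False using K[OF b] by simp
      qed
      then obtain r s where rs: "r < s" "s < Suc K" "x r \<otimes> b \<otimes> inv (x r) = x s \<otimes> b \<otimes> inv (x s)"
        unfolding inj_on_def by (metis lessThan_iff linorder_neqE_nat)
      have mem: "x r \<in> carrier G" "x s \<in> carrier G" "b \<in> carrier G"
        using x[of r] x[of s] rs AG b BG by auto
      have "inv (x r) \<otimes> x s \<otimes> b = inv (x r) \<otimes> (x s \<otimes> b \<otimes> inv (x s)) \<otimes> x s"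
        using mem by (simp add: m_assoc)
      also have "\<dots> = b \<otimes> (inv (x r) \<otimes> x s)"
        unfolding rs(3)[symmetric] using mem by (simp add: m_assoc)
      finally have "b \<in> ?S (r, s)" using b by (simp add: centr_in_def)
      moreover have "(r, s) \<in> I" using rs by (simp add: I_def)
      moreover have "b = \<one> \<otimes> b" using mem by simp
      ultimately show "b \<in> (\<Union>i\<in>I. \<Union>f\<in>{\<one>}. (\<lambda>d. f \<otimes> d) ` ?S i)" by blast
    qed
    obtain i E where i: "i \<in> I" "finite E" "E \<subseteq> B" "card E \<le> cover_bound (card I) 1"
      "B \<subseteq> (\<Union>f\<in>E. (\<lambda>(s, t). f \<otimes> (s \<otimes> inv t)) ` (?S i \<times> ?S i))"
      by (rule generic_of_cover[OF B I _ _ cov, of 1])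
        (use subgroup.one_closed[OF B] in \<open>auto simp: centr_in_def\<close>)
    obtain r s where rs: "i = (r, s)" by fastforce
    have q: "inv (x r) \<otimes> x s \<in> A"
      using i(1) x A by (auto simp: rs I_def intro!: subgroup.m_closed subgroup.m_inv_closed)
    then have "inv (x r) \<otimes> x s \<in> D"
      using conj_class_of_cover[OF B _ i(2,3), of "inv (x r) \<otimes> x s"] i(4,5) AG
      by (auto simp: D_def K'_def rs)
    then show ?thesis using i(1) by (auto simp: rs I_def)
  qed
  then obtain E where "finite E" "E \<subseteq> A" "card E \<le> Suc K" "A \<subseteq> (\<Union>f\<in>E. (\<lambda>d. f \<otimes> d) ` D)"
    using generic_by_pigeonhole[OF A] by metis
  then have "fin_cover G D A" by (auto simp: fin_cover_def)
  then show ?thesis by (intro exI[of _ D] exI[of _ K']) (auto simp: D_def)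
qed

lemma fin_cover_trans:
  assumes K: "subgroup K G" and "H \<subseteq> K" "D \<subseteq> carrier G"
    and "fin_cover G D H" "fin_cover G H K"
  shows "fin_cover G D K"
proof -
  have KG: "K \<subseteq> carrier G" using K by (rule subgroup.subset)
  obtain E where E: "finite E" "E \<subseteq> H" "H \<subseteq> (\<Union>f\<in>E. (\<lambda>d. f \<otimes> d) ` D)"
    using assms(4) by (auto simp: fin_cover_def)
  obtain F where F: "finite F" "F \<subseteq> K" "K \<subseteq> (\<Union>f\<in>F. (\<lambda>d. f \<otimes> d) ` H)"
    using assms(5) by (auto simp: fin_cover_def)
  let ?P = "(\<lambda>(f, e). f \<otimes> e) ` (F \<times> E)"
  have "K \<subseteq> (\<Union>p\<in>?P. (\<lambda>d. p \<otimes> d) ` D)"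
  proof
    fix k assume "k \<in> K"
    then obtain f e d where *: "f \<in> F" "e \<in> E" "d \<in> D" "k = f \<otimes> (e \<otimes> d)"
      using F(3) E(3) by blast
    then have "k = (f \<otimes> e) \<otimes> d"
      using F(2) E(2) assms(2,3) KG by (subst m_assoc) auto
    then show "k \<in> (\<Union>p\<in>?P. (\<lambda>d. p \<otimes> d) ` D)" using * by blast
  qed
  moreover have "?P \<subseteq> K"
    using F(2) E(2) assms(2) K by (auto intro!: subgroup.m_closed)
  ultimately show ?thesis using E F unfolding fin_cover_def
    by (intro exI[of _ ?P]) auto
qed

text \<open>\<open>fin_cover\<close> counts left cosets and \<open>finite_index_subgroup\<close>
  right cosets; inversion turns f H into H f^-1.\<close>

lemma fin_cover_imp_finite_index:
  assumes H: "subgroup H G" and K: "subgroup K G" and "H \<subseteq> K" "fin_cover G H K"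
  shows "finite_index_subgroup G H K"
proof -
  have HG: "H \<subseteq> carrier G" and KG: "K \<subseteq> carrier G"
    using H K by (auto dest: subgroup.subset)
  obtain F where F: "finite F" "F \<subseteq> K" "K \<subseteq> (\<Union>f\<in>F. (\<lambda>d. f \<otimes> d) ` H)"
    using assms(4) by (auto simp: fin_cover_def)
  have "{H #> x | x. x \<in> K} \<subseteq> (\<lambda>f. H #> inv f) ` F"
  proof
    fix C assume "C \<in> {H #> x | x. x \<in> K}"
    then obtain x where x: "x \<in> K" "C = H #> x" by blast
    then have "inv x \<in> K" using K by (simp add: subgroup.m_inv_closed)
    then obtain f h where fh: "f \<in> F" "h \<in> H" "inv x = f \<otimes> h" using F(3) by blast
    have mem: "f \<in> carrier G" "h \<in> carrier G" "x \<in> carrier G" using fh x F HG KG by auto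
    have "x = inv (inv x)" using mem by simp
    also have "\<dots> = inv h \<otimes> inv f" unfolding fh(3) using mem by (simp add: inv_mult_group)
    finally have "C = (H #> inv h) #> inv f"
      using x(2) mem HG by (simp add: coset_mult_assoc)
    also have "H #> inv h = H"
      using H fh(2) mem by (intro coset_join2) (auto intro: subgroup.m_inv_closed)
    finally show "C \<in> (\<lambda>f. H #> inv f) ` F" using fh by blast
  qed
  then have "finite {H #> x | x. x \<in> K}"
    by (rule finite_subset) (use F(1) in simp)
  then show ?thesis
    using H assms(3) by (simp add: finite_index_subgroup_def)
qed

section \<open>Centralizers, commutators and the BFC argument\<close>

lemma subgroup_centralizer_set:
  assumes T: "T \<subseteq> carrier G"
  shows "subgroup (centralizer_set G T) G"
proof
  fix x assume x: "x \<in> centralizer_set G T"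
  have "inv x \<otimes> h = h \<otimes> inv x" if "h \<in> T" for h
  proof -
    have mem: "x \<in> carrier G" "h \<in> carrier G" "x \<otimes> h = h \<otimes> x"
      using x that T by (auto simp: centralizer_set_def)
    have "inv x \<otimes> h = inv x \<otimes> (h \<otimes> x) \<otimes> inv x" using mem(1,2) by (simp add: m_assoc)
    also have "\<dots> = h \<otimes> inv x" unfolding mem(3)[symmetric] using mem(1,2) by simp
    finally show ?thesis .
  qed
  then show "inv x \<in> centralizer_set G T" using x by (simp add: centralizer_set_def)
  fix y assume y: "y \<in> centralizer_set G T"
  have "x \<otimes> y \<otimes> h = h \<otimes> (x \<otimes> y)" if "h \<in> T" for h
  proof -
    have mem: "x \<in> carrier G" "y \<in> carrier G" "h \<in> carrier G" "x \<otimes> h = h \<otimes> x" "y \<otimes> h = h \<otimes> y"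
      using x y that T by (auto simp: centralizer_set_def)
    have "x \<otimes> y \<otimes> h = x \<otimes> h \<otimes> y" using mem(1-3) by (simp add: m_assoc mem(5))
    also have "\<dots> = h \<otimes> (x \<otimes> y)" unfolding mem(4) using mem(1-3) by (simp add: m_assoc)
    finally show ?thesis .
  qed
  then show "x \<otimes> y \<in> centralizer_set G T" using x y by (simp add: centralizer_set_def)
qed (use T in \<open>auto simp: centralizer_set_def\<close>)

text \<open>Send a to the tuple of its conjugates of the members of X. Only finitely many tuples
  occur, and two elements with the same tuple differ by a right factor centralizing X.\<close>

lemma fin_cover_centralizer:
  assumes A: "subgroup A G" and X: "finite X" "X \<subseteq> carrier G"
    and fin: "\<And>x. x \<in> X \<Longrightarrow> finite (conj_class G A x)"
  shows "fin_cover G (A \<inter> centralizer_set G X) A"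
proof -
  have AG: "A \<subseteq> carrier G" using A by (rule subgroup.subset)
  define \<phi> where "\<phi> a = (\<lambda>x\<in>X. a \<otimes> x \<otimes> inv a)" for a
  have "\<phi> ` A \<subseteq> (\<Pi>\<^sub>E x\<in>X. conj_class G A x)"
    by (auto simp: \<phi>_def conj_class_def)
  then have "finite (\<phi> ` A)"
    by (rule finite_subset) (intro finite_PiE X fin)
  then obtain F where F: "F \<subseteq> A" "finite F" "\<phi> ` A = \<phi> ` F"
    by (meson finite_subset_image order_refl)
  have "a \<in> (\<Union>f\<in>F. (\<lambda>d. f \<otimes> d) ` (A \<inter> centralizer_set G X))" if a: "a \<in> A" for a
  proof -
    obtain f where f: "f \<in> F" "\<phi> f = \<phi> a" using F(3) a by (metis imageE imageI)
    have mem: "a \<in> carrier G" "f \<in> carrier G" using a f F AG by auto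
    have "inv f \<otimes> a \<otimes> x = x \<otimes> (inv f \<otimes> a)" if x: "x \<in> X" for x
    proof -
      have xG: "x \<in> carrier G" using x X by auto
      have eq: "f \<otimes> x \<otimes> inv f = a \<otimes> x \<otimes> inv a"
        using fun_cong[OF f(2), of x] x by (simp add: \<phi>_def)
      have "inv f \<otimes> a \<otimes> x = inv f \<otimes> (a \<otimes> x \<otimes> inv a) \<otimes> a"
        using mem xG by (simp add: m_assoc)
      also have "\<dots> = x \<otimes> (inv f \<otimes> a)"
        unfolding eq[symmetric] using mem xG by (simp add: m_assoc)
      finally show ?thesis .
    qed
    then have "inv f \<otimes> a \<in> A \<inter> centralizer_set G X"
      using A a f F mem by (auto simp: centralizer_set_def intro: subgroup.m_closed subgroup.m_inv_closed)
    moreover have "a = f \<otimes> (inv f \<otimes> a)" using mem by simp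
    ultimately show ?thesis using f(1) by blast
  qed
  then show ?thesis using F unfolding fin_cover_def by blast
qed

text \<open>Meant for commutators, which are products of an element and a conjugate: conjugation by
  an element of S does not lead out of the class under S.\<close>

lemma finite_conj_class_conj:
  assumes S: "subgroup S G" and s: "s \<in> S" and x: "x \<in> carrier G" "finite (conj_class G S x)"
  shows "finite (conj_class G S (inv s \<otimes> x \<otimes> s))"
proof (rule finite_subset[OF _ x(2)])
  have SG: "S \<subseteq> carrier G" using S by (rule subgroup.subset)
  show "conj_class G S (inv s \<otimes> x \<otimes> s) \<subseteq> conj_class G S x"
  proof
    fix z assume "z \<in> conj_class G S (inv s \<otimes> x \<otimes> s)"
    then obtain g where g: "g \<in> S" "z = g \<otimes> (inv s \<otimes> x \<otimes> s) \<otimes> inv g"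
      by (auto simp: conj_class_def)
    have "z = (g \<otimes> inv s) \<otimes> x \<otimes> inv (g \<otimes> inv s)"
      using subsetD[OF SG g(1)] subsetD[OF SG s] g(2) x by (simp add: inv_mult_group m_assoc)
    moreover have "g \<otimes> inv s \<in> S"
      using S g s by (simp add: subgroup.m_closed subgroup.m_inv_closed)
    ultimately show "z \<in> conj_class G S x" by (auto simp: conj_class_def)
  qed
qed

text \<open>Since all powers of c stay in the finite set E, adjoining the generators one at a time
  multiplies a finite set W by a finite set of powers. The final W is only known to be closed under
  right multiplication by elements of E, but with \<one> \<in> W and E closed under inverses this
  forces it to contain the generated group.\<close>

lemma finite_generate_commuting:
  assumes E: "finite E" "E \<subseteq> carrier G"
    and comm: "\<And>c d. c \<in> E \<Longrightarrow> d \<in> E \<Longrightarrow> c \<otimes> d = d \<otimes> c"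
    and pow: "\<And>c n. c \<in> E \<Longrightarrow> c [^] (n::nat) \<in> E"
    and inv: "\<And>c. c \<in> E \<Longrightarrow> inv c \<in> E"
  shows "finite (generate G E)"
proof -
  have "\<exists>W. finite W \<and> W \<subseteq> carrier G \<and> \<one> \<in> W \<and> (\<forall>w\<in>W. \<forall>s\<in>S. w \<otimes> s \<in> W)"
    if "finite S" "S \<subseteq> E" for S
    using that
  proof (induction S rule: finite_induct)
    case empty
    show ?case by (rule exI[of _ "{\<one>}"]) simp
  next
    case (insert c S)
    from insert.prems have "S \<subseteq> E" by blast
    from insert.IH[OF this] obtain W where W: "finite W" "W \<subseteq> carrier G" "\<one> \<in> W"
      "\<forall>w\<in>W. \<forall>s\<in>S. w \<otimes> s \<in> W" by (elim exE conjE)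
    have c: "c \<in> E" "c \<in> carrier G" using insert.prems E by auto
    define P where "P = range (\<lambda>n::nat. c [^] n)"
    have P: "P \<subseteq> E" unfolding P_def using pow[OF c(1)] by blast
    let ?V = "(\<lambda>(w, p). w \<otimes> p) ` (W \<times> P)"
    have mulV: "w \<otimes> p \<otimes> s \<in> ?V" if w: "w \<in> W" and p: "p \<in> P" and s: "s \<in> insert c S" for w p s
    proof (cases "s = c")
      case True
      obtain n :: nat where n: "p = c [^] n" using p by (auto simp: P_def)
      have "w \<otimes> p \<otimes> s = w \<otimes> c [^] Suc n"
        using True n subsetD[OF W(2) w] c by (simp add: m_assoc)
      moreover have "c [^] Suc n \<in> P" unfolding P_def by blast
      ultimately show ?thesis
        using w by (intro image_eqI[of _ _ "(w, c [^] Suc n)"]) auto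
    next
      case False
      then have s: "s \<in> S" "s \<in> E" using that insert.prems by auto
      have mem: "w \<in> carrier G" "p \<in> carrier G" "s \<in> carrier G" using w p s P W E by auto
      have "p \<otimes> s = s \<otimes> p" using p s P by (intro comm) auto
      then have "w \<otimes> p \<otimes> s = (w \<otimes> s) \<otimes> p"
        using mem by (simp add: m_assoc)
      then show ?thesis
        using W(4) w s(1) p by (intro image_eqI[of _ _ "(w \<otimes> s, p)"]) auto
    qed
    have "c [^] (0::nat) \<in> P" unfolding P_def by (rule rangeI)
    then have oneP: "\<one> \<in> P" by simp
    show ?case
    proof (intro exI[of _ ?V] conjI ballI)
      show "finite ?V" using W(1) finite_subset[OF P E(1)] by simp
      show "?V \<subseteq> carrier G" using W(2) P E(2) by auto
      have "(\<lambda>(w, p). w \<otimes> p) (\<one>, \<one>) \<in> ?V"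
        by (rule imageI) (use W(3) oneP in simp)
      then show "\<one> \<in> ?V" by simp
      fix v s assume v: "v \<in> ?V" and s: "s \<in> insert c S"
      from v obtain w p where "w \<in> W" "p \<in> P" "v = w \<otimes> p" by auto
      then show "v \<otimes> s \<in> ?V" using mulV s by blast
    qed
  qed
  from this[OF E(1) order_refl] obtain W where W: "finite W" "W \<subseteq> carrier G" "\<one> \<in> W"
    "\<forall>w\<in>W. \<forall>s\<in>E. w \<otimes> s \<in> W"
    by (elim exE conjE)
  have gE: "y \<in> carrier G" if "y \<in> generate G E" for y
    using generate_in_carrier[OF E(2) that] .
  have "\<forall>w\<in>W. w \<otimes> y \<in> W" if "y \<in> generate G E" for y
    using that
  proof (induction rule: generate.induct)
    case (eng h1 h2)
    show ?case
    proof
      fix w assume w: "w \<in> W"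
      then have "w \<otimes> h1 \<otimes> h2 \<in> W" using eng.IH by blast
      then show "w \<otimes> (h1 \<otimes> h2) \<in> W"
        using subsetD[OF W(2) w] gE eng.hyps by (simp add: m_assoc)
    qed
  next
    case one
    then show ?case using W(2) by auto
  next
    case (incl h)
    then show ?case using W(4) by blast
  next
    case (inv h)
    then show ?case using W(4) \<open>\<And>c. c \<in> E \<Longrightarrow> inv c \<in> E\<close> by blast
  qed
  then have "generate G E \<subseteq> W"
  proof (intro subsetI)
    fix y assume y: "y \<in> generate G E"
    then have "\<one> \<otimes> y \<in> W" using \<open>\<And>y. y \<in> generate G E \<Longrightarrow> \<forall>w\<in>W. w \<otimes> y \<in> W\<close> W(3) by blast
    then show "y \<in> W" using gE[OF y] by simp
  qed
  then show ?thesis using W(1) finite_subset by blast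
qed

definition commutator :: "'a \<Rightarrow> 'a \<Rightarrow> 'a" where
  "commutator a h = inv a \<otimes> inv h \<otimes> a \<otimes> h"

lemma commutator_closed [simp]: "a \<in> carrier G \<Longrightarrow> h \<in> carrier G \<Longrightarrow> commutator a h \<in> carrier G"
  by (simp add: commutator_def)

text \<open>In general [a b, h] = b^-1 [a, h] b [b, h]; the commutation hypothesis removes the
  conjugation.\<close>

lemma commutator_mult_left:
  assumes "a \<in> carrier G" "b \<in> carrier G" "h \<in> carrier G" "commutator a h \<otimes> b = b \<otimes> commutator a h"
  shows "commutator (a \<otimes> b) h = commutator a h \<otimes> commutator b h"
proof -
  have "commutator (a \<otimes> b) h = inv b \<otimes> (commutator a h \<otimes> b) \<otimes> (inv b \<otimes> inv h \<otimes> b \<otimes> h)"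
    using assms(1-3) by (simp add: commutator_def m_assoc inv_mult_group)
  also have "\<dots> = commutator a h \<otimes> commutator b h"
    unfolding assms(4) using assms(1-3) by (simp add: m_assoc commutator_def)
  finally show ?thesis .
qed

text \<open>Let g have a largest class O under B, and let X contain a conjugating element for each
  member of O. If a in A centralizes X, the class of g a contains O a, hence equals it by
  maximality. So h g a h^-1 = p a with p in O, and h a h^-1 a^-1 = (h g h^-1)^-1 p lies in a finite
  set of quotients.\<close>

lemma finite_commutators:
  assumes A: "subgroup A G" and B: "subgroup B G"
    and bound: "\<And>a. a \<in> A \<Longrightarrow> finite (conj_class G B a) \<and> card (conj_class G B a) \<le> K"
  obtains X where "finite X" "X \<subseteq> B"
    "finite ((\<lambda>(a, h). commutator a h) ` ((A \<inter> centralizer_set G X) \<times> B))"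
proof -
  have AG: "A \<subseteq> carrier G" and BG: "B \<subseteq> carrier G"
    using A B by (auto dest: subgroup.subset)
  have "\<exists>g. g \<in> A \<and> (\<forall>a. a \<in> A \<longrightarrow> card (conj_class G B a) \<le> card (conj_class G B g))"
    by (rule ex_has_greatest_nat[of _ \<one> _ "Suc K"])
      (use bound subgroup.one_closed[OF A] in \<open>auto simp: less_Suc_eq_le\<close>)
  then obtain g where g: "g \<in> A"
    and max: "\<And>a. a \<in> A \<Longrightarrow> card (conj_class G B a) \<le> card (conj_class G B g)" by blast
  let ?O = "conj_class G B g"
  have O: "finite ?O" "?O \<subseteq> carrier G"
    using bound g conj_class_carrier[OF BG] AG by auto
  then obtain X where X: "X \<subseteq> B" "finite X" "?O = (\<lambda>x. x \<otimes> g \<otimes> inv x) ` X"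
    unfolding conj_class_def by (meson finite_subset_image order_refl)
  have XG: "X \<subseteq> carrier G" using X BG by auto
  let ?A = "A \<inter> centralizer_set G X"
  have subA: "subgroup ?A G"
    using A subgroup_centralizer_set[OF XG] by (rule subgroups_Inter_pair)
  let ?Z = "(\<lambda>(p, q). inv p \<otimes> q) ` (?O \<times> ?O)"
  have Z: "h \<otimes> a \<otimes> inv h \<otimes> inv a \<in> ?Z" if a: "a \<in> ?A" and h: "h \<in> B" for a h
  proof -
    have mem: "g \<in> carrier G" "a \<in> carrier G" "h \<in> carrier G"
      using g a h AG BG by auto
    have sub: "(\<lambda>p. p \<otimes> a) ` ?O \<subseteq> conj_class G B (g \<otimes> a)"
    proof
      fix z assume "z \<in> (\<lambda>p. p \<otimes> a) ` ?O"
      then obtain x where x: "x \<in> X" "z = x \<otimes> g \<otimes> inv x \<otimes> a"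
        unfolding X(3) by blast
      have xG: "x \<in> carrier G" using x XG by auto
      have "a \<in> centralizer_set G X" using a by simp
      then have ax: "a \<otimes> x = x \<otimes> a" using x(1) by (simp add: centralizer_set_def)
      have "inv x \<otimes> a = inv x \<otimes> (a \<otimes> x) \<otimes> inv x" using mem xG by (simp add: m_assoc)
      also have "\<dots> = a \<otimes> inv x" unfolding ax using mem xG by simp
      finally have "z = x \<otimes> (g \<otimes> a) \<otimes> inv x" using x mem xG by (simp add: m_assoc)
      then show "z \<in> conj_class G B (g \<otimes> a)" using x X by (auto simp: conj_class_def)
    qed
    have ga: "g \<otimes> a \<in> A" using g a A by (auto intro: subgroup.m_closed)
    have "inj_on (\<lambda>p. p \<otimes> a) ?O" using O mem by (auto simp: inj_on_def subset_eq)
    then have "card (conj_class G B (g \<otimes> a)) \<le> card ((\<lambda>p. p \<otimes> a) ` ?O)"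
      using max[OF ga] by (simp add: card_image)
    then have "(\<lambda>p. p \<otimes> a) ` ?O = conj_class G B (g \<otimes> a)"
      using bound[OF ga] sub by (intro card_seteq) auto
    moreover have "h \<otimes> (g \<otimes> a) \<otimes> inv h \<in> conj_class G B (g \<otimes> a)"
      using h by (auto simp: conj_class_def)
    ultimately obtain p where p: "p \<in> ?O" "h \<otimes> (g \<otimes> a) \<otimes> inv h = p \<otimes> a" by blast
    have pG: "p \<in> carrier G" using p O by auto
    have "inv (h \<otimes> g \<otimes> inv h) \<otimes> p = inv (h \<otimes> g \<otimes> inv h) \<otimes> (p \<otimes> a) \<otimes> inv a"
      using mem pG by (simp add: m_assoc)
    also have "\<dots> = h \<otimes> a \<otimes> inv h \<otimes> inv a"
      unfolding p(2)[symmetric] using mem by (simp add: m_assoc inv_mult_group)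
    finally show ?thesis using p(1) h by (force simp: conj_class_def image_iff)
  qed
  \<comment> \<open>\<open>Z\<close> concerns h a h^-1 a^-1. With h and a replaced by their inverses
    this becomes the inverse of \<open>commutator a h\<close>.\<close>
  have "(\<lambda>(a, h). commutator a h) ` (?A \<times> B) \<subseteq> m_inv G ` ?Z"
  proof clarify
    fix a h assume a: "a \<in> A" "a \<in> centralizer_set G X" and h: "h \<in> B"
    have mem: "a \<in> carrier G" "h \<in> carrier G" using a h AG BG by auto
    have "inv h \<otimes> inv a \<otimes> inv (inv h) \<otimes> inv (inv a) \<in> ?Z"
      using a h by (intro Z subgroup.m_inv_closed[OF subA] subgroup.m_inv_closed[OF B]) auto
    moreover have "commutator a h = inv (inv h \<otimes> inv a \<otimes> inv (inv h) \<otimes> inv (inv a))"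
      using mem by (simp add: commutator_def m_assoc inv_mult_group)
    ultimately show "commutator a h \<in> m_inv G ` ?Z" by blast
  qed
  then have "finite ((\<lambda>(a, h). commutator a h) ` (?A \<times> B))"
    by (rule finite_subset) (use O in simp)
  then show ?thesis using that X by blast
qed

text \<open>The finitely many commutators from \<open>finite_commutators\<close> have finite classes
  under both groups, so centralizing them costs only finite index. Afterwards commutators are
  multiplicative in the first argument, which closes their set under powers and inverses, and they
  commute with each other; \<open>finite_generate_commuting\<close> applies.\<close>

lemma finite_central_commutator_group:
  assumes A: "subgroup A G" and B: "subgroup B G"
    and bound: "\<And>a. a \<in> A \<Longrightarrow> finite (conj_class G B a) \<and> card (conj_class G B a) \<le> K"
    and fin: "\<And>b. b \<in> B \<Longrightarrow> finite (conj_class G A b)"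
  obtains A1 B1 where "subgroup A1 G" "subgroup B1 G" "A1 \<subseteq> A" "B1 \<subseteq> B"
    "fin_cover G A1 A" "fin_cover G B1 B" "finite (commutator_group G A1 B1)"
    "commutator_group G A1 B1 \<subseteq> centralizer_set G A1 \<inter> centralizer_set G B1"
proof -
  have AG: "A \<subseteq> carrier G" and BG: "B \<subseteq> carrier G"
    using A B by (auto dest: subgroup.subset)
  obtain X where X: "finite X" "X \<subseteq> B"
    "finite ((\<lambda>(a, h). commutator a h) ` ((A \<inter> centralizer_set G X) \<times> B))"
    using finite_commutators[OF A B bound] by blast
  define E where "E = (\<lambda>(a, h). commutator a h) ` ((A \<inter> centralizer_set G X) \<times> B)"
  have fE: "finite E" using X(3) by (simp add: E_def)
  have EG: "E \<subseteq> carrier G" using AG BG by (auto simp: E_def subset_eq)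
  have finE: "finite (conj_class G A c)" "finite (conj_class G B c)" if c: "c \<in> E" for c
  proof -
    obtain a h where ah: "a \<in> A" "h \<in> B" "c = commutator a h" using c by (auto simp: E_def)
    have mem: "a \<in> carrier G" "h \<in> carrier G" using ah AG BG by auto
    \<comment> \<open>Read as (a^-1 h^-1 a) h, the commutator is a product of A-conjugates of
      elements of B, whose A-classes are finite; read as a^-1 (h^-1 a h), it is a product of
      B-conjugates of elements of A.\<close>
    have 1: "c = (inv a \<otimes> inv h \<otimes> a) \<otimes> h" by (simp add: ah(3) commutator_def)
    have "inv h \<in> B" using ah B by (simp add: subgroup.m_inv_closed)
    then show "finite (conj_class G A c)"
      unfolding 1 using mem ah fin
      by (intro conj_class_mult(1)[OF AG] finite_conj_class_conj[OF A]) auto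
    have 2: "c = inv a \<otimes> (inv h \<otimes> a \<otimes> h)" using mem by (simp add: ah(3) commutator_def m_assoc)
    have "inv a \<in> A" using ah A by (simp add: subgroup.m_inv_closed)
    then show "finite (conj_class G B c)"
      unfolding 2 using mem ah bound
      by (intro conj_class_mult(1)[OF BG] finite_conj_class_conj[OF B]) auto
  qed
  \<comment> \<open>Centralizing X as well keeps the commutators of \<open>A1\<close> with
    \<open>B1\<close> inside \<open>E\<close>.\<close>
  define A1 where "A1 = A \<inter> centralizer_set G (X \<union> E)"
  define B1 where "B1 = B \<inter> centralizer_set G E"
  have XG: "X \<subseteq> carrier G" using X BG by auto
  have A1: "subgroup A1 G" unfolding A1_def
    by (rule subgroups_Inter_pair[OF A subgroup_centralizer_set]) (use EG XG in simp)
  have B1: "subgroup B1 G" unfolding B1_def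
    by (rule subgroups_Inter_pair[OF B subgroup_centralizer_set[OF EG]])
  have A1G: "A1 \<subseteq> carrier G" and B1G: "B1 \<subseteq> carrier G"
    using A1 B1 by (auto dest: subgroup.subset)
  have covA: "fin_cover G A1 A" unfolding A1_def
    by (rule fin_cover_centralizer[OF A]) (use X EG XG finE fin fE in auto)
  have covB: "fin_cover G B1 B" unfolding B1_def
    by (rule fin_cover_centralizer[OF B]) (use EG finE fE in auto)
  define C where "C = (\<lambda>(a, h). commutator a h) ` (A1 \<times> B1)"
  have CE: "C \<subseteq> E"
    unfolding C_def E_def A1_def B1_def centralizer_set_def by blast
  have A1c: "a \<otimes> c = c \<otimes> a" if "a \<in> A1" "c \<in> E" for a c
    using that by (auto simp: A1_def centralizer_set_def)
  have B1c: "b \<otimes> c = c \<otimes> b" if "b \<in> B1" "c \<in> E" for b c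
    using that by (auto simp: B1_def centralizer_set_def)
  have cc: "C \<subseteq> centralizer_set G A1 \<inter> centralizer_set G B1"
    using CE EG A1c B1c by (auto simp: centralizer_set_def)
  have eq: "commutator_group G A1 B1 = generate G C"
    unfolding commutator_group_def C_def commutator_def
    by (rule arg_cong[of _ _ "generate G"]) auto
  \<comment> \<open>Both a and h centralize d, hence so does every word in them.\<close>
  have CC: "c \<otimes> d = d \<otimes> c" if c: "c \<in> C" and d: "d \<in> C" for c d
  proof -
    obtain a h where ah: "a \<in> A1" "h \<in> B1" "c = commutator a h" using c by (auto simp: C_def)
    have dE: "d \<in> E" "d \<in> carrier G" using d CE EG by auto
    have Z: "subgroup (centralizer_set G {d}) G"
      by (rule subgroup_centralizer_set) (use dE in simp)
    have "a \<in> centralizer_set G {d}" "h \<in> centralizer_set G {d}"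
      using ah A1c[OF _ dE(1)] B1c[OF _ dE(1)] A1G B1G by (auto simp: centralizer_set_def)
    then have "c \<in> centralizer_set G {d}"
      unfolding ah(3) commutator_def
      by (intro subgroup.m_closed[OF Z] subgroup.m_inv_closed[OF Z])
    then show ?thesis by (simp add: centralizer_set_def)
  qed
  have mult: "commutator (a \<otimes> b) h = commutator a h \<otimes> commutator b h" if "a \<in> A1" "b \<in> A1" "h \<in> B1" for a b h
  proof (rule commutator_mult_left)
    have "commutator a h \<in> E" using that CE by (auto simp: C_def)
    with that(2) show "commutator a h \<otimes> b = b \<otimes> commutator a h" by (rule A1c[symmetric])
  qed (use that A1G B1G in auto)
  have one: "commutator \<one> h = \<one>" if "h \<in> carrier G" for h
    using that by (simp add: commutator_def)
  \<comment> \<open>Powers and inverses are again single commutators: [a, h]^n = [a^n, h] and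
    [a, h]^-1 = [a^-1, h].\<close>
  have pow: "c [^] (n::nat) \<in> C" if c: "c \<in> C" for c n
  proof -
    obtain a h where ah: "a \<in> A1" "h \<in> B1" "c = commutator a h" using c by (auto simp: C_def)
    have "a [^] n \<in> A1 \<and> commutator (a [^] n) h = c [^] n"
    proof (induction n)
      case 0
      show ?case using subgroup.one_closed[OF A1] one ah B1G by auto
    next
      case (Suc n)
      then show ?case
        using ah mult[of "a [^] n" a h] subgroup.m_closed[OF A1] by simp
    qed
    then show ?thesis using ah(2) by (force simp: C_def image_iff)
  qed
  have inv: "inv c \<in> C" if c: "c \<in> C" for c
  proof -
    obtain a h where ah: "a \<in> A1" "h \<in> B1" "c = commutator a h" using c by (auto simp: C_def)
    have mem: "a \<in> carrier G" "h \<in> carrier G" "inv a \<in> A1"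
      using ah A1G B1G A1 by (auto intro: subgroup.m_inv_closed)
    have "c \<otimes> commutator (inv a) h = \<one>"
      using mult[OF ah(1) mem(3) ah(2)] mem one ah(3) by simp
    then have "inv c = commutator (inv a) h"
      using mem ah(3) by (intro inv_equality) (auto intro: inv_comm)
    then show ?thesis using ah(2) mem by (force simp: C_def image_iff)
  qed
  have finC: "finite C" using CE fE by (rule finite_subset)
  have "finite (commutator_group G A1 B1)"
    unfolding eq using CE EG by (intro finite_generate_commuting finC CC pow inv) auto
  moreover have "commutator_group G A1 B1 \<subseteq> centralizer_set G A1 \<inter> centralizer_set G B1"
    unfolding eq using cc A1G B1G
    by (intro generate_subgroup_incl subgroups_Inter_pair subgroup_centralizer_set) auto
  moreover have "A1 \<subseteq> A" "B1 \<subseteq> B" by (auto simp: A1_def B1_def)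
  ultimately show ?thesis using that A1 B1 covA covB by blast
qed

text \<open>The hypotheses \<open>gen\<close> and \<open>cov\<close> are what the operator algebra provides: finitely many translates
  of T cover S2, and for each h in T boundedly many translates cover S1 of the set of those k that conjugate
  some a h b to some c h d.\<close>
lemma finite_commutators_of_generic:
  assumes S1: "subgroup S1 G" and S2: "subgroup S2 G"
    and I: "finite I" "I \<subseteq> carrier G \<times> carrier G"
    and T: "T \<subseteq> S2" and E: "finite E" "E \<subseteq> S2" and gen: "S2 \<subseteq> (\<Union>f\<in>E. (\<lambda>d. f \<otimes> d) ` T)"
    and cov: "\<And>h. h \<in> T \<Longrightarrow> \<exists>A. finite A \<and> A \<subseteq> S1 \<and> card A \<le> N \<and>
      S1 \<subseteq> (\<Union>f\<in>A. (\<lambda>k. f \<otimes> k) ` {k \<in> S1. \<exists>(a, b)\<in>I. \<exists>(c, d)\<in>I.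
        k \<otimes> (a \<otimes> h \<otimes> b) = (c \<otimes> h \<otimes> d) \<otimes> k})"
  obtains k \<Omega>1 \<Omega>2 where "k \<in> carrier G"
    "finite_index_subgroup G \<Omega>1 (conj_set G k S1)" "finite_index_subgroup G \<Omega>2 S2"
    "finite (commutator_group G \<Omega>1 \<Omega>2)"
    "commutator_group G \<Omega>1 \<Omega>2 \<subseteq> centralizer_set G \<Omega>1 \<inter> centralizer_set G \<Omega>2"
proof -
  have S1G: "S1 \<subseteq> carrier G" and S2G: "S2 \<subseteq> carrier G"
    using S1 S2 by (auto dest: subgroup.subset)
  \<comment> \<open>For a fixed pair i the translates are indexed by the translating set from
    \<open>cov\<close> and a second pair j, so there are at most \<open>N * card I\<close>; they are
    applied to \<open>card I\<close> centralizers.\<close>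
  define K where "K = cover_bound (card I) (N * card I)"
  define Tab where "Tab i = {h \<in> S2. finite (conj_class G S1 (fst i \<otimes> h \<otimes> snd i))
    \<and> card (conj_class G S1 (fst i \<otimes> h \<otimes> snd i)) \<le> K}" for i
  have Tab: "\<exists>i\<in>I. h \<in> Tab i" if h: "h \<in> T" for h
  proof -
    have hG: "h \<in> carrier G" using h T S2G by auto
    define x where "x i = fst i \<otimes> h \<otimes> snd i" for i
    have xG: "x i \<in> carrier G" if "i \<in> I" for i
      using that I(2) hG by (auto simp: x_def)
    obtain A where A: "finite A" "A \<subseteq> S1" "card A \<le> N"
      and Acov: "S1 \<subseteq> (\<Union>f\<in>A. (\<lambda>k. f \<otimes> k) ` {k \<in> S1. \<exists>(a, b)\<in>I. \<exists>(c, d)\<in>I.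
        k \<otimes> (a \<otimes> h \<otimes> b) = (c \<otimes> h \<otimes> d) \<otimes> k})"
      using cov[OF h] by (elim exE conjE)
    define R where "R i j = {k \<in> S1. k \<otimes> x i = x j \<otimes> k}" for i j
    \<comment> \<open>A nonempty \<open>R i j\<close> is the left coset of the centralizer of
      \<open>x i\<close> represented by \<open>k0 i j\<close>. For empty \<open>R i j\<close> the
      choice is meaningless, and \<open>F\<close> discards such j.\<close>
    define k0 where "k0 i j = (SOME k. k \<in> R i j)" for i j
    have k0: "k0 i j \<in> R i j" if "k \<in> R i j" for i j k
      unfolding k0_def using that by (rule someI)
    define F where "F i = (\<lambda>(f, j). f \<otimes> k0 i j) ` (A \<times> {j \<in> I. R i j \<noteq> {}})" for i
    have F: "finite (F i) \<and> F i \<subseteq> S1 \<and> card (F i) \<le> N * card I" for i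
    proof (intro conjI)
      let ?P = "A \<times> {j \<in> I. R i j \<noteq> {}}"
      have fin: "finite ?P" using A I by simp
      then show "finite (F i)" by (simp add: F_def)
      show "F i \<subseteq> S1"
      proof
        fix y assume "y \<in> F i"
        then obtain f j k where *: "f \<in> A" "k \<in> R i j" "y = f \<otimes> k0 i j"
          unfolding F_def by (clarsimp simp flip: ex_in_conv)
        have "k0 i j \<in> S1" using k0[OF *(2)] by (simp add: R_def)
        with * show "y \<in> S1" using A(2) S1 by (auto intro: subgroup.m_closed)
      qed
      have "card (F i) \<le> card ?P" unfolding F_def using fin by (rule card_image_le)
      also have "\<dots> \<le> N * card I"
        unfolding card_cartesian_product using A(3) I(1) by (intro mult_le_mono card_mono) auto
      finally show "card (F i) \<le> N * card I" .
    qed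
    have "S1 \<subseteq> (\<Union>i\<in>I. \<Union>f\<in>F i. (\<lambda>d. f \<otimes> d) ` centr_in S1 (x i))"
    proof
      fix s assume "s \<in> S1"
      then obtain f k i j where *: "f \<in> A" "k \<in> S1" "i \<in> I" "j \<in> I" "k \<otimes> x i = x j \<otimes> k" "s = f \<otimes> k"
        using Acov unfolding x_def by fastforce
      have kR: "k \<in> R i j" using * by (simp add: R_def)
      have r: "k0 i j \<in> S1" "k0 i j \<otimes> x i = x j \<otimes> k0 i j"
        using k0[OF kR] by (auto simp: R_def)
      have mem: "f \<in> carrier G" "k \<in> carrier G" "k0 i j \<in> carrier G" "x i \<in> carrier G" "x j \<in> carrier G"
        using * r A(2) S1G xG by auto
      let ?c = "inv (k0 i j) \<otimes> k"
      have "inv (k0 i j) \<otimes> x j = inv (k0 i j) \<otimes> (x j \<otimes> k0 i j) \<otimes> inv (k0 i j)"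
        using mem by (simp add: m_assoc)
      also have "\<dots> = x i \<otimes> inv (k0 i j)"
        unfolding r(2)[symmetric] using mem by simp
      finally have e: "inv (k0 i j) \<otimes> x j = x i \<otimes> inv (k0 i j)" .
      have "?c \<otimes> x i = inv (k0 i j) \<otimes> (x j \<otimes> k)"
        unfolding *(5)[symmetric] using mem by (simp add: m_assoc)
      also have "\<dots> = (inv (k0 i j) \<otimes> x j) \<otimes> k" using mem by (simp add: m_assoc)
      also have "\<dots> = x i \<otimes> ?c" unfolding e using mem by (simp add: m_assoc)
      finally have "?c \<in> centr_in S1 (x i)"
        using r(1) *(2) S1 by (auto simp: centr_in_def intro: subgroup.m_closed subgroup.m_inv_closed)
      moreover have "s = (f \<otimes> k0 i j) \<otimes> ?c" using mem *(6) by (simp add: m_assoc)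
      moreover have "f \<otimes> k0 i j \<in> F i" unfolding F_def
        by (rule image_eqI[of _ _ "(f, j)"]) (use * kR in auto)
      ultimately show "s \<in> (\<Union>i\<in>I. \<Union>f\<in>F i. (\<lambda>d. f \<otimes> d) ` centr_in S1 (x i))"
        using *(3) by blast
    qed
    then obtain i C where i: "i \<in> I" "finite C" "C \<subseteq> S1" "card C \<le> K"
      "S1 \<subseteq> (\<Union>f\<in>C. (\<lambda>(s, t). f \<otimes> (s \<otimes> inv t)) ` (centr_in S1 (x i) \<times> centr_in S1 (x i)))"
      unfolding K_def
      by (rule generic_of_cover[OF S1 I(1) F, rotated]) (auto simp: centr_in_def)
    have "h \<in> Tab i"
      using conj_class_of_cover[OF S1 xG[OF i(1)] i(2,3,5)] i(4) h T
      by (auto simp: Tab_def x_def)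
    then show ?thesis using i(1) by blast
  qed
  \<comment> \<open>Second use of the covering lemma, now over \<open>S2\<close>: for a single pair
    i, finitely many translates of the quotients of \<open>Tab i\<close> cover
    \<open>S2\<close>.\<close>
  have "S2 \<subseteq> (\<Union>i\<in>I. \<Union>f\<in>E. (\<lambda>d. f \<otimes> d) ` Tab i)"
  proof
    fix y assume "y \<in> S2"
    then obtain f d where "f \<in> E" "d \<in> T" "y = f \<otimes> d" using gen by blast
    moreover from Tab[OF this(2)] obtain i where "i \<in> I" "d \<in> Tab i" by blast
    ultimately show "y \<in> (\<Union>i\<in>I. \<Union>f\<in>E. (\<lambda>d. f \<otimes> d) ` Tab i)" by blast
  qed
  moreover have "finite E \<and> E \<subseteq> S2 \<and> card E \<le> card E" using E by simp
  moreover have "Tab i \<subseteq> S2" for i by (auto simp: Tab_def)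
  ultimately obtain i C where i: "i \<in> I" "finite C" "C \<subseteq> S2"
    "S2 \<subseteq> (\<Union>f\<in>C. (\<lambda>(s, t). f \<otimes> (s \<otimes> inv t)) ` (Tab i \<times> Tab i))"
    using generic_of_cover[where F = "\<lambda>_. E" and S = Tab and N = "card E", OF S2 I(1)] by metis
  obtain a b where ab: "i = (a, b)" "a \<in> carrier G" "b \<in> carrier G"
    using i(1) I(2) by auto
  \<comment> \<open>Chosen so that conjugation by k carries the \<open>S1\<close>-class of (a s b)(a
    t b)^-1 onto the \<open>S\<close>-class of s t^-1. The former has at most K * K elements as a
    product of two bounded classes.\<close>
  define k where "k = inv a"
  define S where "S = conj_set G k S1"
  have k: "k \<in> carrier G" using ab by (simp add: k_def)
  have S: "subgroup S G"
  proof
    show "S \<subseteq> carrier G" using k S1G by (auto simp: S_def conj_set_def)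
    show "\<one> \<in> S" unfolding S_def conj_set_def
      using k subgroup.one_closed[OF S1] by (auto intro!: exI[of _ \<one>])
    fix u assume "u \<in> S"
    then obtain s where s: "s \<in> S1" "u = k \<otimes> s \<otimes> inv k" by (auto simp: S_def conj_set_def)
    have sG: "s \<in> carrier G" using s S1G by auto
    have "inv u = k \<otimes> inv s \<otimes> inv k"
      using k sG s(2) by (simp add: inv_mult_group m_assoc)
    then show "inv u \<in> S"
      unfolding S_def conj_set_def using subgroup.m_inv_closed[OF S1 s(1)] by blast
    fix v assume "v \<in> S"
    then obtain t where t: "t \<in> S1" "v = k \<otimes> t \<otimes> inv k" by (auto simp: S_def conj_set_def)
    have tG: "t \<in> carrier G" using t S1G by auto
    have "u \<otimes> v = k \<otimes> (s \<otimes> t) \<otimes> inv k"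
      using k sG tG s(2) t(2) by (simp add: m_assoc)
    then show "u \<otimes> v \<in> S"
      unfolding S_def conj_set_def using subgroup.m_closed[OF S1 s(1) t(1)] by blast
  qed
  have SG: "S \<subseteq> carrier G" using S by (rule subgroup.subset)
  define D where "D = (\<lambda>(s, t). s \<otimes> inv t) ` (Tab i \<times> Tab i)"
  have D: "D \<subseteq> S2"
    using S2 by (auto simp: D_def Tab_def intro!: subgroup.m_closed subgroup.m_inv_closed)
  have Dcov: "fin_cover G D S2"
    unfolding fin_cover_def using i(2-4) by (intro exI[of _ C]) (auto simp: D_def image_image case_prod_unfold)
  have Dcls: "finite (conj_class G S d) \<and> card (conj_class G S d) \<le> K * K" if d: "d \<in> D" for d
  proof -
    obtain s t where st: "s \<in> Tab i" "t \<in> Tab i" "d = s \<otimes> inv t" using d by (auto simp: D_def)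
    have mem: "s \<in> carrier G" "t \<in> carrier G" using st S2G by (auto simp: Tab_def)
    define u where "u = a \<otimes> s \<otimes> b"
    define v where "v = a \<otimes> t \<otimes> b"
    have uv: "u \<in> carrier G" "v \<in> carrier G" using ab mem by (auto simp: u_def v_def)
    have cls: "finite (conj_class G S1 u)" "card (conj_class G S1 u) \<le> K"
      "finite (conj_class G S1 v)" "card (conj_class G S1 v) \<le> K"
      using st(1,2) by (auto simp: Tab_def ab(1) u_def v_def)
    note inv_cls = finite_conj_class_inv[OF S1G uv(2) cls(3)]
    note mult_cls = conj_class_mult[OF S1G uv(1) inv_closed[OF uv(2)] cls(1) inv_cls(1)]
    have c: "card (conj_class G S1 (u \<otimes> inv v)) \<le> K * K"
      by (rule order_trans[OF mult_cls(2) mult_le_mono[OF cls(2) order_trans[OF inv_cls(2) cls(4)]]])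
    have uvd: "u \<otimes> inv v = a \<otimes> d \<otimes> inv a"
      using mem ab by (simp add: u_def v_def st(3) inv_mult_group m_assoc)
    have img: "conj_class G S d \<subseteq> (\<lambda>z. k \<otimes> z \<otimes> inv k) ` conj_class G S1 (u \<otimes> inv v)"
    proof
      fix z assume "z \<in> conj_class G S d"
      then obtain g where g: "g \<in> S1" "z = (k \<otimes> g \<otimes> inv k) \<otimes> d \<otimes> inv (k \<otimes> g \<otimes> inv k)"
        by (auto simp: conj_class_def S_def conj_set_def)
      have "g \<in> carrier G" using g S1G by auto
      then have "z = k \<otimes> (g \<otimes> (u \<otimes> inv v) \<otimes> inv g) \<otimes> inv k"
        unfolding uvd using g(2) ab mem st(3) by (simp add: k_def inv_mult_group m_assoc)
      then show "z \<in> (\<lambda>z. k \<otimes> z \<otimes> inv k) ` conj_class G S1 (u \<otimes> inv v)"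
        using g(1) by (auto simp: conj_class_def)
    qed
    show ?thesis
    proof
      show "finite (conj_class G S d)"
        using img by (rule finite_subset) (use mult_cls(1) in simp)
      have "card (conj_class G S d) \<le> card (conj_class G S1 (u \<otimes> inv v))"
        using mult_cls(1) img by (rule surj_card_le)
      then show "card (conj_class G S d) \<le> K * K" using c by simp
    qed
  qed
  define \<Delta>2 where "\<Delta>2 = {h \<in> S2. finite (conj_class G S h)}"
  have \<Delta>2: "subgroup \<Delta>2 G"
    unfolding \<Delta>2_def using S2 SG by (rule subgroup_finite_conj_class)
  have cov2: "fin_cover G \<Delta>2 S2"
    unfolding \<Delta>2_def by (rule bounded_class_subgroup(1)[OF S2 SG D Dcls Dcov])
  obtain K2 where K2: "\<And>h. h \<in> \<Delta>2 \<Longrightarrow> card (conj_class G S h) \<le> K2"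
    using bounded_class_subgroup(2)[OF S2 SG D Dcls Dcov] by (auto simp: \<Delta>2_def)
  \<comment> \<open>Bounds for classes under \<open>S\<close> are exchanged for bounds for classes
    under \<open>\<Delta>2\<close>, valid on a set finitely many translates of which cover
    \<open>S\<close>; the elements of finite class again turn this set into a subgroup with a
    uniform bound.\<close>
  have "\<exists>D K'. D \<subseteq> S \<and> fin_cover G D S \<and>
    (\<forall>d\<in>D. finite (conj_class G \<Delta>2 d) \<and> card (conj_class G \<Delta>2 d) \<le> K')"
    by (rule bounded_class_swap[OF S \<Delta>2, of K2]) (use K2 in \<open>auto simp: \<Delta>2_def\<close>)
  then obtain D1 K1 where D1: "D1 \<subseteq> S" "fin_cover G D1 S"
    "\<forall>d\<in>D1. finite (conj_class G \<Delta>2 d) \<and> card (conj_class G \<Delta>2 d) \<le> K1"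
    by (elim exE conjE)
  have D1': "finite (conj_class G \<Delta>2 d) \<and> card (conj_class G \<Delta>2 d) \<le> K1" if "d \<in> D1" for d
    using D1(3) that by blast
  have \<Delta>2G: "\<Delta>2 \<subseteq> carrier G" using \<Delta>2 by (rule subgroup.subset)
  define \<Delta>1 where "\<Delta>1 = {g \<in> S. finite (conj_class G \<Delta>2 g)}"
  have \<Delta>1: "subgroup \<Delta>1 G"
    unfolding \<Delta>1_def using S \<Delta>2G by (rule subgroup_finite_conj_class)
  have cov1: "fin_cover G \<Delta>1 S"
    unfolding \<Delta>1_def by (rule bounded_class_subgroup(1)[OF S \<Delta>2G D1(1) D1' D1(2)])
  obtain K3 where K3: "\<And>h. h \<in> \<Delta>1 \<Longrightarrow> card (conj_class G \<Delta>2 h) \<le> K3"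
    using bounded_class_subgroup(2)[OF S \<Delta>2G D1(1) D1' D1(2)] by (auto simp: \<Delta>1_def)
  have b1: "finite (conj_class G \<Delta>2 g) \<and> card (conj_class G \<Delta>2 g) \<le> K3" if "g \<in> \<Delta>1" for g
    using K3[OF that] that by (simp add: \<Delta>1_def)
  have b2: "finite (conj_class G \<Delta>1 h)" if "h \<in> \<Delta>2" for h
  proof (rule finite_subset)
    show "conj_class G \<Delta>1 h \<subseteq> conj_class G S h" by (auto simp: conj_class_def \<Delta>1_def)
    show "finite (conj_class G S h)" using that by (simp add: \<Delta>2_def)
  qed
  obtain A1 B1 where AB: "subgroup A1 G" "subgroup B1 G" "A1 \<subseteq> \<Delta>1" "B1 \<subseteq> \<Delta>2"
    "fin_cover G A1 \<Delta>1" "fin_cover G B1 \<Delta>2" "finite (commutator_group G A1 B1)"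
    "commutator_group G A1 B1 \<subseteq> centralizer_set G A1 \<inter> centralizer_set G B1"
    using finite_central_commutator_group[OF \<Delta>1 \<Delta>2 b1 b2] by blast
  have s1: "\<Delta>1 \<subseteq> S" and s2: "\<Delta>2 \<subseteq> S2" by (auto simp: \<Delta>1_def \<Delta>2_def)
  have "fin_cover G A1 S"
    using fin_cover_trans[OF S s1 _ AB(5) cov1] AB(1) by (auto dest: subgroup.subset)
  then have i1: "finite_index_subgroup G A1 (conj_set G k S1)"
    unfolding S_def[symmetric] using AB(1,3) s1 S by (intro fin_cover_imp_finite_index) auto
  have "fin_cover G B1 S2"
    using fin_cover_trans[OF S2 s2 _ AB(6) cov2] AB(2) by (auto dest: subgroup.subset)
  then have i2: "finite_index_subgroup G B1 S2"
    using AB(2,4) s2 S2 by (intro fin_cover_imp_finite_index) auto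
  show ?thesis by (rule that[OF k i1 i2 AB(7,8)])
qed

subsection \<open>Operators commuting with right translations\<close>

text \<open>The right regular representation, set to 0 outside \<open>l2 G\<close> like
  \<open>lambda_op\<close>. Evaluating at x k makes it multiplicative in k, see
  \<open>rho_rho\<close>.\<close>

definition rho :: "'a \<Rightarrow> 'a op" where
  "rho k = (\<lambda>f. if f \<in> l2 G then (\<lambda>x. if x \<in> carrier G then f (x \<otimes> k) else 0) else (\<lambda>_. 0))"

lemma bij_right_mult: "k \<in> carrier G \<Longrightarrow> bij_betw (\<lambda>x. x \<otimes> k) (carrier G) (carrier G)"
  by (rule bij_betw_byWitness[where f' = "\<lambda>x. x \<otimes> inv k"]) (auto simp: m_assoc)

lemma bij_left_mult: "k \<in> carrier G \<Longrightarrow> bij_betw (\<lambda>x. k \<otimes> x) (carrier G) (carrier G)"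
  by (rule bij_betw_byWitness[where f' = "\<lambda>x. inv k \<otimes> x"]) (auto simp: m_assoc[symmetric])

lemma bij_inv: "bij_betw (\<lambda>x. inv x) (carrier G) (carrier G)"
  by (rule bij_betw_byWitness[where f' = "\<lambda>x. inv x"]) auto

lemma l2_reindex:
  assumes b: "bij_betw b (carrier G) (carrier G)" and f: "f \<in> l2 G"
  shows "(\<lambda>x. if x \<in> carrier G then f (b x) else 0) \<in> l2 G"
proof -
  have "(\<lambda>x. (cmod (f (b x)))\<^sup>2) summable_on carrier G"
    using summable_on_reindex_bij_betw[OF b, of "\<lambda>x. (cmod (f x))\<^sup>2"] l2_summable[OF f] by simp
  then show ?thesis by (rule l2_dominated) auto
qed

lemma l2_inner_reindex:
  assumes b: "bij_betw b (carrier G) (carrier G)"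
  shows "l2_inner G (\<lambda>x. if x \<in> carrier G then f (b x) else 0)
    (\<lambda>x. if x \<in> carrier G then g (b x) else 0) = l2_inner G f g"
  unfolding l2_inner_def infsum_reindex_bij_betw[OF b, symmetric, of "\<lambda>x. cnj (f x) * g x"]
  by (rule infsum_cong) simp

lemma l2_norm_reindex:
  assumes b: "bij_betw b (carrier G) (carrier G)"
  shows "l2_norm G (\<lambda>x. if x \<in> carrier G then f (b x) else 0) = l2_norm G f"
  unfolding l2_norm_def infsum_reindex_bij_betw[OF b, symmetric, of "\<lambda>x. (cmod (f x))\<^sup>2"]
  by (intro arg_cong[of _ _ sqrt] infsum_cong) simp

section \<open>Left and right translations\<close>

lemma rho_apply: "f \<in> l2 G \<Longrightarrow> rho k f x = (if x \<in> carrier G then f (x \<otimes> k) else 0)"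
  by (simp add: rho_def)

lemma lambda_apply: "f \<in> l2 G \<Longrightarrow>
    lambda_op G k f x = (if x \<in> carrier G then f (inv k \<otimes> x) else 0)"
  by (simp add: lambda_op_def)

lemma rho_l2: "k \<in> carrier G \<Longrightarrow> f \<in> l2 G \<Longrightarrow> rho k f \<in> l2 G"
  unfolding rho_def by (simp add: l2_reindex[OF bij_right_mult])

lemma lambda_l2: "k \<in> carrier G \<Longrightarrow> f \<in> l2 G \<Longrightarrow> lambda_op G k f \<in> l2 G"
  unfolding lambda_op_def by (simp add: l2_reindex[OF bij_left_mult])

lemma rho_norm: "k \<in> carrier G \<Longrightarrow> f \<in> l2 G \<Longrightarrow> l2_norm G (rho k f) = l2_norm G f"
  unfolding rho_def by (simp add: l2_norm_reindex[OF bij_right_mult])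

lemma lambda_norm: "k \<in> carrier G \<Longrightarrow> f \<in> l2 G \<Longrightarrow> l2_norm G (lambda_op G k f) = l2_norm G f"
  unfolding lambda_op_def by (simp add: l2_norm_reindex[OF bij_left_mult])

lemma rho_inner: "k \<in> carrier G \<Longrightarrow> f \<in> l2 G \<Longrightarrow> g \<in> l2 G \<Longrightarrow>
    l2_inner G (rho k f) (rho k g) = l2_inner G f g"
  unfolding rho_def by (simp add: l2_inner_reindex[OF bij_right_mult])

lemma lambda_inner: "k \<in> carrier G \<Longrightarrow> f \<in> l2 G \<Longrightarrow> g \<in> l2 G \<Longrightarrow>
    l2_inner G (lambda_op G k f) (lambda_op G k g) = l2_inner G f g"
  unfolding lambda_op_def by (simp add: l2_inner_reindex[OF bij_left_mult])

lemma rho_rho: "k \<in> carrier G \<Longrightarrow> l \<in> carrier G \<Longrightarrow> f \<in> l2 G \<Longrightarrow>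
    rho k (rho l f) = rho (k \<otimes> l) f"
  by (rule ext) (simp add: rho_apply rho_l2 m_assoc)

lemma lambda_lambda: "k \<in> carrier G \<Longrightarrow> l \<in> carrier G \<Longrightarrow> f \<in> l2 G \<Longrightarrow>
    lambda_op G k (lambda_op G l f) = lambda_op G (k \<otimes> l) f"
  by (rule ext) (simp add: lambda_apply lambda_l2 m_assoc inv_mult_group)

lemma rho_one: "f \<in> l2 G \<Longrightarrow> rho \<one> f = f"
  by (rule ext) (simp add: rho_apply l2_outside)

lemma lambda_one: "f \<in> l2 G \<Longrightarrow> lambda_op G \<one> f = f"
  by (rule ext) (simp add: lambda_apply l2_outside)

lemma lambda_rho: "k \<in> carrier G \<Longrightarrow> l \<in> carrier G \<Longrightarrow> f \<in> l2 G \<Longrightarrow>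
    lambda_op G k (rho l f) = rho l (lambda_op G k f)"
  by (rule ext) (simp add: lambda_apply rho_apply rho_l2 lambda_l2 m_assoc)

lemma rho_dirac:
  assumes "k \<in> carrier G" "y \<in> carrier G"
  shows "rho k (dirac y) = dirac (y \<otimes> inv k)"
proof
  fix x
  have "x \<otimes> k = y \<longleftrightarrow> x = y \<otimes> inv k" if "x \<in> carrier G"
    using assms that by (auto simp: m_assoc)
  moreover have "x \<noteq> y \<otimes> inv k" if "x \<notin> carrier G" using assms that by auto
  ultimately show "rho k (dirac y) x = dirac (y \<otimes> inv k) x"
    unfolding rho_apply[OF dirac_l2[OF assms(2)]] by (auto simp: dirac_def)
qed

lemma lambda_dirac:
  assumes "k \<in> carrier G" "y \<in> carrier G"
  shows "lambda_op G k (dirac y) = dirac (k \<otimes> y)"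
proof
  fix x
  have "inv k \<otimes> x = y \<longleftrightarrow> x = k \<otimes> y" if "x \<in> carrier G"
    using assms that by (auto simp: m_assoc[symmetric])
  moreover have "x \<noteq> k \<otimes> y" if "x \<notin> carrier G" using assms that by auto
  ultimately show "lambda_op G k (dirac y) x = dirac (k \<otimes> y) x"
    unfolding lambda_apply[OF dirac_l2[OF assms(2)]] by (auto simp: dirac_def)
qed

lemma bounded_op_lambda: "k \<in> carrier G \<Longrightarrow> bounded_op G (lambda_op G k)"
  by (rule bounded_op_isometry)
    (auto simp: lambda_l2 lambda_norm lambda_apply l2_add l2_scale, simp add: lambda_op_def)

lemma bounded_op_rho: "k \<in> carrier G \<Longrightarrow> bounded_op G (rho k)"
  by (rule bounded_op_isometry)
    (auto simp: rho_l2 rho_norm rho_apply l2_add l2_scale, simp add: rho_def)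

lemma adj_lambda:
  assumes "k \<in> carrier G"
  shows "adj G (lambda_op G k) = lambda_op G (inv k)"
proof (rule adj_eqI)
  fix f g assume fg: "f \<in> l2 G" "g \<in> l2 G"
  have "g = lambda_op G k (lambda_op G (inv k) g)"
    using assms fg by (simp add: lambda_lambda lambda_one)
  then show "l2_inner G (lambda_op G k f) g = l2_inner G f (lambda_op G (inv k) g)"
    using lambda_inner[OF assms fg(1) lambda_l2[OF inv_closed[OF assms] fg(2)]] by simp
qed (use assms in \<open>auto intro: bounded_op_lambda\<close>)

text \<open>The commutant of the right regular representation. It contains L(\<Gamma>) by
  \<open>rinv_vNa\<close>, is closed under products and adjoints, and its members are determined by
  their values at \<open>dirac \<one>\<close>, so the estimates can avoid double commutants.\<close>

definition rinv :: "'a op \<Rightarrow> bool" where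
  "rinv T \<longleftrightarrow> bounded_op G T \<and> (\<forall>k\<in>carrier G. \<forall>f\<in>l2 G. T (rho k f) = rho k (T f))"

lemma rinv_bounded: "rinv T \<Longrightarrow> bounded_op G T"
  by (simp add: rinv_def)

lemma rinv_l2: "rinv T \<Longrightarrow> f \<in> l2 G \<Longrightarrow> T f \<in> l2 G"
  by (simp add: rinv_def bounded_op_l2)

lemma rinv_rho: "rinv T \<Longrightarrow> k \<in> carrier G \<Longrightarrow> f \<in> l2 G \<Longrightarrow> T (rho k f) = rho k (T f)"
  by (simp add: rinv_def)

lemma rinv_lambda: "k \<in> carrier G \<Longrightarrow> rinv (lambda_op G k)"
  by (simp add: rinv_def bounded_op_lambda lambda_rho)

lemma rinv_comp: "rinv S \<Longrightarrow> rinv T \<Longrightarrow> rinv (S \<circ> T)"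
  by (auto simp: rinv_def bounded_op_comp bounded_op_l2)

lemma rinv_adj:
  assumes T: "rinv T" shows "rinv (adj G T)"
proof -
  have b: "bounded_op G T" using T by (rule rinv_bounded)
  note b' = bounded_op_adj[OF b]
  have "adj G T (rho k g) = rho k (adj G T g)" if k: "k \<in> carrier G" and g: "g \<in> l2 G" for k g
  proof (rule l2_eqI)
    fix f assume f: "f \<in> l2 G"
    define f' where "f' = rho (inv k) f"
    have f': "f' \<in> l2 G" "f = rho k f'"
      using f k by (simp_all add: f'_def rho_l2 rho_rho rho_one)
    have "l2_inner G f (adj G T (rho k g)) = l2_inner G (T f) (rho k g)"
      using f g k by (simp add: inner_adj[OF b] rho_l2)
    also have "\<dots> = l2_inner G (rho k (T f')) (rho k g)"
      unfolding f'(2) by (simp add: rinv_rho[OF T] k f'(1))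
    also have "\<dots> = l2_inner G f' (adj G T g)"
      using k g f'(1) by (simp add: rho_inner rinv_l2[OF T] inner_adj[OF b])
    also have "\<dots> = l2_inner G (rho k f') (rho k (adj G T g))"
      using k g f'(1) by (simp add: rho_inner bounded_op_l2[OF b'])
    finally show "l2_inner G f (adj G T (rho k g)) = l2_inner G f (rho k (adj G T g))"
      unfolding f'(2) .
  qed (use k g in \<open>simp_all add: rho_l2 bounded_op_l2[OF b']\<close>)
  with b' show ?thesis by (simp add: rinv_def)
qed

text \<open>Right translations commute with left ones, so they lie in the first commutant, and the
  double commutant commutes with them.\<close>

lemma rinv_vNa:
  assumes "T \<in> group_vNa G (carrier G)" shows "rinv T"
proof -
  have b: "bounded_op G T" using assms by (simp add: group_vNa_def commutant_def)
  have "rho k \<in> commutant G (lambda_op G ` carrier G)" if k: "k \<in> carrier G" for k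
  proof -
    have "rho k \<circ> lambda_op G g = lambda_op G g \<circ> rho k" if g: "g \<in> carrier G" for g
    proof
      fix f show "(rho k \<circ> lambda_op G g) f = (lambda_op G g \<circ> rho k) f"
      proof (cases "f \<in> l2 G")
        case False
        then show ?thesis
          using bounded_op_zero[OF bounded_op_rho[OF k]] bounded_op_zero[OF bounded_op_lambda[OF g]]
            bounded_op_outside[OF bounded_op_rho[OF k]] bounded_op_outside[OF bounded_op_lambda[OF g]]
          by simp
      qed (simp add: lambda_rho k g)
    qed
    then show ?thesis by (auto simp: commutant_def bounded_op_rho k)
  qed
  then have "T \<circ> rho k = rho k \<circ> T" if "k \<in> carrier G" for k
    using assms that by (simp add: group_vNa_def commutant_def)
  then have "T (rho k f) = rho k (T f)" if "k \<in> carrier G" for k f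
    using that by (metis comp_apply)
  then show ?thesis using b by (simp add: rinv_def)
qed

lemma group_vNa_mono:
  assumes "S \<subseteq> S'" shows "group_vNa G S \<subseteq> group_vNa G S'"
  using assms unfolding group_vNa_def commutant_def by blast

lemma lambda_in_vNa:
  assumes "g \<in> S" "g \<in> carrier G" shows "lambda_op G g \<in> group_vNa G S"
  using assms bounded_op_lambda unfolding group_vNa_def commutant_def by auto

lemma rinv_dirac:
  assumes T: "rinv T" and "y \<in> carrier G"
  shows "T (dirac y) = rho (inv y) (T (dirac \<one>))"
proof -
  have "dirac y = rho (inv y) (dirac \<one>)" using assms(2) by (simp add: rho_dirac)
  then show ?thesis using rinv_rho[OF T] assms(2) by (simp add: dirac_l2)
qed

text \<open>On the vectors \<open>T (dirac \<one>)\<close> the adjoint is the involution sending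
  f(y) to the conjugate of f(y^-1). As inversion permutes the group, this makes the vector state
  tracial.\<close>

lemma adj_dirac_one:
  assumes T: "rinv T" and y: "y \<in> carrier G"
  shows "adj G T (dirac \<one>) y = cnj (T (dirac \<one>) (inv y))"
proof -
  have b: "bounded_op G T" using T by (rule rinv_bounded)
  have "adj G T (dirac \<one>) y = l2_inner G (T (dirac y)) (dirac \<one>)"
    using y by (simp add: inner_adj[OF b] dirac_l2 l2_inner_dirac)
  also have "\<dots> = cnj (T (dirac y) \<one>)"
    by (simp add: l2_inner_dirac_right)
  also have "\<dots> = cnj (T (dirac \<one>) (inv y))"
    using y by (simp add: rinv_dirac[OF T y] rho_apply rinv_l2[OF T] dirac_l2)
  finally show ?thesis .
qed

text \<open>This is the trace property of the vector state at \<open>dirac \<one>\<close>.\<close>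
lemma rinv_inner_adj:
  assumes A: "rinv A" and B: "rinv B"
  shows "l2_inner G (A (dirac \<one>)) (B (dirac \<one>)) = l2_inner G (adj G B (dirac \<one>)) (adj G A (dirac \<one>))"
proof -
  let ?f = "A (dirac \<one>)" and ?g = "B (dirac \<one>)"
  have "l2_inner G (adj G B (dirac \<one>)) (adj G A (dirac \<one>))
      = infsum (\<lambda>y. cnj (?f (inv y)) * ?g (inv y)) (carrier G)"
    unfolding l2_inner_def
    by (rule infsum_cong) (simp add: adj_dirac_one[OF A] adj_dirac_one[OF B] mult.commute)
  also have "\<dots> = l2_inner G ?f ?g"
    unfolding l2_inner_def by (rule infsum_reindex_bij_betw[OF bij_inv])
  finally show ?thesis ..
qed

lemma rinv_norm_adj:
  assumes A: "rinv A"
  shows "l2_norm G (adj G A (dirac \<one>)) = l2_norm G (A (dirac \<one>))"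
proof -
  have "complex_of_real ((l2_norm G (adj G A (dirac \<one>)))\<^sup>2) = of_real ((l2_norm G (A (dirac \<one>)))\<^sup>2)"
    using rinv_inner_adj[OF A A]
    by (simp only: l2_inner_self[symmetric] rinv_l2[OF A] rinv_l2[OF rinv_adj[OF A]] dirac_l2 one_closed)
  then have "(l2_norm G (adj G A (dirac \<one>)))\<^sup>2 = (l2_norm G (A (dirac \<one>)))\<^sup>2"
    unfolding of_real_eq_iff .
  then show ?thesis by (rule power2_eq_imp_eq) (rule l2_norm_nonneg)+
qed

lemma rinv_norm_dirac:
  "rinv T \<Longrightarrow> y \<in> carrier G \<Longrightarrow> l2_norm G (T (dirac y)) = l2_norm G (T (dirac \<one>))"
  by (subst rinv_dirac) (simp_all add: rho_norm rinv_l2 dirac_l2)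

text \<open>\<open>bounded_op\<close> hides the constant. It is kept here because one number of
  translates has to serve a whole family of operators.\<close>

definition op_bound :: "real \<Rightarrow> 'a op \<Rightarrow> bool" where
  "op_bound C T \<longleftrightarrow> (\<forall>f\<in>l2 G. l2_norm G (T f) \<le> C * l2_norm G f)"

text \<open>If the translates \<open>x r m m\<^sup>* x r\<inverse>\<close> were pairwise almost orthogonal, their sum
  applied to \<open>dirac \<one>\<close> would be too short for its inner product with \<open>dirac \<one>\<close>.\<close>
lemma translates_overlap:
  assumes m: "rinv m" and C: "C > 0" "op_bound C m" "op_bound C (adj G m)"
    and d: "\<delta> > 0" "\<delta> \<le> l2_norm G (m (dirac \<one>))"
    and N: "real N * \<delta> ^ 3 > 2 * C ^ 3"
    and x: "\<And>i. i < N \<Longrightarrow> x i \<in> carrier G"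
  shows "\<exists>r s. r < s \<and> s < N \<and>
    \<delta> ^ 3 / (2 * C) \<le> l2_norm G (adj G m (lambda_op G (inv (x r) \<otimes> x s) (m (dirac \<one>))))"
proof (rule ccontr)
  \<comment> \<open>C times \<open>?\<delta>1\<close> is \<delta>^3 / 2: the off-diagonal terms then
    use up at most half of the lower bound N t^3, and N is so large that the diagonal terms,
    contributing at most C^3, cannot fill the rest.\<close>
  let ?m' = "adj G m" and ?\<delta>1 = "\<delta> ^ 3 / (2 * C)"
  define t where "t = l2_norm G (m (dirac \<one>))"
  have b: "bounded_op G m" using m by (rule rinv_bounded)
  have m': "rinv ?m'" using m by (rule rinv_adj)
  have t: "\<delta> \<le> t" "t > 0" using d by (auto simp: t_def)
  have t': "l2_norm G (?m' (dirac \<one>)) = t" unfolding t_def by (rule rinv_norm_adj[OF m])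
  have tC: "t \<le> C"
    using C(2) unfolding op_bound_def t_def by (metis dirac_l2 l2_norm_dirac mult.right_neutral one_closed)
  define W where "W r s = ?m' \<circ> (lambda_op G (inv (x r) \<otimes> x s) \<circ> m)" for r s
  assume "\<not> ?thesis"
  then have less: "l2_norm G (W r s (dirac \<one>)) < ?\<delta>1" if "r < s" "s < N" for r s
    using that by (auto simp: W_def not_le)
  have W: "rinv (W r s)" if "r < N" "s < N" for r s
    unfolding W_def using that x by (intro rinv_comp m m' rinv_lambda) auto
  have Wadj: "adj G (W r s) = W s r" if "r < N" "s < N" for r s
  proof -
    have g: "inv (x r) \<otimes> x s \<in> carrier G" using that x by simp
    have "adj G (W r s) = (?m' \<circ> lambda_op G (inv (inv (x r) \<otimes> x s))) \<circ> m"
      unfolding W_def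
      by (simp add: adj_comp bounded_op_comp bounded_op_lambda[OF g] b bounded_op_adj adj_adj adj_lambda[OF g])
    then show ?thesis using that x by (simp add: W_def comp_assoc inv_mult_group)
  qed
  \<comment> \<open>The adjoint of \<open>W r s\<close> is \<open>W s r\<close> and adjoints keep
    the 2-norm, so the bound extends to r > s.\<close>
  have less': "l2_norm G (W r s (dirac \<one>)) < ?\<delta>1" if "r \<noteq> s" "r < N" "s < N" for r s
  proof (cases "r < s")
    case False
    then have "l2_norm G (W s r (dirac \<one>)) < ?\<delta>1" using that by (intro less) auto
    then show ?thesis using rinv_norm_adj[OF W[OF that(3,2)]] Wadj[OF that(3,2)] by simp
  qed (use that less in simp)
  define \<eta> where "\<eta> r = ?m' (dirac (inv (x r)))" for r
  have \<eta>: "\<eta> r \<in> l2 G" "l2_norm G (\<eta> r) = t" if "r < N" for r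
    using x[OF that] t' rinv_norm_dirac[OF m', of "inv (x r)"]
    by (simp_all add: \<eta>_def rinv_l2[OF m'] dirac_l2)
  \<comment> \<open>This is \<open>lambda_op G (x r)\<close> m (adj m)
    \<open>lambda_op G (inv (x r))\<close> applied to \<open>dirac \<one>\<close>: the last operator
    maps \<open>dirac \<one>\<close> to \<open>dirac (inv (x r))\<close>.\<close>
  define a where "a r = lambda_op G (x r) (m (\<eta> r))" for r
  have a: "a r \<in> l2 G" if "r < N" for r
    unfolding a_def using x[OF that] \<eta>[OF that] by (intro lambda_l2 rinv_l2[OF m])
  have inner_a: "l2_inner G (a r) (a s) = l2_inner G (\<eta> r) (W r s (\<eta> s))" if "r < N" "s < N" for r s
  proof -
    have mem: "x r \<in> carrier G" "x s \<in> carrier G" "m (\<eta> r) \<in> l2 G" "m (\<eta> s) \<in> l2 G"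
      using that x \<eta> rinv_l2[OF m] by auto
    have "a s = lambda_op G (x r) (lambda_op G (inv (x r) \<otimes> x s) (m (\<eta> s)))"
      using mem by (simp add: a_def lambda_lambda m_assoc[symmetric])
    then have "l2_inner G (a r) (a s) = l2_inner G (m (\<eta> r)) (lambda_op G (inv (x r) \<otimes> x s) (m (\<eta> s)))"
      unfolding a_def[of r] using mem by (simp add: lambda_inner lambda_l2)
    also have "\<dots> = l2_inner G (\<eta> r) (W r s (\<eta> s))"
      using mem \<eta> that by (simp add: W_def inner_adj[OF b] lambda_l2)
    finally show ?thesis .
  qed
  \<comment> \<open>\<open>W r s\<close> is known to be small only at \<open>dirac \<one>\<close>,
    not at \<open>\<eta> s\<close>. Right invariance and the invariance of the 2-norm under adjoints
    rewrite the norm as that of m applied to the adjoint of \<open>W r s\<close> at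
    \<open>dirac \<one>\<close>, at the cost of a factor C.\<close>
  have offdiag: "cmod (l2_inner G (a r) (a s)) \<le> t * (C * ?\<delta>1)" if "r \<noteq> s" "r < N" "s < N" for r s
  proof -
    note Wrs = W[OF that(2,3)]
    have Wm: "rinv (W r s \<circ> ?m')" using Wrs m' by (rule rinv_comp)
    have "l2_norm G (W r s (\<eta> s)) = l2_norm G ((W r s \<circ> ?m') (dirac \<one>))"
      using rinv_norm_dirac[OF Wm, of "inv (x s)"] x[OF that(3)] by (simp add: \<eta>_def)
    also have "\<dots> = l2_norm G (m (adj G (W r s) (dirac \<one>)))"
      using rinv_norm_adj[OF Wm, symmetric]
      by (simp add: adj_comp rinv_bounded[OF Wrs] bounded_op_adj b adj_adj)
    also have "\<dots> \<le> C * l2_norm G (adj G (W r s) (dirac \<one>))"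
      using C(2) rinv_l2[OF rinv_adj[OF Wrs]] by (simp add: op_bound_def dirac_l2)
    also have "\<dots> \<le> C * ?\<delta>1"
      using less'[OF that] rinv_norm_adj[OF Wrs] C(1) by (intro mult_left_mono) auto
    finally have "l2_norm G (W r s (\<eta> s)) \<le> C * ?\<delta>1" .
    then have "l2_norm G (\<eta> r) * l2_norm G (W r s (\<eta> s)) \<le> t * (C * ?\<delta>1)"
      using \<eta>(2)[OF that(2)] t(2) by (simp add: mult_left_mono)
    then show ?thesis
      unfolding inner_a[OF that(2,3)]
      using l2_Cauchy_Schwarz[OF \<eta>(1)[OF that(2)] rinv_l2[OF Wrs \<eta>(1)[OF that(3)]]] by linarith
  qed
  have diag: "cmod (l2_inner G (a r) (a r)) \<le> C\<^sup>2 * t\<^sup>2" if "r < N" for r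
  proof -
    have "l2_norm G (a r) = l2_norm G (m (\<eta> r))"
      unfolding a_def using x[OF that] \<eta>(1)[OF that] rinv_l2[OF m] by (simp add: lambda_norm)
    also have "\<dots> \<le> C * t" using C(2) \<eta>[OF that] by (auto simp: op_bound_def)
    finally have "(l2_norm G (a r))\<^sup>2 \<le> (C * t)\<^sup>2" by (rule power_mono) (rule l2_norm_nonneg)
    then show ?thesis by (simp add: l2_inner_self[OF a[OF that]] power_mult_distrib norm_power)
  qed
  define S where "S = (\<lambda>y. \<Sum>r<N. a r y)"
  have S: "S \<in> l2 G" unfolding S_def by (rule l2_sum) (use a in auto)
  have "l2_inner G (dirac \<one>) (a r) = of_real (t\<^sup>2)" if "r < N" for r
  proof -
    have mem: "x r \<in> carrier G" "m (\<eta> r) \<in> l2 G" using x \<eta> that rinv_l2[OF m] by auto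
    have "l2_inner G (dirac \<one>) (a r) = l2_inner G (lambda_op G (x r) (dirac (inv (x r)))) (a r)"
      using mem by (simp add: lambda_dirac)
    also have "\<dots> = l2_inner G (dirac (inv (x r))) (m (\<eta> r))"
      unfolding a_def using mem by (simp add: lambda_inner dirac_l2)
    also have "\<dots> = l2_inner G (\<eta> r) (\<eta> r)"
      unfolding \<eta>_def[of r] using mem \<eta>(1)[OF that]
      by (simp add: inner_adj_left[OF b] dirac_l2 \<eta>_def)
    also have "\<dots> = of_real (t\<^sup>2)" using \<eta>[OF that] by (simp add: l2_inner_self)
    finally show ?thesis .
  qed
  then have "l2_inner G (dirac \<one>) S = of_real (real N * t\<^sup>2)"
    unfolding S_def by (subst l2_inner_sum_right) (use a in \<open>auto simp: dirac_l2\<close>)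
  then have "real N * t\<^sup>2 = cmod (l2_inner G (dirac \<one>) S)"
    by (simp add: norm_mult norm_power)
  also have "\<dots> \<le> l2_norm G S"
    using l2_Cauchy_Schwarz[OF dirac_l2[OF one_closed] S] by (simp add: l2_norm_dirac)
  finally have low: "(real N * t\<^sup>2)\<^sup>2 \<le> (l2_norm G S)\<^sup>2"
    by (rule power_mono) simp
  have "l2_inner G S S = (\<Sum>r<N. \<Sum>s<N. l2_inner G (a r) (a s))"
    by (subst (1) S_def, subst l2_inner_sum_left, rule S, use a in blast, rule sum.cong, rule refl)
      (subst S_def, subst l2_inner_sum_right, use a in auto)
  then have "(l2_norm G S)\<^sup>2 = cmod (\<Sum>r<N. \<Sum>s<N. l2_inner G (a r) (a s))"
    by (metis (no_types) S l2_inner_self abs_of_nonneg norm_of_real zero_le_power2)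
  also have "\<dots> \<le> (\<Sum>r<N. \<Sum>s<N. cmod (l2_inner G (a r) (a s)))"
    by (rule order_trans[OF norm_sum]) (intro sum_mono norm_sum)
  also have "\<dots> \<le> (\<Sum>r<N. \<Sum>s<N. (if r = s then C\<^sup>2 * t\<^sup>2 else 0) + t * (C * ?\<delta>1))"
  proof (intro sum_mono)
    fix r s assume rs: "r \<in> {..<N}" "s \<in> {..<N}"
    have "0 \<le> t * (C * ?\<delta>1)" using t C d by simp
    then show "cmod (l2_inner G (a r) (a s)) \<le> (if r = s then C\<^sup>2 * t\<^sup>2 else 0) + t * (C * ?\<delta>1)"
      using rs diag[of r] offdiag[of r s] by (cases "r = s") force+
  qed
  also have "\<dots> = real N * (C\<^sup>2 * t\<^sup>2) + (real N)\<^sup>2 * (t * (C * ?\<delta>1))"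
    by (simp add: sum.distrib sum.delta power2_eq_square algebra_simps)
  finally have up: "(real N * t\<^sup>2)\<^sup>2 \<le> real N * (C\<^sup>2 * t\<^sup>2) + (real N)\<^sup>2 * (t * (C * ?\<delta>1))"
    using low by linarith
  have N0: "real N > 0"
  proof (rule ccontr)
    assume "\<not> real N > 0"
    then show False using N C by auto
  qed
  have "(real N * t) * (real N * t ^ 3) \<le> (real N * t) * (C\<^sup>2 * t + real N * (C * ?\<delta>1))"
    using up by (simp add: power2_eq_square power3_eq_cube algebra_simps)
  then have "real N * t ^ 3 \<le> C\<^sup>2 * t + real N * (C * ?\<delta>1)"
    by (rule mult_left_le_imp_le) (use N0 t in simp)
  also have "C * ?\<delta>1 = \<delta> ^ 3 / 2" using C(1) by simp
  also have "C\<^sup>2 * t \<le> C ^ 3"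
    using mult_left_mono[OF tC, of "C\<^sup>2"] by (simp add: power2_eq_square power3_eq_cube)
  finally have "real N * t ^ 3 \<le> C ^ 3 + real N * (\<delta> ^ 3 / 2)" by simp
  moreover have "real N * \<delta> ^ 3 \<le> real N * t ^ 3"
    using t d by (intro mult_left_mono power_mono) auto
  ultimately show False using N by simp
qed

text \<open>Let \<xi> and \<eta> be the values of v and of its adjoint at
  \<open>dirac \<one>\<close>. The adjoint maps \<open>dirac (h \<otimes> y)\<close> to a right
  translate of \<eta>, concentrated near F1 h y. Translations are isometries, so truncating \<xi> to
  F0 and \<eta> to F1 costs the same for every h.\<close>

lemma uniform_support:
  assumes v: "rinv v" and e: "e > 0"
  obtains F1 F0 where "finite F1" "finite F0" "F1 \<subseteq> carrier G" "F0 \<subseteq> carrier G"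
    "\<And>h. h \<in> carrier G \<Longrightarrow> \<exists>f\<in>l2 G. (\<forall>x. f x \<noteq> 0 \<longrightarrow> (\<exists>a\<in>F1. \<exists>b\<in>F0. x = a \<otimes> h \<otimes> b)) \<and>
      l2_norm G (\<lambda>x. adj G v (lambda_op G h (v (dirac \<one>))) x - f x) \<le> e"
proof -
  let ?v' = "adj G v"
  have v': "rinv ?v'" using v by (rule rinv_adj)
  note b' = rinv_bounded[OF v']
  obtain C where C: "C > 0" "\<And>f. f \<in> l2 G \<Longrightarrow> l2_norm G (?v' f) \<le> C * l2_norm G f"
    using bounded_opE[OF b'] by blast
  define \<xi> where "\<xi> = v (dirac \<one>)"
  define \<eta> where "\<eta> = ?v' (dirac \<one>)"
  have \<xi>: "\<xi> \<in> l2 G" and \<eta>: "\<eta> \<in> l2 G"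
    by (simp_all add: \<xi>_def \<eta>_def rinv_l2[OF v] rinv_l2[OF v'] dirac_l2)
  obtain F0 where F0: "finite F0" "F0 \<subseteq> carrier G"
    "l2_norm G (\<lambda>x. \<xi> x - (if x \<in> F0 then \<xi> x else 0)) \<le> e / (2 * C)"
    using l2_approx[OF \<xi>, of "e / (2 * C)"] e C(1) by auto
  define D where "D = (\<Sum>y\<in>F0. cmod (\<xi> y))"
  have D: "D \<ge> 0" by (simp add: D_def sum_nonneg)
  \<comment> \<open>The truncation error of \<eta> gets multiplied by the coefficients of \<xi> on
    F0, so F0 comes first and its coefficient sum D fixes the tolerance here; D + 1 avoids division
    by 0.\<close>
  obtain F1 where F1: "finite F1" "F1 \<subseteq> carrier G"
    "l2_norm G (\<lambda>x. \<eta> x - (if x \<in> F1 then \<eta> x else 0)) \<le> e / (2 * (D + 1))"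
    using l2_approx[OF \<eta>, of "e / (2 * (D + 1))"] e D by auto
  define \<xi>0 where "\<xi>0 = (\<lambda>x. if x \<in> F0 then \<xi> x else 0)"
  define \<eta>0 where "\<eta>0 = (\<lambda>x. if x \<in> F1 then \<eta> x else 0)"
  have \<xi>0: "\<xi>0 \<in> l2 G" and \<eta>0: "\<eta>0 \<in> l2 G"
    unfolding \<xi>0_def \<eta>0_def by (intro l2_restrict \<xi> \<eta>)+
  have "\<exists>f\<in>l2 G. (\<forall>x. f x \<noteq> 0 \<longrightarrow> (\<exists>a\<in>F1. \<exists>b\<in>F0. x = a \<otimes> h \<otimes> b)) \<and>
      l2_norm G (\<lambda>x. ?v' (lambda_op G h \<xi>) x - f x) \<le> e" if h: "h \<in> carrier G" for h
  proof -
    note bl = bounded_op_lambda[OF h]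
    have cl: "h \<otimes> y \<in> carrier G" "y \<in> carrier G" if "y \<in> F0" for y using that F0(2) h by auto
    define f where "f = (\<lambda>x. \<Sum>y\<in>F0. \<xi> y * rho (inv (h \<otimes> y)) \<eta>0 x)"
    have term0: "(\<lambda>x. \<xi> y * rho (inv (h \<otimes> y)) \<eta>0 x) \<in> l2 G" if "y \<in> F0" for y
      using cl[OF that] by (intro l2_scale rho_l2 \<eta>0) auto
    have f: "f \<in> l2 G" unfolding f_def using term0 by (rule l2_sum)
    have supp: "\<exists>a\<in>F1. \<exists>b\<in>F0. x = a \<otimes> h \<otimes> b" if fx: "f x \<noteq> 0" for x
    proof -
      obtain y where y: "y \<in> F0" "rho (inv (h \<otimes> y)) \<eta>0 x \<noteq> 0"
        using sum.not_neutral_contains_not_neutral[OF fx[unfolded f_def]] by auto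
      then have x: "x \<in> carrier G" "x \<otimes> inv (h \<otimes> y) \<in> F1"
        unfolding rho_apply[OF \<eta>0] by (auto simp: \<eta>0_def split: if_splits)
      moreover have "x = x \<otimes> inv (h \<otimes> y) \<otimes> h \<otimes> y"
        using x(1) h cl[OF y(1)] by (simp add: m_assoc)
      ultimately show ?thesis using y(1) by blast
    qed
    have \<xi>0s: "\<xi>0 = (\<lambda>x. \<Sum>y\<in>F0. \<xi> y * dirac y x)"
      unfolding \<xi>0_def using F0(1) by (rule l2_restrict_sum)
    have memb: "(\<lambda>x. \<xi> y * dirac y x) \<in> l2 G" "dirac y \<in> l2 G" if "y \<in> F0" for y
      using cl[OF that] by (auto intro!: l2_scale dirac_l2)
    have memb2: "(\<lambda>x. \<xi> y * dirac (h \<otimes> y) x) \<in> l2 G" "dirac (h \<otimes> y) \<in> l2 G" if "y \<in> F0" for y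
      using cl[OF that] by (auto intro!: l2_scale dirac_l2)
    have "lambda_op G h \<xi>0 = (\<lambda>x. \<Sum>y\<in>F0. lambda_op G h (\<lambda>x. \<xi> y * dirac y x) x)"
      unfolding \<xi>0s by (rule bounded_op_sum[OF bl]) (rule memb)
    also have "\<dots> = (\<lambda>x. \<Sum>y\<in>F0. \<xi> y * dirac (h \<otimes> y) x)"
      by (intro ext sum.cong refl)
        (simp add: bounded_op_scale[OF bl memb(2)] lambda_dirac[OF h] cl)
    finally have "?v' (lambda_op G h \<xi>0) = ?v' (\<lambda>x. \<Sum>y\<in>F0. \<xi> y * dirac (h \<otimes> y) x)"
      by simp
    also have "\<dots> = (\<lambda>x. \<Sum>y\<in>F0. ?v' (\<lambda>x. \<xi> y * dirac (h \<otimes> y) x) x)"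
      by (rule bounded_op_sum[OF b']) (rule memb2)
    also have "\<dots> = (\<lambda>x. \<Sum>y\<in>F0. \<xi> y * rho (inv (h \<otimes> y)) \<eta> x)"
      by (intro ext sum.cong refl)
        (simp add: bounded_op_scale[OF b' memb2(2)] rinv_dirac[OF v' cl(1)] \<eta>_def)
    finally have vl: "?v' (lambda_op G h \<xi>0) = (\<lambda>x. \<Sum>y\<in>F0. \<xi> y * rho (inv (h \<otimes> y)) \<eta> x)" .
    define q where "q = (\<lambda>x. \<eta> x - \<eta>0 x)"
    have q: "q \<in> l2 G" "l2_norm G q \<le> e / (2 * (D + 1))"
      using F1(3) by (auto simp: q_def \<eta>0_def intro!: l2_diff \<eta> \<eta>0[unfolded \<eta>0_def])
    have "(\<lambda>x. ?v' (lambda_op G h \<xi>0) x - f x) = (\<lambda>x. \<Sum>y\<in>F0. \<xi> y * rho (inv (h \<otimes> y)) q x)"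
    proof
      fix x
      have "rho k \<eta> x - rho k \<eta>0 x = rho k q x" for k
        by (simp add: rho_apply \<eta> \<eta>0 q(1)) (simp add: q_def)
      then show "?v' (lambda_op G h \<xi>0) x - f x = (\<Sum>y\<in>F0. \<xi> y * rho (inv (h \<otimes> y)) q x)"
        unfolding vl f_def sum_subtractf[symmetric] right_diff_distrib[symmetric] by simp
    qed
    then have "l2_norm G (\<lambda>x. ?v' (lambda_op G h \<xi>0) x - f x)
        \<le> (\<Sum>y\<in>F0. l2_norm G (\<lambda>x. \<xi> y * rho (inv (h \<otimes> y)) q x))"
      using l2_norm_sum[OF F0(1), of "\<lambda>y x. \<xi> y * rho (inv (h \<otimes> y)) q x" G] cl q(1)
      by (simp add: l2_scale rho_l2)
    also have "\<dots> = (\<Sum>y\<in>F0. cmod (\<xi> y) * l2_norm G q)"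
      by (intro sum.cong refl) (simp add: l2_norm_scale rho_norm cl q(1))
    also have "\<dots> = D * l2_norm G q" by (simp add: D_def sum_distrib_right)
    also have "\<dots> \<le> D * (e / (2 * (D + 1)))" using D q(2) by (rule mult_left_mono[rotated])
    also have "\<dots> \<le> e / 2" using D e by (simp add: field_simps)
    finally have d2: "l2_norm G (\<lambda>x. ?v' (lambda_op G h \<xi>0) x - f x) \<le> e / 2" .
    have mem: "lambda_op G h \<xi> \<in> l2 G" "lambda_op G h \<xi>0 \<in> l2 G"
      "(\<lambda>x. \<xi> x - \<xi>0 x) \<in> l2 G"
      using h \<xi> \<xi>0 by (auto intro: lambda_l2 l2_diff)
    have "(\<lambda>x. ?v' (lambda_op G h \<xi>) x - ?v' (lambda_op G h \<xi>0) x)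
        = ?v' (lambda_op G h (\<lambda>x. \<xi> x - \<xi>0 x))"
      using \<xi> \<xi>0 mem by (simp add: bounded_op_diff[OF bl] bounded_op_diff[OF b'])
    then have "l2_norm G (\<lambda>x. ?v' (lambda_op G h \<xi>) x - ?v' (lambda_op G h \<xi>0) x)
        \<le> C * l2_norm G (\<lambda>x. \<xi> x - \<xi>0 x)"
      using C(2)[of "lambda_op G h (\<lambda>x. \<xi> x - \<xi>0 x)"] mem(3) h by (simp add: lambda_l2 lambda_norm)
    also have "\<dots> \<le> C * (e / (2 * C))"
      using F0(3) C(1) by (intro mult_left_mono) (simp_all add: \<xi>0_def)
    also have "\<dots> = e / 2" using C(1) by simp
    finally have "l2_norm G (\<lambda>x. ?v' (lambda_op G h \<xi>) x - f x) \<le> e"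
      using d2 l2_norm_diff_triangle[OF rinv_l2[OF v' mem(1)] rinv_l2[OF v' mem(2)] f] by linarith
    then show ?thesis using f supp by blast
  qed
  then show ?thesis
    unfolding \<xi>_def using that[OF F1(1) F0(1) F1(2) F0(2)] by blast
qed

subsection \<open>From the intertwining to generic sets\<close>

text \<open>Faithfulness of the trace: the adjoint of v has the same 2-norm, and right invariance
  carries its vanishing from \<open>dirac \<one>\<close> to every \<open>dirac x\<close>.\<close>

lemma rinv_eq_zero:
  assumes v: "rinv v" and "l2_norm G (v (dirac \<one>)) = 0"
  shows "v = zero_op"
proof (intro ext)
  fix f x
  note b = rinv_bounded[OF v]
  show "v f x = zero_op f x"
  proof (cases "f \<in> l2 G \<and> x \<in> carrier G")
    case True
    then have "l2_norm G (adj G v (dirac x)) = 0"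
      using assms(2) by (simp add: rinv_norm_dirac[OF rinv_adj[OF v]] rinv_norm_adj[OF v])
    then have "cmod (l2_inner G (adj G v (dirac x)) f) \<le> 0"
      using l2_Cauchy_Schwarz[of "adj G v (dirac x)" G f] True
      by (simp add: rinv_l2[OF rinv_adj[OF v]] dirac_l2)
    then have "l2_inner G (dirac x) (v f) = 0"
      using True by (simp add: inner_adj_left[OF b] dirac_l2)
    then show ?thesis using True by (simp add: l2_inner_dirac zero_op_def)
  next
    case False
    then show ?thesis
      using bounded_op_outside[OF b, of f] l2_outside[OF rinv_l2[OF v], of f x]
      by (cases "f \<in> l2 G") (auto simp: zero_op_def)
  qed
qed

lemma op_bound_mono:
  assumes "op_bound C T" "C \<le> D" shows "op_bound D T"
  unfolding op_bound_def
proof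
  fix f assume "f \<in> l2 G"
  then have "l2_norm G (T f) \<le> C * l2_norm G f" using assms(1) by (simp add: op_bound_def)
  also have "\<dots> \<le> D * l2_norm G f" using assms(2) by (rule mult_right_mono) (rule l2_norm_nonneg)
  finally show "l2_norm G (T f) \<le> D * l2_norm G f" .
qed

lemma op_boundE:
  assumes "bounded_op G T"
  obtains C where "C > 0" "op_bound C T" "op_bound C (adj G T)"
proof -
  obtain C where C: "C > 0" "\<And>f. f \<in> l2 G \<Longrightarrow> l2_norm G (T f) \<le> C * l2_norm G f"
    using bounded_opE[OF assms] by blast
  obtain D where D: "D > 0" "\<And>f. f \<in> l2 G \<Longrightarrow> l2_norm G (adj G T f) \<le> D * l2_norm G f"
    using bounded_opE[OF bounded_op_adj[OF assms]] by blast
  show ?thesis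
  proof (rule that[of "max C D"])
    show "op_bound (max C D) T" "op_bound (max C D) (adj G T)"
      by (rule op_bound_mono[of C] op_bound_mono[of D]; use C D in \<open>simp add: op_bound_def\<close>)+
  qed (use C(1) in simp)
qed

lemma op_bound_comp:
  assumes "op_bound C S" "op_bound D T" "C \<ge> 0" "\<And>f. f \<in> l2 G \<Longrightarrow> T f \<in> l2 G"
  shows "op_bound (C * D) (S \<circ> T)"
  unfolding op_bound_def
proof
  fix f assume f: "f \<in> l2 G"
  have "l2_norm G (S (T f)) \<le> C * l2_norm G (T f)"
    using assms(1,4) f by (simp add: op_bound_def)
  also have "\<dots> \<le> C * (D * l2_norm G f)"
    using assms(2,3) f by (intro mult_left_mono) (auto simp: op_bound_def)
  finally show "l2_norm G ((S \<circ> T) f) \<le> C * D * l2_norm G f" by (simp add: mult.assoc)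
qed

lemma op_bound_lambda: "k \<in> carrier G \<Longrightarrow> op_bound 1 (lambda_op G k)"
  by (simp add: op_bound_def lambda_norm)

text \<open>If w is almost supported in a finite set and w and its conjugate by k are not almost
  orthogonal, then k conjugates one element of that set into another one.\<close>
lemma support_overlap:
  assumes w: "rinv w" and k: "k \<in> carrier G"
    and B: "l2_norm G (w (dirac \<one>)) \<le> B"
    and f: "f \<in> l2 G" "l2_norm G (\<lambda>x. w (dirac \<one>) x - f x) \<le> e" and e: "0 \<le> e"
    and big: "e * (2 * B + e) < cmod (l2_inner G (lambda_op G k (w (dirac \<one>))) (w (lambda_op G k (dirac \<one>))))"
  shows "\<exists>y z. f y \<noteq> 0 \<and> f z \<noteq> 0 \<and> y \<in> carrier G \<and> z \<in> carrier G \<and> k \<otimes> y = z \<otimes> k"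
proof -
  define z where "z = w (dirac \<one>)"
  have z: "z \<in> l2 G" by (simp add: z_def rinv_l2[OF w] dirac_l2)
  have "w (lambda_op G k (dirac \<one>)) = rho (inv k) z"
    using k by (simp add: lambda_dirac rinv_dirac[OF w k] z_def)
  note big' = big[unfolded this, folded z_def]
  define d where "d = (\<lambda>x. z x - f x)"
  have d: "d \<in> l2 G" "l2_norm G d \<le> e"
    using z f by (auto simp: d_def z_def intro: l2_diff)
  have zfd: "z = (\<lambda>x. f x + d x)" by (simp add: d_def)
  have ik: "inv k \<in> carrier G" using k by simp
  have mem: "lambda_op G k f \<in> l2 G" "lambda_op G k d \<in> l2 G" "rho (inv k) f \<in> l2 G" "rho (inv k) d \<in> l2 G"
      "rho (inv k) z \<in> l2 G"
    using k ik f(1) d(1) z by (auto intro: lambda_l2 rho_l2)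
  have zB: "l2_norm G z \<le> B" using B by (simp add: z_def)
  have B0: "0 \<le> B" using zB l2_norm_nonneg[of G z] by linarith
  have fB: "l2_norm G f \<le> B + e"
  proof -
    have "l2_norm G (\<lambda>x. z x + (-1) * d x) \<le> l2_norm G z + l2_norm G (\<lambda>x. (-1) * d x)"
      using z d(1) by (intro l2_norm_triangle l2_scale)
    also have "\<dots> \<le> B + e" using zB d(2) unfolding l2_norm_scale by simp
    also have "(\<lambda>x. z x + (-1) * d x) = f" by (simp add: d_def)
    finally show ?thesis .
  qed
  have "l2_inner G (lambda_op G k f) (rho (inv k) f) \<noteq> 0"
  proof
    assume 0: "l2_inner G (lambda_op G k f) (rho (inv k) f) = 0"
    have lz: "lambda_op G k z = (\<lambda>x. lambda_op G k f x + lambda_op G k d x)"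
      unfolding zfd using f(1) d(1) by (rule bounded_op_add[OF bounded_op_lambda[OF k]])
    have rz: "rho (inv k) z = (\<lambda>x. rho (inv k) f x + rho (inv k) d x)"
      unfolding zfd using f(1) d(1) by (rule bounded_op_add[OF bounded_op_rho[OF ik]])
    have "l2_inner G (lambda_op G k z) (rho (inv k) z)
        = l2_inner G (lambda_op G k f) (rho (inv k) z) + l2_inner G (lambda_op G k d) (rho (inv k) z)"
      unfolding lz using mem by (intro l2_inner_add_left)
    also have "l2_inner G (lambda_op G k f) (rho (inv k) z) = l2_inner G (lambda_op G k f) (rho (inv k) d)"
      unfolding rz using mem by (simp add: l2_inner_add_right 0)
    finally have "cmod (l2_inner G (lambda_op G k z) (rho (inv k) z))
        \<le> cmod (l2_inner G (lambda_op G k f) (rho (inv k) d)) + cmod (l2_inner G (lambda_op G k d) (rho (inv k) z))"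
      by (simp add: norm_triangle_ineq)
    also have "\<dots> \<le> l2_norm G f * l2_norm G d + l2_norm G d * l2_norm G z"
      using l2_Cauchy_Schwarz[OF mem(1,4)] l2_Cauchy_Schwarz[OF mem(2,5)] k ik f(1) d(1) z
      by (simp add: lambda_norm rho_norm)
    also have "\<dots> \<le> (B + e) * e + e * B"
      using fB zB d(2) e B0 by (intro add_mono mult_mono) (auto simp: l2_norm_nonneg)
    finally show False using big' by (simp add: algebra_simps)
  qed
  then obtain x where x: "x \<in> carrier G" "lambda_op G k f x \<noteq> 0" "rho (inv k) f x \<noteq> 0"
    unfolding l2_inner_def using infsum_0[of "carrier G" "\<lambda>x. cnj (lambda_op G k f x) * rho (inv k) f x"]
    by auto
  then have "f (inv k \<otimes> x) \<noteq> 0" "f (x \<otimes> inv k) \<noteq> 0"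
    using f(1) by (simp_all add: lambda_apply rho_apply)
  moreover have "k \<otimes> (inv k \<otimes> x) = (x \<otimes> inv k) \<otimes> k"
    using k x(1) by (simp add: m_assoc)
  ultimately show ?thesis using k x(1) by (intro exI[of _ "inv k \<otimes> x"] exI[of _ "x \<otimes> inv k"]) simp
qed

text \<open>The hypothesis \<open>com\<close> gives commutation with the compressions p \<lambda>_g
  p, not with \<lambda>_g itself; v p = v lets p be inserted next to v and its adjoint where
  needed.\<close>

lemma generic_of_commuting_family:
  assumes S1: "subgroup S1 G" and S2: "subgroup S2 G"
    and p: "rinv p" "adj G p = p" "p \<circ> p = p"
    and v: "rinv v" "v \<noteq> zero_op" "v \<circ> p = v"
    and com: "\<And>g h f. g \<in> S1 \<Longrightarrow> h \<in> S2 \<Longrightarrow> f \<in> l2 G \<Longrightarrow>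
      p (lambda_op G g (p (adj G v (lambda_op G h (v f))))) = adj G v (lambda_op G h (v (p (lambda_op G g (p f)))))"
  obtains I T E N where "finite I" "I \<subseteq> carrier G \<times> carrier G" "T \<subseteq> S2" "finite E" "E \<subseteq> S2"
    "S2 \<subseteq> (\<Union>f\<in>E. (\<lambda>d. f \<otimes> d) ` T)"
    "\<And>h. h \<in> T \<Longrightarrow> \<exists>A. finite A \<and> A \<subseteq> S1 \<and> card A \<le> (N::nat) \<and>
      S1 \<subseteq> (\<Union>f\<in>A. (\<lambda>k. f \<otimes> k) ` {k \<in> S1. \<exists>(a, b)\<in>I. \<exists>(c, d)\<in>I.
        k \<otimes> (a \<otimes> h \<otimes> b) = (c \<otimes> h \<otimes> d) \<otimes> k})"
proof -
  have S1G: "S1 \<subseteq> carrier G" and S2G: "S2 \<subseteq> carrier G"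
    using S1 S2 by (auto dest: subgroup.subset)
  let ?v' = "adj G v" and ?e = "dirac \<one>"
  have e1: "?e \<in> l2 G" by (simp add: dirac_l2)
  note bv = rinv_bounded[OF v(1)] and bp = rinv_bounded[OF p(1)] and v' = rinv_adj[OF v(1)]
  obtain C where C: "C > 0" "op_bound C v" "op_bound C ?v'" using op_boundE[OF bv] by blast
  define B where "B = C * C"
  have B: "B > 0" using C by (simp add: B_def)
  define w where "w h = ?v' \<circ> (lambda_op G h \<circ> v)" for h
  have w: "rinv (w h)" if "h \<in> S2" for h
    unfolding w_def using that S2G by (intro rinv_comp v v' rinv_lambda) auto
  have wadj: "adj G (w h) = w (inv h)" if "h \<in> S2" for h
  proof -
    have h: "h \<in> carrier G" using that S2G by auto
    show ?thesis unfolding w_def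
      by (simp add: adj_comp bounded_op_comp bounded_op_lambda[OF h] bv bounded_op_adj adj_adj
          adj_lambda[OF h] comp_assoc)
  qed
  have wB: "op_bound B (w h)" if "h \<in> S2" for h
  proof -
    have h: "h \<in> carrier G" using that S2G by auto
    have "op_bound (1 * C) (lambda_op G h \<circ> v)"
      by (rule op_bound_comp[OF op_bound_lambda[OF h] C(2)]) (auto simp: rinv_l2[OF v(1)])
    then show ?thesis unfolding w_def B_def using C(1)
      by (intro op_bound_comp C(3)) (auto simp: lambda_l2 h rinv_l2[OF v(1)])
  qed
  have wB': "op_bound B (adj G (w h))" if "h \<in> S2" for h
    unfolding wadj[OF that] using that S2 by (intro wB subgroup.m_inv_closed)
  have wp: "w h \<circ> p = w h" for h
    unfolding w_def by (simp add: comp_assoc v(3))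
  have pw: "p (w h f) = w h f" for h f
  proof -
    have "p \<circ> ?v' = ?v'" using adj_comp[OF bv bp] by (simp add: v(3) p(2))
    then show ?thesis unfolding w_def by (metis comp_apply)
  qed
  define \<delta> where "\<delta> = l2_norm G (v ?e)"
  have \<delta>: "\<delta> > 0"
    using rinv_eq_zero[OF v(1)] v(2) l2_norm_nonneg[of G "v ?e"] by (auto simp: \<delta>_def order_less_le)
  \<comment> \<open>\<delta>1 is the overlap that \<open>translates_overlap\<close> returns for v.
    It becomes the lower 2-norm bound in the second application, to the adjoint of
    \<open>w h\<close>, so that \<delta>2 and N2 do not depend on h.\<close>
  define \<delta>1 where "\<delta>1 = \<delta> ^ 3 / (2 * C)"
  have \<delta>1: "\<delta>1 > 0" using \<delta> C(1) by (simp add: \<delta>1_def)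
  obtain N1 :: nat where N1: "real N1 * \<delta> ^ 3 > 2 * C ^ 3"
    using reals_Archimedean3[of "\<delta> ^ 3"] \<delta> by auto
  define T where "T = {h \<in> S2. \<delta>1 \<le> l2_norm G (w h ?e)}"
  have gT: "\<exists>r s. r < s \<and> s < N1 \<and> inv (x r) \<otimes> x s \<in> T" if x: "\<And>i. i < N1 \<Longrightarrow> x i \<in> S2" for x
  proof -
    have xG: "x i \<in> carrier G" if "i < N1" for i using x[OF that] S2G by auto
    have "\<exists>r s. r < s \<and> s < N1 \<and> \<delta>1 \<le> l2_norm G (?v' (lambda_op G (inv (x r) \<otimes> x s) (v ?e)))"
      unfolding \<delta>1_def by (rule translates_overlap[OF v(1) C \<delta> _ N1 xG]) (simp add: \<delta>_def)
    then obtain r s where rs: "r < s" "s < N1"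
      "\<delta>1 \<le> l2_norm G (?v' (lambda_op G (inv (x r) \<otimes> x s) (v ?e)))" by (elim exE conjE)
    have "inv (x r) \<otimes> x s \<in> S2"
      using S2 x[of r] x[of s] rs by (simp add: subgroup.m_closed subgroup.m_inv_closed)
    then show ?thesis using rs by (auto simp: T_def w_def)
  qed
  have "\<exists>E. finite E \<and> E \<subseteq> S2 \<and> card E \<le> N1 \<and> S2 \<subseteq> (\<Union>f\<in>E. (\<lambda>d. f \<otimes> d) ` T)"
    by (rule generic_by_pigeonhole[OF S2], rule gT)
  then obtain E where E: "finite E" "E \<subseteq> S2" "S2 \<subseteq> (\<Union>f\<in>E. (\<lambda>d. f \<otimes> d) ` T)"
    by (elim exE conjE)
  define \<delta>2 where "\<delta>2 = \<delta>1 ^ 3 / (2 * B)"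
  have \<delta>2: "\<delta>2 > 0" using \<delta>1 B by (simp add: \<delta>2_def)
  obtain N2 :: nat where N2: "real N2 * \<delta>1 ^ 3 > 2 * B ^ 3"
    using reals_Archimedean3[of "\<delta>1 ^ 3"] \<delta>1 by auto
  \<comment> \<open>\<open>support_overlap\<close> needs \<epsilon> (2 B + \<epsilon>) below the
    lower bound (\<delta>2 / B)^2 for an inner product; \<epsilon> \<le> 1 reduces this to a linear
    condition.\<close>
  define \<epsilon> where "\<epsilon> = min 1 ((\<delta>2 / B)\<^sup>2 / (2 * (2 * B + 1)))"
  have \<epsilon>: "\<epsilon> > 0" using \<delta>2 B by (simp add: \<epsilon>_def)
  have \<epsilon>': "\<epsilon> * (2 * B + \<epsilon>) < (\<delta>2 / B)\<^sup>2"
  proof -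
    have cancel: "x / (2 * c) * c = x / 2" if "c \<noteq> 0" for x c :: real
      using that by simp
    have "\<epsilon> * (2 * B + \<epsilon>) \<le> ((\<delta>2 / B)\<^sup>2 / (2 * (2 * B + 1))) * (2 * B + 1)"
      using B \<epsilon> by (intro mult_mono) (auto simp: \<epsilon>_def)
    also have "\<dots> = (\<delta>2 / B)\<^sup>2 / 2" by (rule cancel) (use B in simp)
    also have "\<dots> < (\<delta>2 / B)\<^sup>2" using zero_less_power[OF divide_pos_pos[OF \<delta>2 B], of 2] by linarith
    finally show ?thesis .
  qed
  obtain F1 F0 where F: "finite F1" "finite F0" "F1 \<subseteq> carrier G" "F0 \<subseteq> carrier G"
    and supp: "\<And>h. h \<in> carrier G \<Longrightarrow> \<exists>f\<in>l2 G. (\<forall>x. f x \<noteq> 0 \<longrightarrow> (\<exists>a\<in>F1. \<exists>b\<in>F0. x = a \<otimes> h \<otimes> b)) \<and>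
      l2_norm G (\<lambda>x. ?v' (lambda_op G h (v ?e)) x - f x) \<le> \<epsilon>"
    by (rule uniform_support[OF v(1) \<epsilon>]) (rule that)
  let ?I = "F1 \<times> F0"
  have cov: "\<exists>A. finite A \<and> A \<subseteq> S1 \<and> card A \<le> N2 \<and>
      S1 \<subseteq> (\<Union>f\<in>A. (\<lambda>k. f \<otimes> k) ` {k \<in> S1. \<exists>(a, b)\<in>?I. \<exists>(c, d)\<in>?I.
        k \<otimes> (a \<otimes> h \<otimes> b) = (c \<otimes> h \<otimes> d) \<otimes> k})" if h: "h \<in> T" for h
  proof (rule generic_by_pigeonhole[OF S1])
    have h2: "h \<in> S2" "h \<in> carrier G" using h S2G by (auto simp: T_def)
    define u where "u = w h"
    have u: "rinv u" unfolding u_def by (rule w[OF h2(1)])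
    note bu = rinv_bounded[OF u] and u' = rinv_adj[OF u]
    have uB: "op_bound B u" "op_bound B (adj G u)"
      unfolding u_def using wB[OF h2(1)] wB'[OF h2(1)] by auto
    have u1: "\<delta>1 \<le> l2_norm G (adj G u ?e)"
      unfolding rinv_norm_adj[OF u] using h by (simp add: T_def u_def)
    obtain f where f: "f \<in> l2 G" "\<And>x. f x \<noteq> 0 \<Longrightarrow> \<exists>a\<in>F1. \<exists>b\<in>F0. x = a \<otimes> h \<otimes> b"
      "l2_norm G (\<lambda>x. u ?e x - f x) \<le> \<epsilon>"
      using supp[OF h2(2)] by (auto simp: u_def w_def)
    fix x :: "nat \<Rightarrow> 'a" assume x: "\<And>i. i < N2 \<Longrightarrow> x i \<in> S1"
    have xG: "x i \<in> carrier G" if "i < N2" for i using x[OF that] S1G by auto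
    have uu: "op_bound B (adj G (adj G u))" using uB(1) by (simp add: adj_adj[OF bu])
    \<comment> \<open>Taking the adjoint of u for m puts u to the left of the translation: the bound
      obtained concerns u \<lambda>_k (adj u).\<close>
    have "\<exists>r s. r < s \<and> s < N2 \<and>
        \<delta>2 \<le> l2_norm G (adj G (adj G u) (lambda_op G (inv (x r) \<otimes> x s) (adj G u ?e)))"
      unfolding \<delta>2_def by (rule translates_overlap[OF u' B uB(2) uu \<delta>1 u1 N2 xG])
    then obtain r s where rs: "r < s" "s < N2"
      and rs\<delta>: "\<delta>2 \<le> l2_norm G (adj G (adj G u) (lambda_op G (inv (x r) \<otimes> x s) (adj G u ?e)))"
      by (elim exE conjE)
    define k where "k = inv (x r) \<otimes> x s"
    have k: "k \<in> S1" "k \<in> carrier G"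
      unfolding k_def using S1 x[of r] x[of s] xG[of r] xG[of s] rs
      by (simp_all add: subgroup.m_closed subgroup.m_inv_closed)
    have big: "\<delta>2 \<le> l2_norm G (u (lambda_op G k (adj G u ?e)))"
      using rs\<delta> by (simp add: adj_adj[OF bu] k_def)
    define t where "t = u \<circ> lambda_op G k"
    note l = rinv_lambda[OF k(2)]
    have t: "rinv t" unfolding t_def by (rule rinv_comp[OF u l])
    note bt = rinv_bounded[OF t] and t' = rinv_adj[OF t]
    have t'e: "adj G t ?e \<in> l2 G" using rinv_l2[OF t' e1] .
    \<comment> \<open>The trace trades t (adj u) for u (adj t), which equals u p (adj t) because u p
      = u. Hence p (adj t) at \<open>dirac \<one>\<close> has norm at least \<delta>2 / B.\<close>
    have "l2_norm G ((t \<circ> adj G u) ?e) = l2_norm G ((u \<circ> adj G t) ?e)"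
      using rinv_norm_adj[OF rinv_comp[OF t u']] by (simp add: adj_comp bt bounded_op_adj bu adj_adj)
    also have "(u \<circ> adj G t) ?e = u (p (adj G t ?e))"
      using wp[of h] by (metis comp_apply u_def)
    also have "l2_norm G \<dots> \<le> B * l2_norm G (p (adj G t ?e))"
      using uB(1) rinv_l2[OF p(1) t'e] by (simp add: op_bound_def)
    finally have "\<delta>2 / B \<le> l2_norm G (p (adj G t ?e))"
      using big B by (simp add: t_def field_simps)
    then have sq: "(\<delta>2 / B)\<^sup>2 \<le> (l2_norm G (p (adj G t ?e)))\<^sup>2"
      using \<delta>2 B by (intro power_mono) auto
    have tp: "rinv (t \<circ> p)" using t p(1) by (rule rinv_comp)
    have te: "t ?e \<in> l2 G" "lambda_op G k (u ?e) \<in> l2 G"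
      using rinv_l2[OF t e1] rinv_l2[OF l rinv_l2[OF u e1]] by auto
    have pte: "p (t ?e) = t ?e" unfolding t_def u_def using pw by simp
    have pue: "p (u ?e) = u ?e" unfolding u_def using pw by simp
    \<comment> \<open>Since p u = u, both sides of \<lambda>_k may be compressed by p, and
      \<open>com\<close> then moves u outside, giving t p at \<open>dirac \<one>\<close>. The trace
      property identifies the inner product with the squared norm just bounded below.\<close>
    have "l2_inner G (lambda_op G k (u ?e)) (t ?e) = l2_inner G (p (lambda_op G k (u ?e))) (t ?e)"
      using inner_adj[OF bp te(2,1)] by (simp add: p(2) pte)
    also have "p (lambda_op G k (u ?e)) = p (lambda_op G k (p (u ?e)))"
      by (simp add: pue)
    also have "\<dots> = u (p (lambda_op G k (p ?e)))"
      using com[OF k(1) h2(1) e1] by (simp add: u_def w_def)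
    also have "\<dots> = (t \<circ> p) ?e"
      using wp[of h] unfolding t_def u_def by (metis comp_apply)
    also have "l2_inner G \<dots> (t ?e) = l2_inner G (adj G t ?e) (p (adj G t ?e))"
      using rinv_inner_adj[OF tp t] by (simp add: adj_comp[OF bt bp] p(2))
    also have "\<dots> = l2_inner G (adj G t ?e) (p (p (adj G t ?e)))"
      using p(3) by (metis comp_apply)
    also have "\<dots> = l2_inner G (p (adj G t ?e)) (p (adj G t ?e))"
      using inner_adj[OF bp t'e rinv_l2[OF p(1) t'e]] by (simp add: p(2))
    also have "\<dots> = of_real ((l2_norm G (p (adj G t ?e)))\<^sup>2)"
      by (rule l2_inner_self[OF rinv_l2[OF p(1) t'e]])
    finally have "cmod (l2_inner G (lambda_op G k (u ?e)) (u (lambda_op G k ?e)))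
        = (l2_norm G (p (adj G t ?e)))\<^sup>2"
      by (simp add: t_def norm_power)
    then have "\<epsilon> * (2 * B + \<epsilon>) < cmod (l2_inner G (lambda_op G k (u ?e)) (u (lambda_op G k ?e)))"
      using \<epsilon>' sq by linarith
    moreover have "l2_norm G (u ?e) \<le> B"
      using uB(1) e1 l2_norm_dirac[OF one_closed] by (force simp: op_bound_def)
    ultimately obtain y z where yz: "f y \<noteq> 0" "f z \<noteq> 0" "k \<otimes> y = z \<otimes> k"
      using support_overlap[OF u k(2) _ f(1,3), of B] \<epsilon> by auto
    then have "\<exists>(a, b)\<in>?I. \<exists>(c, d)\<in>?I. k \<otimes> (a \<otimes> h \<otimes> b) = (c \<otimes> h \<otimes> d) \<otimes> k"
      using f(2)[OF yz(1)] f(2)[OF yz(2)] by blast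
    then show "\<exists>r s. r < s \<and> s < N2 \<and> inv (x r) \<otimes> x s \<in> {k \<in> S1. \<exists>(a, b)\<in>?I. \<exists>(c, d)\<in>?I.
        k \<otimes> (a \<otimes> h \<otimes> b) = (c \<otimes> h \<otimes> d) \<otimes> k}"
      using rs k(1) unfolding k_def by blast
  qed
  show ?thesis
    by (rule that[of ?I T E N2]) (use F E cov in \<open>auto simp: T_def\<close>)
qed

text \<open>Write X_g for p \<lambda>_g p and v' for the adjoint of v. The intertwining relation for
  the adjoint of X_g, which is X_{g^-1}, gives X_g v' = v' \<theta>(X_g) because \<theta> preserves
  adjoints. Therefore X_g v' \<lambda>_h v = v' \<theta>(X_g) \<lambda>_h v = v' \<lambda>_h
  \<theta>(X_g) v = v' \<lambda>_h v X_g.\<close>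

lemma intertwines_commuting_family:
  assumes S1: "subgroup S1 G" and S2: "subgroup S2 G"
    and "intertwines G (group_vNa G (carrier G)) (group_vNa G S1)
           (commutant G (group_vNa G S2) \<inter> group_vNa G (carrier G))"
  obtains p v where "rinv p" "adj G p = p" "p \<circ> p = p" "rinv v" "v \<noteq> zero_op" "v \<circ> p = v"
    "\<And>g h f. g \<in> S1 \<Longrightarrow> h \<in> S2 \<Longrightarrow> f \<in> l2 G \<Longrightarrow>
      p (lambda_op G g (p (adj G v (lambda_op G h (v f))))) = adj G v (lambda_op G h (v (p (lambda_op G g (p f)))))"
proof -
  let ?P = "group_vNa G S1" and ?Q = "commutant G (group_vNa G S2) \<inter> group_vNa G (carrier G)"
  have S1G: "S1 \<subseteq> carrier G" and S2G: "S2 \<subseteq> carrier G"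
    using S1 S2 by (auto dest: subgroup.subset)
  obtain p q \<theta> v where pP: "p \<in> ?P" and p: "is_projection G p" and qQ: "q \<in> ?Q"
    and \<theta>: "star_hom_on G (corner p ?P) (corner q ?Q) \<theta>"
    and vM: "v \<in> group_vNa G (carrier G)" and vqp: "v = q \<circ> v \<circ> p" and v0: "v \<noteq> zero_op"
    and \<theta>v: "\<And>x. x \<in> corner p ?P \<Longrightarrow> \<theta> x \<circ> v = v \<circ> x"
    using assms(3) unfolding intertwines_def by blast
  have rp: "rinv p" using pP group_vNa_mono[OF S1G] by (intro rinv_vNa) auto
  have rv: "rinv v" using vM by (rule rinv_vNa)
  note bp = rinv_bounded[OF rp] and bv = rinv_bounded[OF rv]
  have pp: "p \<circ> p = p" "adj G p = p" using p by (auto simp: is_projection_def)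
  have vp: "v \<circ> p = v"
    by (subst (1) vqp, subst (2) vqp) (simp add: comp_assoc pp(1))
  define X where "X g = p \<circ> lambda_op G g \<circ> p" for g
  have X: "X g \<in> corner p ?P" "bounded_op G (X g)" "adj G (X g) = X (inv g)" if g: "g \<in> S1" for g
  proof -
    have gG: "g \<in> carrier G" using g S1G by auto
    note bl = bounded_op_lambda[OF gG]
    show "X g \<in> corner p ?P"
      unfolding X_def corner_def using lambda_in_vNa[OF g gG] by blast
    show "bounded_op G (X g)" unfolding X_def by (intro bounded_op_comp bp bl)
    show "adj G (X g) = X (inv g)"
      unfolding X_def by (simp add: adj_comp bounded_op_comp bp bl adj_lambda[OF gG] pp(2) comp_assoc)
  qed
  \<comment> \<open>Elements of the corner have the form q y q with q and y in the commutant of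
    L(\<open>\<Sigma>2\<close>), hence commute with each \<lambda>_h.\<close>
  have \<theta>X: "bounded_op G (\<theta> (X g)) \<and> adj G (\<theta> (X g)) = \<theta> (X (inv g)) \<and>
      (\<forall>h\<in>S2. \<theta> (X g) \<circ> lambda_op G h = lambda_op G h \<circ> \<theta> (X g))" if g: "g \<in> S1" for g
  proof (intro conjI ballI)
    have "\<theta> (X g) \<in> corner q ?Q"
      using \<theta> X(1)[OF g] unfolding star_hom_on_def by blast
    then obtain y where y: "y \<in> ?Q" "\<theta> (X g) = q \<circ> y \<circ> q" by (auto simp: corner_def)
    have b: "bounded_op G q" "bounded_op G y"
      using qQ y by (auto dest: bounded_op_commutant)
    then show "bounded_op G (\<theta> (X g))" unfolding y(2) by (intro bounded_op_comp)
    have "\<theta> (adj G (X g)) = adj G (\<theta> (X g))"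
      using \<theta> X(1)[OF g] unfolding star_hom_on_def by blast
    then show "adj G (\<theta> (X g)) = \<theta> (X (inv g))" by (simp add: X(3)[OF g])
    fix h assume h: "h \<in> S2"
    have "lambda_op G h \<in> group_vNa G S2" using h S2G by (intro lambda_in_vNa) auto
    then have "q \<circ> lambda_op G h = lambda_op G h \<circ> q" "y \<circ> lambda_op G h = lambda_op G h \<circ> y"
      using qQ y(1) by (auto simp: commutant_def)
    then show "\<theta> (X g) \<circ> lambda_op G h = lambda_op G h \<circ> \<theta> (X g)"
      unfolding y(2) by (metis comp_assoc)
  qed
  have \<theta>Xv: "\<theta> (X g) (v f) = v (X g f)" if "g \<in> S1" for g f
    using \<theta>v[OF X(1)[OF that]] by (metis comp_apply)
  have "X g (adj G v (lambda_op G h (v f))) = adj G v (lambda_op G h (v (X g f)))"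
    if g: "g \<in> S1" and h: "h \<in> S2" and f: "f \<in> l2 G" for g h f
  proof (rule l2_eqI)
    have hG: "h \<in> carrier G" using h S2G by auto
    have ig: "inv g \<in> S1" using S1 g by (simp add: subgroup.m_inv_closed)
    note bX = X(2)[OF g] and bv' = bounded_op_adj[OF bv]
    have b\<theta>: "bounded_op G (\<theta> (X g))" using \<theta>X[OF g] by simp
    have vf: "lambda_op G h (v f) \<in> l2 G" using f hG by (intro lambda_l2 rinv_l2[OF rv])
    have Xf: "X g f \<in> l2 G" using bounded_op_l2[OF bX f] .
    show "X g (adj G v (lambda_op G h (v f))) \<in> l2 G"
      by (intro bounded_op_l2[OF bX] bounded_op_l2[OF bv'] vf)
    show "adj G v (lambda_op G h (v (X g f))) \<in> l2 G"
      by (intro bounded_op_l2[OF bv'] lambda_l2 hG rinv_l2[OF rv] Xf)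
    fix f' assume f': "f' \<in> l2 G"
    have Xf': "X (inv g) f' \<in> l2 G" using bounded_op_l2[OF X(2)[OF ig] f'] .
    have "l2_inner G f' (X g (adj G v (lambda_op G h (v f))))
        = l2_inner G (X (inv g) f') (adj G v (lambda_op G h (v f)))"
      using inner_adj_left[OF bX f' bounded_op_l2[OF bv' vf]] X(3)[OF g] by simp
    also have "\<dots> = l2_inner G (v (X (inv g) f')) (lambda_op G h (v f))"
      using inner_adj[OF bv Xf' vf] by simp
    also have "v (X (inv g) f') = adj G (\<theta> (X g)) (v f')"
      using \<theta>Xv[OF ig] \<theta>X[OF g] by simp
    also have "l2_inner G \<dots> (lambda_op G h (v f)) = l2_inner G (v f') (\<theta> (X g) (lambda_op G h (v f)))"
      using inner_adj_left[OF b\<theta> rinv_l2[OF rv f'] vf] .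
    also have "\<theta> (X g) (lambda_op G h (v f)) = lambda_op G h (\<theta> (X g) (v f))"
      using \<theta>X[OF g] h by (metis comp_apply)
    also have "\<dots> = lambda_op G h (v (X g f))" using \<theta>Xv[OF g] by simp
    also have "l2_inner G (v f') \<dots> = l2_inner G f' (adj G v (lambda_op G h (v (X g f))))"
      by (intro inner_adj[OF bv f'] lambda_l2 hG rinv_l2[OF rv] Xf)
    finally show "l2_inner G f' (X g (adj G v (lambda_op G h (v f))))
        = l2_inner G f' (adj G v (lambda_op G h (v (X g f))))" .
  qed
  then show ?thesis
    using that[OF rp pp(2,1) rv v0 vp] by (simp add: X_def)
qed

end

theorem theorem6p2:
  fixes G :: "('a, 'b) monoid_scheme" and \<Sigma>1 \<Sigma>2 :: "'a set"
  assumes "group G"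
    and "countable (carrier G)"
    and "subgroup \<Sigma>1 G" and "subgroup \<Sigma>2 G"
    and "intertwines G (group_vNa G (carrier G)) (group_vNa G \<Sigma>1)
           (commutant G (group_vNa G \<Sigma>2) \<inter> group_vNa G (carrier G))"
  shows "\<exists>k \<in> carrier G. \<exists>\<Omega>1 \<Omega>2.
           finite_index_subgroup G \<Omega>1 (conj_set G k \<Sigma>1) \<and>
           finite_index_subgroup G \<Omega>2 \<Sigma>2 \<and>
           finite (commutator_group G \<Omega>1 \<Omega>2) \<and>
           commutator_group G \<Omega>1 \<Omega>2 \<subseteq> centralizer_set G \<Omega>1 \<inter> centralizer_set G \<Omega>2"
proof -
  interpret group G by fact
  note S = assms(3,4)
  obtain p v where pv: "rinv p" "adj G p = p" "p \<circ> p = p" "rinv v" "v \<noteq> zero_op" "v \<circ> p = v"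
    and com: "\<And>g h f. g \<in> \<Sigma>1 \<Longrightarrow> h \<in> \<Sigma>2 \<Longrightarrow> f \<in> l2 G \<Longrightarrow>
      p (lambda_op G g (p (adj G v (lambda_op G h (v f))))) = adj G v (lambda_op G h (v (p (lambda_op G g (p f)))))"
    using intertwines_commuting_family[OF S assms(5)] by metis
  show ?thesis
  proof (rule generic_of_commuting_family[OF S pv com])
    fix I T E and N :: nat
    assume *: "finite I" "I \<subseteq> carrier G \<times> carrier G" "T \<subseteq> \<Sigma>2" "finite E" "E \<subseteq> \<Sigma>2"
      "\<Sigma>2 \<subseteq> (\<Union>f\<in>E. (\<lambda>d. f \<otimes>\<^bsub>G\<^esub> d) ` T)"
      and **: "\<And>h. h \<in> T \<Longrightarrow> \<exists>A. finite A \<and> A \<subseteq> \<Sigma>1 \<and> card A \<le> N \<and>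
      \<Sigma>1 \<subseteq> (\<Union>f\<in>A. (\<lambda>k. f \<otimes>\<^bsub>G\<^esub> k) ` {k \<in> \<Sigma>1. \<exists>(a, b)\<in>I. \<exists>(c, d)\<in>I.
        k \<otimes>\<^bsub>G\<^esub> (a \<otimes>\<^bsub>G\<^esub> h \<otimes>\<^bsub>G\<^esub> b) = (c \<otimes>\<^bsub>G\<^esub> h \<otimes>\<^bsub>G\<^esub> d) \<otimes>\<^bsub>G\<^esub> k})"
    show ?thesis
      by (rule finite_commutators_of_generic[OF S * **]) blast+
  qed
qed

end
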